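(* Let $m,n\in\mathbb{N}$ (positive integers). The Hausdorff dimension of the set of $s\in M_{m,n}$ which are singular on average (and hence of the set of singular $s\in M_{m,n}$) is at most $mn-\frac{mn}{m+n}$.
   Context: $M_{m,n}$ is the space of real $m\times n$ matrices with its Euclidean metric. For $s\in M_{m,n}$, $\varepsilon>0$ and $T>0$ consider the condition $$(\ast)_{\varepsilon,T}:\quad \exists\,\mathbf{q}\in\mathbb{Z}^n,\ \mathbf{p}\in\mathbb{Z}^m \text{ such that } \|s\mathbf{q}-\mathbf{p}\|<\frac{\varepsilon}{T^{n/m}}\ \text{ and }\ 0<\|\mathbf{q}\|<T,$$ where the norms are Euclidean norms. The matrix $s$ is called singular if for any $\varepsilon>0$ there exists $T_0\in\mathbb{N}$ such that $(\ast)_{\varepsilon,T}$ holds for all $T>T_0$. The matrix $s$ is called singular on average if for any $\varepsilon>0$ one has $$\lim_{N\to\infty}\frac1N\left|\left\{\ell\in\{1,\dots,N\}: (\ast)_{\varepsilon,T}\text{ holds for }T=2^\ell\right\}\right|=1.$$ *)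

theory Defs
  imports "HOL-Analysis.Analysis"
begin

text \<open>
  The weight of a covering set in dimension \<open>d\<close>: \<open>diam(U)^d\<close>. Since
  \<open>0 powr 0 = 0\<close>, the usual conventions (nonempty sets have weight 1 for
  \<open>d = 0\<close>, the empty set has weight 0) are made explicit.
\<close>

definition hausdorff_weight :: "real \<Rightarrow> 'a::metric_space set \<Rightarrow> real" where
  "hausdorff_weight d U =
     (if U = {} then 0 else if d = 0 then 1 else diameter U powr d)"

text \<open>
  Boundedness of the covering sets is required because \<open>diameter\<close> is real-valued
  and unspecified on unbounded sets. Finite covers are included, as the \<open>U i\<close> may be empty.
\<close>

definition hausdorff_content :: "real \<Rightarrow> real \<Rightarrow> 'a::metric_space set \<Rightarrow> ennreal" where
  "hausdorff_content d \<delta> A =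
     Inf {(\<Sum>i. ennreal (hausdorff_weight d (U i))) | U :: nat \<Rightarrow> 'a set.
            A \<subseteq> (\<Union>i. U i) \<and> (\<forall>i. bounded (U i) \<and> diameter (U i) \<le> \<delta>)}"

definition hausdorff_measure :: "real \<Rightarrow> 'a::metric_space set \<Rightarrow> ennreal" where
  "hausdorff_measure d A = (SUP \<delta>\<in>{0<..}. hausdorff_content d \<delta> A)"

definition hausdorff_dim :: "'a::metric_space set \<Rightarrow> ereal" where
  "hausdorff_dim A = Inf {ereal d | d. 0 \<le> d \<and> hausdorff_measure d A = 0}"

definition real_vec :: "int ^ 'n \<Rightarrow> real ^ 'n" where
  "real_vec v = (\<chi> i. real_of_int (v $ i))"

text \<open>
  An \<open>m \<times> n\<close> matrix is an element of \<^typ>\<open>real ^ 'n ^ 'm\<close>, so \<open>m = CARD('m)\<close> and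
  \<open>n = CARD('n)\<close>. The norm on \<^typ>\<open>real ^ 'n\<close> is Euclidean, and the metric on
  \<^typ>\<open>real ^ 'n ^ 'm\<close> is the Euclidean one on the \<open>m * n\<close> entries.
\<close>

definition approximable :: "real ^ 'n ^ 'm \<Rightarrow> real \<Rightarrow> real \<Rightarrow> bool" where
  "approximable s \<epsilon> T \<longleftrightarrow>
     (\<exists>(q :: int ^ 'n) (p :: int ^ 'm).
        norm (s *v real_vec q - real_vec p) < \<epsilon> / T powr (real CARD('n) / real CARD('m)) \<and>
        0 < norm (real_vec q) \<and> norm (real_vec q) < T)"

definition singular :: "real ^ 'n ^ 'm \<Rightarrow> bool" where
  "singular s \<longleftrightarrow> (\<forall>\<epsilon>>0. \<exists>T\<^sub>0::nat. \<forall>T::real. T > real T\<^sub>0 \<longrightarrow> approximable s \<epsilon> T)"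

definition singular_on_average :: "real ^ 'n ^ 'm \<Rightarrow> bool" where
  "singular_on_average s \<longleftrightarrow>
     (\<forall>\<epsilon>>0. (\<lambda>N::nat. real (card {l \<in> {1..N}. approximable s \<epsilon> (2 ^ l)}) / real N)
        \<longlonglongrightarrow> 1)"

end

theory Submission
  imports Defs "Jordan_Normal_Form.Determinant" "HOL-Probability.Probability"
begin

text \<open>
  A matrix \<open>s\<close> is singular on average iff the trajectory of the lattice
  \<open>{(p + s q, q)}\<close> under the diagonal flow expanding the first component and contracting the
  second spends asymptotically all of its time in the cusp. On the lattices there is a height, a
  sum over the ranks \<open>i\<close> of powers of the reciprocal of the least covolume of a rank \<open>i\<close> sublattice,
  whose average over a small cube of perturbations of \<open>s\<close> is contracted by
  almost \<open>A\<^sup>-\<^sup>m\<close> in one step of the flow, as long as the height is large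
  (\<open>A\<close> is the factor by which the first component is expanded).
  For a single sublattice this is a negative moment of the determinant of a random matrix;
  it applies unless two sublattices of the same rank compete, and then submodularity
  of the covolume compares the rank \<open>i\<close> with the ranks \<open>i - j\<close> and \<open>i + j\<close>.
  Iterating the contraction along the tree of subcubes bounds the number of cubes of side
  about \<open>L\<^sup>-\<^sup>N\<close>, \<open>L = A B\<close>, that stay in the cusp for almost all of the first \<open>N\<close> steps.
\<close>

text \<open>The bound comes from the arithmetic of the flow. With \<open>A\<close> = 2^(nk) and
  \<open>B\<close> = 2^(mk) one has A^m = B^n, so the flow is unimodular, and A^m = L^(mn/(m+n)). A
  cube has L^(mn) subcubes per step, and contraction by about A^(-m) leaves a growth of L^(mn -
  mn/(m+n)) per step. The exponents in the height are dictated by the wish that every rank contracts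
  at this same rate. They then sit at the edge of integrability in the ranks 1, m and m+n-1, so a
  small loss \<eta> has to be accepted. The constant in the contraction must not depend on the step
  size: taking k large then makes it harmless against the gap between the exponent D and the bound.
  What does depend on the step size, such as the distortion of one step, is absorbed by weights
  attached to the ranks, which are chosen last. A step outside the cusp costs a fixed factor, and
  such steps have density zero along the orbits in question.\<close>

no_notation Matrix.scalar_prod (infix \<open>\<bullet>\<close> 70)
no_notation Matrix.vec_index (infixl \<open>$\<close> 100)

section \<open>Gram determinants\<close>

definition gdet :: "'a::real_inner list \<Rightarrow> real" where
  "gdet xs = Determinant.det (Matrix.mat (length xs) (length xs) (\<lambda>(i, j). xs ! i \<bullet> xs ! j))"

text \<open>For an independent list this is the covolume of the lattice it generates; for a
  dependent list it is 0.\<close>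

definition vol :: "'a::real_inner list \<Rightarrow> real" where
  "vol xs = sqrt (gdet xs)"

text \<open>The Gram matrix transforms by congruence, so the coefficient matrix contributes its
  determinant twice. Independence is not assumed, so the coefficients may be any choice.\<close>

lemma gdet_change:
  assumes len: "length ys = length xs"
    and eq: "\<And>k. k < length xs \<Longrightarrow> ys ! k = (\<Sum>l<length xs. a k l *\<^sub>R xs ! l)"
  shows "gdet ys = (Determinant.det (Matrix.mat (length xs) (length xs) (\<lambda>(k, l). a k l)))\<^sup>2 * gdet xs"
proof -
  let ?n = "length xs"
  let ?A = "Matrix.mat ?n ?n (\<lambda>(k, l). a k l)"
  let ?G = "Matrix.mat ?n ?n (\<lambda>(i, j). xs ! i \<bullet> xs ! j)"
  have A: "?A \<in> carrier_mat ?n ?n" and G: "?G \<in> carrier_mat ?n ?n" by auto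
  have "Matrix.mat (length ys) (length ys) (\<lambda>(i, j). ys ! i \<bullet> ys ! j) = ?A * ?G * transpose_mat ?A"
    unfolding len
  proof (rule eq_matI)
    fix i j assume "i < dim_row (?A * ?G * transpose_mat ?A)" "j < dim_col (?A * ?G * transpose_mat ?A)"
    then have i: "i < ?n" and j: "j < ?n" by auto
    have AG: "(?A * ?G) $$ (i, l) = (\<Sum>k<?n. a i k * (xs ! k \<bullet> xs ! l))" if "l < ?n" for l
      using i that by (simp add: scalar_prod_def lessThan_atLeast0)
    have "(?A * ?G * transpose_mat ?A) $$ (i, j) = (\<Sum>l<?n. (?A * ?G) $$ (i, l) * a j l)"
      using i j by (subst index_mult_mat) (auto simp: scalar_prod_def lessThan_atLeast0 intro!: sum.cong)
    also have "\<dots> = (\<Sum>l<?n. (\<Sum>k<?n. a i k * (xs ! k \<bullet> xs ! l)) * a j l)"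
      using AG by simp
    also have "\<dots> = ys ! i \<bullet> ys ! j"
      unfolding eq[OF i] eq[OF j]
      by (simp add: inner_sum_left inner_sum_right sum_distrib_left sum_distrib_right mult_ac)
    finally show "Matrix.mat ?n ?n (\<lambda>(i, j). ys ! i \<bullet> ys ! j) $$ (i, j)
        = (?A * ?G * transpose_mat ?A) $$ (i, j)"
      using i j by simp
  qed auto
  then have "gdet ys = Determinant.det (?A * ?G * transpose_mat ?A)" by (simp add: gdet_def)
  also have "\<dots> = Determinant.det (?A * ?G) * Determinant.det (transpose_mat ?A)"
    by (rule det_mult[of _ ?n]) auto
  also have "Determinant.det (?A * ?G) = Determinant.det ?A * Determinant.det ?G"
    by (rule det_mult[of _ ?n]) auto
  also have "Determinant.det (transpose_mat ?A) = Determinant.det ?A"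
    by (rule det_transpose[OF A])
  finally show ?thesis by (simp add: gdet_def power2_eq_square)
qed

lemma span_list:
  assumes "y \<in> span (set xs)"
  shows "\<exists>c. y = (\<Sum>k<length xs. c k *\<^sub>R xs ! k)"
  using assms
proof (induction xs arbitrary: y rule: rev_induct)
  case Nil
  then show ?case by simp
next
  case (snoc x xs)
  then obtain t where "y - t *\<^sub>R x \<in> span (set xs)"
    by (auto simp: span_breakdown_eq)
  from snoc.IH[OF this] obtain c where c: "y - t *\<^sub>R x = (\<Sum>k<length xs. c k *\<^sub>R xs ! k)" by blast
  have "y = (\<Sum>k<length xs. c k *\<^sub>R xs ! k) + t *\<^sub>R x" using c by (simp add: algebra_simps)
  also have "\<dots> = (\<Sum>k<length (xs @ [x]). (c(length xs := t)) k *\<^sub>R (xs @ [x]) ! k)"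
    by (simp add: nth_append)
  finally show ?case by blast
qed

lemma list_sum_in_span: "(\<Sum>k<length xs. c k *\<^sub>R xs ! k) \<in> span (set xs)"
  by (intro span_sum span_scale span_base) simp

text \<open>The component \<open>y\<close> in the span is removed by a unipotent triangular change
  of the list; then the new vector is orthogonal to the others and the Gram matrix splits into two
  blocks.\<close>

lemma gdet_snoc:
  assumes y: "y \<in> span (set xs)" and z: "\<And>w. w \<in> span (set xs) \<Longrightarrow> z \<bullet> w = 0"
  shows "gdet (xs @ [y + z]) = gdet xs * (norm z)\<^sup>2"
proof -
  let ?n = "length xs"
  obtain c where c: "y = (\<Sum>k<?n. c k *\<^sub>R xs ! k)" using span_list[OF y] by blast
  define a where "a k l = (if k < ?n then (if k = l then 1 else 0) else if l < ?n then c l else (1::real))" for k l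
  let ?A = "Matrix.mat (Suc ?n) (Suc ?n) (\<lambda>(k, l). a k l)"
  have "gdet (xs @ [y + z]) = (Determinant.det (Matrix.mat (length (xs @ [z])) (length (xs @ [z])) (\<lambda>(k, l). a k l)))\<^sup>2 * gdet (xs @ [z])"
  proof (rule gdet_change)
    fix k assume k: "k < length (xs @ [z])"
    show "(xs @ [y + z]) ! k = (\<Sum>l<length (xs @ [z]). a k l *\<^sub>R (xs @ [z]) ! l)"
    proof (cases "k < ?n")
      case True
      then show ?thesis
        by (simp add: nth_append a_def if_distrib[of "\<lambda>t. t *\<^sub>R _"] sum.delta' cong: if_cong)
    next
      case False
      with k have "k = ?n" by simp
      then show ?thesis by (simp add: nth_append a_def c)
    qed
  qed simp
  moreover have "Determinant.det (Matrix.mat (length (xs @ [z])) (length (xs @ [z])) (\<lambda>(k, l). a k l)) = 1"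
  proof -
    have "Determinant.det ?A = prod_list (diag_mat ?A)"
      by (rule det_lower_triangular[of "Suc ?n"]) (auto simp: a_def)
    also have "diag_mat ?A = map (\<lambda>i. 1) [0..<Suc ?n]"
      unfolding diag_mat_def by (rule map_cong) (auto simp: a_def)
    also have "prod_list (map (\<lambda>i. 1::real) [0..<Suc ?n]) = 1"
      by (simp add: map_replicate_const)
    finally show ?thesis by simp
  qed
  moreover have "gdet (xs @ [z]) = gdet xs * (norm z)\<^sup>2"
  proof -
    have zx: "z \<bullet> xs ! k = 0" if "k < ?n" for k
      using that by (intro z span_base) simp
    have "Matrix.mat (length (xs @ [z])) (length (xs @ [z])) (\<lambda>(i, j). (xs @ [z]) ! i \<bullet> (xs @ [z]) ! j)
      = four_block_mat (Matrix.mat ?n ?n (\<lambda>(i, j). xs ! i \<bullet> xs ! j)) (0\<^sub>m ?n 1) (0\<^sub>m 1 ?n) (Matrix.mat 1 1 (\<lambda>_. z \<bullet> z))"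
      (is "?L = ?R")
    proof (rule eq_matI)
      fix i j assume "i < dim_row ?R" "j < dim_col ?R"
      then have ij: "i < Suc ?n" "j < Suc ?n" by auto
      consider "i < ?n" "j < ?n" | "i < ?n" "j = ?n" | "i = ?n" "j < ?n" | "i = ?n" "j = ?n"
        using ij by linarith
      then show "?L $$ (i, j) = ?R $$ (i, j)"
      proof cases
        case 2
        then show ?thesis using zx[of i] inner_commute[of z "xs ! i"] by (simp add: nth_append)
      qed (simp_all add: nth_append zx)
    qed auto
    then show ?thesis
      unfolding gdet_def
      by (simp add: det_four_block_mat_upper_right_zero[of _ ?n _ 1] det_single power2_norm_eq_inner)
  qed
  ultimately show ?thesis by simp
qed

lemma infdist_span:
  fixes S :: "'a::euclidean_space set"
  assumes "y \<in> span S" "\<And>w. w \<in> span S \<Longrightarrow> z \<bullet> w = 0"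
  shows "infdist (y + z) (span S) = norm z"
proof (rule antisym)
  show "infdist (y + z) (span S) \<le> norm z"
    using infdist_le[OF assms(1), of "y + z"] by (simp add: dist_norm)
  have "norm z \<le> dist (y + z) w" if "w \<in> span S" for w
  proof -
    have "z \<bullet> (y - w) = 0" using assms that by (simp add: span_diff)
    then have "(norm (y + z - w))\<^sup>2 = (norm z)\<^sup>2 + (norm (y - w))\<^sup>2"
      by (simp add: power2_norm_eq_inner inner_simps inner_commute)
    then have "(norm z)\<^sup>2 \<le> (norm (y + z - w))\<^sup>2" by simp
    then show ?thesis by (simp add: dist_norm)
  qed
  then show "norm z \<le> infdist (y + z) (span S)"
    using assms(1) by (auto simp: infdist_def intro!: cINF_greatest)
qed

lemma infdist_span_attained:
  fixes S :: "'a::euclidean_space set"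
  obtains y where "y \<in> span S" "infdist x (span S) = norm (x - y)" "\<And>w. w \<in> span S \<Longrightarrow> (x - y) \<bullet> w = 0"
proof -
  obtain y z where yz: "y \<in> span S" "\<And>w. w \<in> span S \<Longrightarrow> real_inner_class.orthogonal z w" "x = y + z"
    using orthogonal_subspace_decomp_exists by blast
  show thesis
    by (rule that[of y]) (use yz infdist_span[of y S z] in \<open>auto simp: real_inner_class.orthogonal_def\<close>)
qed

lemma gdet_nonneg: "0 \<le> gdet (xs :: 'a::euclidean_space list)"
proof (induction xs rule: rev_induct)
  case Nil
  then show ?case by (simp add: gdet_def)
next
  case (snoc x xs)
  obtain y where "y \<in> span (set xs)" "\<And>w. w \<in> span (set xs) \<Longrightarrow> (x - y) \<bullet> w = 0"
    using infdist_span_attained by blast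
  from gdet_snoc[OF this] snoc show ?case by simp
qed

section \<open>Volume as an iterated product of distances\<close>

lemma vol_nonneg [simp]: "0 \<le> vol (xs :: 'a::euclidean_space list)"
  by (simp add: vol_def gdet_nonneg)

lemma vol_Nil [simp]: "vol [] = 1"
  by (simp add: vol_def gdet_def)

text \<open>Base times height. Most estimates of \<open>vol\<close> below are inductions along this
  recursion.\<close>

lemma vol_snoc:
  fixes xs :: "'a::euclidean_space list"
  shows "vol (xs @ [x]) = vol xs * infdist x (span (set xs))"
proof -
  obtain y where "y \<in> span (set xs)" "infdist x (span (set xs)) = norm (x - y)"
     "\<And>w. w \<in> span (set xs) \<Longrightarrow> (x - y) \<bullet> w = 0"
    using infdist_span_attained by blast
  with gdet_snoc[of y xs "x - y"] show ?thesis
    by (simp add: vol_def real_sqrt_mult)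
qed

text \<open>Each appended vector is at most as far from the larger span as from the smaller one.
  This is the analytic half of submodularity; the other half is the existence of adapted
  bases.\<close>

lemma vol_append_le:
  fixes xs :: "'a::euclidean_space list"
  assumes "set xs \<subseteq> span (set ys)"
  shows "vol (ys @ zs) * vol xs \<le> vol ys * vol (xs @ zs)"
proof (induction zs rule: rev_induct)
  case Nil
  then show ?case by simp
next
  case (snoc z zs)
  have "span (set (xs @ zs)) \<subseteq> span (set (ys @ zs))"
    using assms by (intro span_minimal) (auto intro: span_base subsetD[OF span_mono, rotated])
  then have "infdist z (span (set (ys @ zs))) \<le> infdist z (span (set (xs @ zs)))"
    by (intro infdist_mono) (use span_zero in blast)+
  with snoc have "(vol (ys @ zs) * vol xs) * infdist z (span (set (ys @ zs)))
      \<le> (vol ys * vol (xs @ zs)) * infdist z (span (set (xs @ zs)))"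
    by (intro mult_mono[of "vol (ys @ zs) * vol xs"]) (auto simp: infdist_nonneg)
  then show ?case
    unfolding append_assoc[symmetric] vol_snoc by (simp add: mult_ac)
qed

text \<open>The nearest point in the span is mapped into the image span, so every height grows by at
  most \<open>K\<close>.\<close>

lemma vol_map_le:
  fixes f :: "'a::euclidean_space \<Rightarrow> 'b::euclidean_space"
  assumes f: "linear f" and K: "\<And>x. norm (f x) \<le> K * norm x" "0 \<le> K"
  shows "vol (map f xs) \<le> K ^ length xs * vol xs"
proof (induction xs rule: rev_induct)
  case Nil
  then show ?case by simp
next
  case (snoc x xs)
  obtain y where y: "y \<in> span (set xs)" "infdist x (span (set xs)) = norm (x - y)"
    using infdist_span_attained by blast
  have "f y \<in> span (set (map f xs))"
    using y(1) linear_span_image[OF f, of "set xs"] by auto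
  then have "infdist (f x) (span (set (map f xs))) \<le> norm (f x - f y)"
    using infdist_le by (metis dist_norm)
  also have "\<dots> \<le> K * infdist x (span (set xs))"
    using K(1)[of "x - y"] y(2) by (simp add: linear_diff[OF f])
  finally have "vol (map f xs) * infdist (f x) (span (set (map f xs)))
    \<le> (K ^ length xs * vol xs) * (K * infdist x (span (set xs)))"
    using K(2) snoc by (intro mult_mono) (auto simp: infdist_nonneg)
  then show ?case by (simp add: vol_snoc mult_ac)
qed

text \<open>Hadamard's inequality with a common bound on the norms.\<close>

lemma vol_le_prod_norm:
  fixes xs :: "'a::euclidean_space list"
  assumes "\<And>x. x \<in> set xs \<Longrightarrow> norm x \<le> K"
  shows "vol xs \<le> K ^ length xs"
  using assms
proof (induction xs rule: rev_induct)
  case Nil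
  then show ?case by simp
next
  case (snoc x xs)
  have "infdist x (span (set xs)) \<le> norm x"
    using infdist_le[of 0 "span (set xs)" x] by (simp add: span_zero)
  also have "\<dots> \<le> K" using snoc.prems by simp
  finally have "infdist x (span (set xs)) \<le> K" .
  moreover have "0 \<le> K" using snoc.prems[of x] norm_ge_zero[of x] by (simp add: order_trans[OF norm_ge_zero])
  moreover have "vol xs \<le> K ^ length xs" using snoc by auto
  ultimately have "vol xs * infdist x (span (set xs)) \<le> K ^ length xs * K"
    by (intro mult_mono) (auto simp: infdist_nonneg)
  then show ?case by (simp add: vol_snoc mult_ac)
qed

lemma vol_pos_independent:
  fixes xs :: "'a::euclidean_space list"
  assumes "vol xs > 0"
  shows "distinct xs \<and> independent (set xs)"
  using assms
proof (induction xs rule: rev_induct)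
  case Nil
  then show ?case by (simp add: independent_empty)
next
  case (snoc x xs)
  then have *: "vol xs * infdist x (span (set xs)) > 0" by (simp add: vol_snoc)
  then have v: "vol xs > 0" and d: "infdist x (span (set xs)) \<noteq> 0"
    using vol_nonneg[of xs] infdist_nonneg[of x "span (set xs)"] by (auto simp: zero_less_mult_iff)
  have "x \<notin> span (set xs)" using d infdist_zero by blast
  with snoc.IH[OF v] show ?case
    by (auto simp: independent_insert span_base)
qed

lemma length_le_DIM:
  fixes xs :: "'a::euclidean_space list"
  assumes "vol xs > 0"
  shows "length xs \<le> DIM('a)"
  using vol_pos_independent[OF assms] independent_bound[of "set xs"]
  by (auto simp: distinct_card)

lemma dim_span_list:
  fixes xs :: "'a::euclidean_space list"
  assumes "vol xs > 0"
  shows "dim (span (set xs)) = length xs"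
  using vol_pos_independent[OF assms] by (simp add: dim_eq_card_independent distinct_card)

lemma vol_snoc_pos:
  fixes xs :: "'a::euclidean_space list"
  assumes "vol xs > 0" "x \<notin> span (set xs)"
  shows "vol (xs @ [x]) > 0"
proof -
  have "infdist x (span (set xs)) \<noteq> 0"
    using assms(2) in_closed_iff_infdist_zero[of "span (set xs)" x] closed_span[of "set xs"]
    by (auto intro: span_zero)
  then have "infdist x (span (set xs)) > 0" using infdist_nonneg[of x "span (set xs)"] by linarith
  with assms(1) show ?thesis by (simp add: vol_snoc)
qed

text \<open>Both volumes change by the same coefficient determinant, so the distortion by
  \<open>g\<close> depends only on the spanned subspace. It lets a lattice basis be replaced by any
  convenient basis of its span.\<close>

lemma vol_ratio:
  fixes xs ys :: "'a::euclidean_space list" and g :: "'a \<Rightarrow> 'b::euclidean_space"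
  assumes len: "length ys = length xs" and sub: "set ys \<subseteq> span (set xs)" and g: "linear g"
  shows "vol (map g ys) * vol xs = vol ys * vol (map g xs)"
proof -
  have "\<exists>c. ys ! k = (\<Sum>l<length xs. c l *\<^sub>R xs ! l)" if "k < length xs" for k
    using that len sub by (intro span_list) (auto dest: nth_mem)
  then obtain a where a: "\<And>k. k < length xs \<Longrightarrow> ys ! k = (\<Sum>l<length xs. a k l *\<^sub>R xs ! l)" by metis
  let ?d = "(Determinant.det (Matrix.mat (length xs) (length xs) (\<lambda>(k, l). a k l)))\<^sup>2"
  have 1: "gdet ys = ?d * gdet xs" by (rule gdet_change[OF len a])
  have 2: "gdet (map g ys) = ?d * gdet (map g xs)"
    using gdet_change[of "map g ys" "map g xs" a] len a
    by (simp add: linear_sum[OF g] linear_scale[OF g] o_def)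
  show ?thesis unfolding vol_def 1 2 by (simp add: real_sqrt_mult mult_ac)
qed

lemma vol_pos_in_span:
  fixes xs ys :: "'a::euclidean_space list"
  assumes len: "length ys = length xs" and sub: "set ys \<subseteq> span (set xs)" and pos: "vol ys > 0"
  shows "vol xs > 0"
proof -
  have "\<exists>c. ys ! k = (\<Sum>l<length xs. c l *\<^sub>R xs ! l)" if "k < length xs" for k
    using that len sub by (intro span_list) (auto dest: nth_mem)
  then obtain a where a: "\<And>k. k < length xs \<Longrightarrow> ys ! k = (\<Sum>l<length xs. a k l *\<^sub>R xs ! l)" by metis
  have "gdet xs \<noteq> 0" using gdet_change[OF len a] pos by (auto simp: vol_def)
  then show ?thesis using gdet_nonneg[of xs] by (auto simp: vol_def less_le)
qed

text \<open>Jacobi's identity for complementary minors: \<open>Y\<close> is the dual basis of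
  \<open>X\<close> in the same span, hence its Gram matrix is the inverse of that of
  \<open>X\<close>.\<close>

lemma gdet_complement:
  fixes X Y :: "'a::real_inner list"
  assumes len: "length Y = length X" and i: "i \<le> length X"
    and sub: "set Y \<subseteq> span (set X)"
    and bi: "\<And>k l. k < length X \<Longrightarrow> l < length X \<Longrightarrow> X ! k \<bullet> Y ! l = (if k = l then 1 else 0)"
  shows "gdet (take i X) = gdet X * gdet (drop i Y)"
proof -
  let ?n = "length X"
  let ?G = "Matrix.mat ?n ?n (\<lambda>(r, c). X ! r \<bullet> X ! c)"
  let ?H = "Matrix.mat ?n ?n (\<lambda>(r, c). Y ! r \<bullet> Y ! c)"
  have "\<exists>c. Y ! k = (\<Sum>l<?n. c l *\<^sub>R X ! l)" if "k < ?n" for k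
    using that len sub by (intro span_list) (auto dest: nth_mem)
  then obtain a where a: "\<And>k. k < ?n \<Longrightarrow> Y ! k = (\<Sum>l<?n. a k l *\<^sub>R X ! l)" by metis
  have ak: "Y ! k \<bullet> Y ! l = a k l" if "k < ?n" "l < ?n" for k l
    by (subst a[OF that(1)]) (simp add: inner_sum_left bi that if_distrib[of "\<lambda>t. _ * t"] sum.delta cong: if_cong)
  have HG: "?H * ?G = 1\<^sub>m ?n"
  proof (rule eq_matI)
    fix r c assume "r < dim_row (1\<^sub>m ?n)" "c < dim_col (1\<^sub>m ?n)"
    then have r: "r < ?n" and c: "c < ?n" by auto
    have "(?H * ?G) $$ (r, c) = (\<Sum>k<?n. (Y ! r \<bullet> Y ! k) * (X ! k \<bullet> X ! c))"
      using r c by (simp add: scalar_prod_def lessThan_atLeast0)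
    also have "\<dots> = (\<Sum>k<?n. a r k * (X ! k \<bullet> X ! c))" using ak r by simp
    also have "\<dots> = Y ! r \<bullet> X ! c" by (simp add: a[OF r] inner_sum_left)
    also have "\<dots> = 1\<^sub>m ?n $$ (r, c)" using bi[OF c r] r c by (simp add: inner_commute)
    finally show "(?H * ?G) $$ (r, c) = 1\<^sub>m ?n $$ (r, c)" .
  qed auto
  have GH: "?G * ?H = 1\<^sub>m ?n"
    using mat_mult_left_right_inverse[OF _ _ HG] by simp
  \<comment> \<open>Multiplying the Gram matrix of \<open>X\<close> by \<open>M1\<close> keeps its
    first i columns and turns the others into unit vectors. Both \<open>M1\<close> and the product
    are block triangular, and determinants give the identity.\<close>
  define M1 where "M1 = Matrix.mat ?n ?n (\<lambda>(r, c). if c < i then (if r = c then 1 else 0) else Y ! r \<bullet> Y ! c)"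
  define M2 where "M2 = Matrix.mat ?n ?n (\<lambda>(r, c). if c < i then X ! r \<bullet> X ! c else (if r = c then 1 else 0))"
  have prod: "?G * M1 = M2"
  proof (rule eq_matI)
    fix r c assume "r < dim_row M2" "c < dim_col M2"
    then have r: "r < ?n" and c: "c < ?n" by (auto simp: M2_def)
    have 1: "(?G * M1) $$ (r, c) = (\<Sum>k<?n. (X ! r \<bullet> X ! k) * (if c < i then (if k = c then 1 else 0) else Y ! k \<bullet> Y ! c))"
      using r c by (simp add: scalar_prod_def lessThan_atLeast0 M1_def)
    have 2: "(\<Sum>k<?n. (X ! r \<bullet> X ! k) * (Y ! k \<bullet> Y ! c)) = (if r = c then 1 else 0)"
      using arg_cong[OF GH, of "\<lambda>M. M $$ (r, c)"] r c by (simp add: scalar_prod_def lessThan_atLeast0)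
    show "(?G * M1) $$ (r, c) = M2 $$ (r, c)"
      using r c 2 by (auto simp: 1 M2_def if_distrib[of "\<lambda>t. _ * t"] sum.delta cong: if_cong)
  qed (auto simp: M1_def M2_def)
  have d1: "Determinant.det M1 = gdet (drop i Y)"
  proof -
    have "M1 = four_block_mat (1\<^sub>m i) (Matrix.mat i (?n - i) (\<lambda>(r, c). Y ! r \<bullet> Y ! (c + i)))
       (0\<^sub>m (?n - i) i) (Matrix.mat (?n - i) (?n - i) (\<lambda>(r, c). Y ! (r + i) \<bullet> Y ! (c + i)))"
      (is "_ = ?R")
    proof (rule eq_matI)
      fix r c assume "r < dim_row ?R" "c < dim_col ?R"
      then have "r < ?n" "c < ?n" using i by auto
      then show "M1 $$ (r, c) = ?R $$ (r, c)"
        using i by (cases "r < i"; cases "c < i") (simp_all add: M1_def)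
    qed (use i in \<open>simp_all add: M1_def\<close>)
    then show ?thesis
      using i len by (simp add: det_four_block_mat_lower_left_zero[of _ i _ "?n - i"] gdet_def add.commute)
  qed
  have d2: "Determinant.det M2 = gdet (take i X)"
  proof -
    have "M2 = four_block_mat (Matrix.mat i i (\<lambda>(r, c). X ! r \<bullet> X ! c)) (0\<^sub>m i (?n - i))
       (Matrix.mat (?n - i) i (\<lambda>(r, c). X ! (r + i) \<bullet> X ! c)) (1\<^sub>m (?n - i))"
      (is "_ = ?R")
    proof (rule eq_matI)
      fix r c assume "r < dim_row ?R" "c < dim_col ?R"
      then have "r < ?n" "c < ?n" using i by auto
      then show "M2 $$ (r, c) = ?R $$ (r, c)"
        using i by (cases "r < i"; cases "c < i") (simp_all add: M2_def eq_diff_iff not_less)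
    qed (use i in \<open>simp_all add: M2_def\<close>)
    then have "Determinant.det M2 = Determinant.det (Matrix.mat i i (\<lambda>(r, c). X ! r \<bullet> X ! c))"
      using i by (simp add: det_four_block_mat_upper_right_zero[of _ i _ "?n - i"])
    also have "Matrix.mat i i (\<lambda>(r, c). X ! r \<bullet> X ! c)
       = Matrix.mat i i (\<lambda>(r, c). take i X ! r \<bullet> take i X ! c)"
      by (intro cong_mat) auto
    finally show ?thesis
      using i by (simp add: gdet_def min_def)
  qed
  have "Determinant.det M2 = Determinant.det ?G * Determinant.det M1"
    unfolding prod[symmetric] by (rule det_mult[of _ ?n]) (auto simp: M1_def)
  then show ?thesis unfolding d1 d2 gdet_def by simp
qed

lemma det_in_Ints:
  fixes f :: "nat \<Rightarrow> nat \<Rightarrow> real"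
  assumes "\<And>i j. i < n \<Longrightarrow> j < n \<Longrightarrow> f i j \<in> \<int>"
  shows "Determinant.det (Matrix.mat n n (\<lambda>(i, j). f i j)) \<in> \<int>"
proof -
  have "(\<Prod>i = 0..<n. f i (p i)) \<in> \<int>" if "p permutes {0..<n}" for p
    using that assms by (intro Ints_prod) (auto simp: permutes_in_image)
  moreover have "signof p \<in> (\<int> :: real set)" for p by (simp add: sign_def)
  moreover have "Matrix.mat n n (\<lambda>(i, j). f i j) $$ (i, p i) = f i (p i)"
    if "p permutes {0..<n}" "i < n" for p i
    using that permutes_in_image[OF that(1), of i] by simp
  ultimately show ?thesis
    by (subst det_def'[of _ n]) (auto intro!: Ints_sum Ints_mult)
qed

section \<open>Integer vectors\<close>

definition Zlat :: "'a::euclidean_space set" where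
  "Zlat = {v. \<forall>b\<in>Basis. v \<bullet> b \<in> \<int>}"

definition Zsp :: "'a::euclidean_space list \<Rightarrow> 'a set" where
  "Zsp xs = range (\<lambda>c :: nat \<Rightarrow> int. \<Sum>k<length xs. of_int (c k) *\<^sub>R xs ! k)"

lemma Zlat_0 [simp]: "0 \<in> Zlat"
  and Zlat_add: "x \<in> Zlat \<Longrightarrow> y \<in> Zlat \<Longrightarrow> x + y \<in> Zlat"
  and Zlat_diff: "x \<in> Zlat \<Longrightarrow> y \<in> Zlat \<Longrightarrow> x - y \<in> Zlat"
  and Zlat_scale: "x \<in> Zlat \<Longrightarrow> of_int k *\<^sub>R x \<in> Zlat"
  by (auto simp: Zlat_def inner_simps)

lemma Zlat_sum: "(\<And>i. i \<in> I \<Longrightarrow> f i \<in> Zlat) \<Longrightarrow> sum f I \<in> Zlat"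
  by (induction I rule: infinite_finite_induct) (auto intro: Zlat_add)

lemma Zlat_Basis: "b \<in> Basis \<Longrightarrow> b \<in> Zlat"
  by (auto simp: Zlat_def inner_Basis)

lemma Zlat_inner: "x \<in> Zlat \<Longrightarrow> y \<in> Zlat \<Longrightarrow> x \<bullet> y \<in> \<int>"
  by (subst euclidean_inner) (auto simp: Zlat_def intro!: Ints_sum Ints_mult)

text \<open>A positive Gram determinant of integer vectors is a positive integer.\<close>

lemma vol_Zlat_ge_1:
  assumes "set xs \<subseteq> Zlat" "vol xs > 0"
  shows "vol xs \<ge> 1"
proof -
  have "gdet xs \<in> \<int>"
    unfolding gdet_def using assms(1) by (intro det_in_Ints Zlat_inner) auto
  moreover have "gdet xs > 0" using assms(2) by (simp add: vol_def)
  ultimately have "gdet xs \<ge> 1" by (auto elim!: Ints_cases)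
  then show ?thesis by (simp add: vol_def)
qed

lemma finite_Zlat_bounded: "finite {v \<in> Zlat. norm (v :: 'a::euclidean_space) \<le> R}"
proof (rule finite_subset)
  let ?S = "{k \<in> \<int>. \<bar>k\<bar> \<le> R}"
  show "{v \<in> Zlat. norm (v :: 'a) \<le> R} \<subseteq> (\<lambda>f. \<Sum>b\<in>Basis. f b *\<^sub>R b) ` (Basis \<rightarrow>\<^sub>E ?S)"
  proof
    fix v :: 'a assume v: "v \<in> {v \<in> Zlat. norm v \<le> R}"
    have "v = (\<Sum>b\<in>Basis. restrict (\<lambda>b. v \<bullet> b) Basis b *\<^sub>R b)"
      by (simp add: euclidean_representation)
    moreover have "restrict (\<lambda>b. v \<bullet> b) Basis \<in> Basis \<rightarrow>\<^sub>E ?S"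
      using v Basis_le_norm[of _ v] by (auto simp: Zlat_def intro: order_trans)
    ultimately show "v \<in> (\<lambda>f. \<Sum>b\<in>Basis. f b *\<^sub>R b) ` (Basis \<rightarrow>\<^sub>E ?S)" by blast
  qed
  show "finite ((\<lambda>f. \<Sum>b\<in>(Basis :: 'a set). f b *\<^sub>R b) ` (Basis \<rightarrow>\<^sub>E ?S))"
    by (intro finite_imageI finite_PiE finite_abs_int_segment) auto
qed

lemma ZspI: "x = (\<Sum>k<length xs. of_int (c k) *\<^sub>R xs ! k) \<Longrightarrow> x \<in> Zsp xs"
  by (auto simp: Zsp_def)

lemma Zsp_base: "x \<in> set xs \<Longrightarrow> x \<in> Zsp xs"
proof -
  assume "x \<in> set xs"
  then obtain i where i: "i < length xs" "x = xs ! i" by (auto simp: in_set_conv_nth)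
  then have "x = (\<Sum>k<length xs. of_int (if k = i then 1 else 0) *\<^sub>R xs ! k)"
    by (simp add: if_distrib[of "\<lambda>t. of_int t *\<^sub>R _"] sum.delta cong: if_cong)
  then show ?thesis by (rule ZspI[where c = "\<lambda>k. if k = i then 1 else 0"])
qed

lemma Zsp_add: "x \<in> Zsp xs \<Longrightarrow> y \<in> Zsp xs \<Longrightarrow> x + y \<in> Zsp xs"
proof -
  assume "x \<in> Zsp xs" "y \<in> Zsp xs"
  then obtain c d where "x = (\<Sum>k<length xs. of_int (c k) *\<^sub>R xs ! k)" "y = (\<Sum>k<length xs. of_int (d k) *\<^sub>R xs ! k)"
    by (auto simp: Zsp_def)
  then have "x + y = (\<Sum>k<length xs. of_int (c k + d k) *\<^sub>R xs ! k)"
    by (simp add: sum.distrib scaleR_add_left)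
  then show ?thesis by (rule ZspI[where c = "\<lambda>k. c k + d k"])
qed

lemma Zsp_scale: "x \<in> Zsp xs \<Longrightarrow> of_int t *\<^sub>R x \<in> Zsp xs"
proof -
  assume "x \<in> Zsp xs"
  then obtain c where "x = (\<Sum>k<length xs. of_int (c k) *\<^sub>R xs ! k)"
    by (auto simp: Zsp_def)
  then have "of_int t *\<^sub>R x = (\<Sum>k<length xs. of_int (t * c k) *\<^sub>R xs ! k)"
    by (simp add: scaleR_sum_right)
  then show ?thesis by (rule ZspI[where c = "\<lambda>k. t * c k"])
qed

lemma Zsp_sum: "(\<And>i. i \<in> I \<Longrightarrow> f i \<in> Zsp xs) \<Longrightarrow> sum f I \<in> Zsp xs"
proof (induction I rule: infinite_finite_induct)
  case (insert x F)
  then show ?case by (auto intro: Zsp_add)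
qed (auto simp: Zsp_def intro!: range_eqI[of _ _ "\<lambda>_. 0"])

lemma Zsp_mono:
  assumes "set ys \<subseteq> Zsp xs"
  shows "Zsp ys \<subseteq> Zsp xs"
proof
  fix y assume "y \<in> Zsp ys"
  then obtain c where "y = (\<Sum>k<length ys. of_int (c k) *\<^sub>R ys ! k)" by (auto simp: Zsp_def)
  then show "y \<in> Zsp xs" using assms by (auto intro!: Zsp_sum Zsp_scale)
qed

lemma Zsp_Zlat: "set xs \<subseteq> Zlat \<Longrightarrow> Zsp xs \<subseteq> Zlat"
  by (auto simp: Zsp_def intro!: Zlat_sum Zlat_scale)

text \<open>Lists that generate the same group have integral transition matrices in both directions.
  If the Gram determinant of the image is nonzero, the product of the two squared determinants is 1,
  so each square is 1.\<close>

lemma vol_Zsp_eq: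
  fixes h :: "'a::euclidean_space \<Rightarrow> 'b::euclidean_space"
  assumes len: "length ys = length xs" and 1: "set ys \<subseteq> Zsp xs" and 2: "set xs \<subseteq> Zsp ys"
    and h: "linear h"
  shows "vol (map h ys) = vol (map h xs)"
proof -
  have "\<exists>c :: nat \<Rightarrow> int. ys ! k = (\<Sum>l<length xs. of_int (c l) *\<^sub>R xs ! l)" if "k < length xs" for k
  proof -
    have "ys ! k \<in> Zsp xs" using 1 len that by auto
    then show ?thesis by (auto simp: Zsp_def)
  qed
  then obtain a :: "nat \<Rightarrow> nat \<Rightarrow> int"
    where a: "\<And>k. k < length xs \<Longrightarrow> ys ! k = (\<Sum>l<length xs. of_int (a k l) *\<^sub>R xs ! l)" by metis
  have "\<exists>c :: nat \<Rightarrow> int. xs ! k = (\<Sum>l<length ys. of_int (c l) *\<^sub>R ys ! l)" if "k < length ys" for k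
  proof -
    have "xs ! k \<in> Zsp ys" using 2 len that by auto
    then show ?thesis by (auto simp: Zsp_def)
  qed
  then obtain b :: "nat \<Rightarrow> nat \<Rightarrow> int"
    where b: "\<And>k. k < length ys \<Longrightarrow> xs ! k = (\<Sum>l<length ys. of_int (b k l) *\<^sub>R ys ! l)" by metis
  let ?A = "Determinant.det (Matrix.mat (length xs) (length xs) (\<lambda>(k, l). real_of_int (a k l)))"
  let ?B = "Determinant.det (Matrix.mat (length ys) (length ys) (\<lambda>(k, l). real_of_int (b k l)))"
  have gA: "gdet (map h ys) = ?A\<^sup>2 * gdet (map h xs)"
    using gdet_change[of "map h ys" "map h xs" "\<lambda>k l. of_int (a k l)"] len a
    by (simp add: linear_sum[OF h] linear_scale[OF h] o_def)
  have gB: "gdet (map h xs) = ?B\<^sup>2 * gdet (map h ys)"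
    using gdet_change[of "map h xs" "map h ys" "\<lambda>k l. of_int (b k l)"] len b
    by (simp add: linear_sum[OF h] linear_scale[OF h] o_def)
  have "?A \<in> \<int>" "?B \<in> \<int>" by (intro det_in_Ints; simp)+
  then obtain A B :: int where AB: "?A = of_int A" "?B = of_int B" by (auto elim!: Ints_cases)
  have "gdet (map h ys) = gdet (map h xs)"
  proof (cases "gdet (map h xs) = 0")
    case True
    then show ?thesis using gA by simp
  next
    case False
    have "gdet (map h xs) = (?B\<^sup>2 * ?A\<^sup>2) * gdet (map h xs)" using gA gB by (simp only: mult.assoc)
    then have "?B\<^sup>2 * ?A\<^sup>2 = 1" using False by (simp only: mult_cancel_right1 mult_cancel_right2) auto
    then have "real_of_int (B\<^sup>2 * A\<^sup>2) = of_int 1" unfolding AB by simp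
    then have "B\<^sup>2 * A\<^sup>2 = 1" by (simp only: of_int_eq_iff)
    then have "A\<^sup>2 = 1" 
      using zmult_eq_1_iff[of "B\<^sup>2" "A\<^sup>2"] zero_le_power2[of "A"] by linarith
    then show ?thesis using gA AB by (simp flip: of_int_power)
  qed
  then show ?thesis by (simp add: vol_def)
qed

text \<open>
  Multiples of a real relation are rounded to integer relations with bounded error; two of them
  have the same error.
\<close>

lemma integer_relation:
  fixes b :: "'a::euclidean_space"
  assumes b: "b \<in> Zlat" and ys: "set ys \<subseteq> Zlat" and sp: "b \<in> span (set ys)"
  obtains a0 :: int and a :: "nat \<Rightarrow> int"
  where "a0 \<noteq> 0" "of_int a0 *\<^sub>R b = (\<Sum>k<length ys. of_int (a k) *\<^sub>R ys ! k)"
proof -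
  obtain c where c: "b = (\<Sum>k<length ys. c k *\<^sub>R ys ! k)" using span_list[OF sp] by blast
  define r where "r N = real N *\<^sub>R b - (\<Sum>k<length ys. of_int \<lfloor>real N * c k\<rfloor> *\<^sub>R ys ! k)" for N :: nat
  define R where "R = (\<Sum>k<length ys. norm (ys ! k))"
  have "r N \<in> Zlat" for N
  proof -
    have "of_int (int N) *\<^sub>R b \<in> Zlat" by (rule Zlat_scale[OF b])
    then show ?thesis unfolding r_def
      using ys by (intro Zlat_diff Zlat_sum Zlat_scale) auto
  qed
  moreover have "norm (r N) \<le> R" for N
  proof -
    have "r N = (\<Sum>k<length ys. (real N * c k - of_int \<lfloor>real N * c k\<rfloor>) *\<^sub>R ys ! k)"
      unfolding r_def by (subst c) (simp add: scaleR_sum_right sum_subtractf scaleR_diff_left)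
    also have "norm \<dots> \<le> (\<Sum>k<length ys. norm ((real N * c k - of_int \<lfloor>real N * c k\<rfloor>) *\<^sub>R ys ! k))"
      by (rule norm_sum)
    also have "\<dots> \<le> R" unfolding R_def
    proof (intro sum_mono)
      fix k
      have "\<bar>real N * c k - of_int \<lfloor>real N * c k\<rfloor>\<bar> \<le> 1" by linarith
      then show "norm ((real N * c k - of_int \<lfloor>real N * c k\<rfloor>) *\<^sub>R ys ! k) \<le> norm (ys ! k)"
        by (simp add: mult_left_le_one_le)
    qed
    finally show ?thesis .
  qed
  ultimately have "range r \<subseteq> {v \<in> Zlat. norm v \<le> R}" by auto
  then have "finite (range r)" using finite_Zlat_bounded finite_subset by blast
  then have "\<not> inj r" using finite_imageD by blast
  then obtain M N where MN: "r M = r N" "M \<noteq> N" by (auto simp: inj_def)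
  have "of_int (int M - int N) *\<^sub>R b = (\<Sum>k<length ys. of_int (\<lfloor>real M * c k\<rfloor> - \<lfloor>real N * c k\<rfloor>) *\<^sub>R ys ! k)"
    using MN(1) unfolding r_def by (simp add: algebra_simps sum_subtractf)
  moreover have "int M - int N \<noteq> 0" using MN(2) by simp
  ultimately show thesis by (intro that)
qed


lemma vol_prefix_pos:
  fixes xs :: "'a::euclidean_space list"
  assumes "vol (xs @ ys) > 0"
  shows "vol xs > 0"
  using assms
proof (induction ys rule: rev_induct)
  case Nil
  then show ?case by simp
next
  case (snoc y ys)
  then have "vol (xs @ ys) * infdist y (span (set (xs @ ys))) > 0"
    using vol_snoc[of "xs @ ys" y] by simp
  then have "vol (xs @ ys) > 0"
    using vol_nonneg[of "xs @ ys"] infdist_nonneg[of y "span (set (xs @ ys))"]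
    by (simp only: zero_less_mult_iff) linarith
  then show ?case by (rule snoc.IH)
qed

lemma sum_remove2:
  fixes f :: "'b \<Rightarrow> 'c::comm_monoid_add"
  assumes "finite K" "p \<in> K" "q \<in> K" "p \<noteq> q"
  shows "sum f K = f p + (f q + sum f (K - {p, q}))"
proof -
  have "sum f K = f p + sum f (K - {p})" using assms by (simp add: sum.remove)
  also have "sum f (K - {p}) = f q + sum f (K - {p} - {q})" using assms by (intro sum.remove) auto
  also have "K - {p} - {q} = K - {p, q}" by auto
  finally show ?thesis .
qed

lemma Zsp_span: "Zsp xs \<subseteq> span (set xs)"
  by (auto simp: Zsp_def intro: list_sum_in_span)

text \<open>
  Among the bases of the lattice generated by \<open>z'\<close>, take one with the fewest elements outside the
  span of \<open>z\<close>. An integer relation between these elements modulo the span could be shortened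
  by Euclid's algorithm until one of the elements lies in the span.
\<close>

lemma adapted_basis:
  fixes z z' :: "'a::euclidean_space list"
  assumes zZ: "set z \<subseteq> Zlat" and z'Z: "set z' \<subseteq> Zlat" and z: "vol z > 0"
  obtains c x where "length c + length x = length z'" "set (c @ x) \<subseteq> Zlat"
    "\<And>h :: 'a \<Rightarrow> 'a. linear h \<Longrightarrow> vol (map h (c @ x)) = vol (map h z')"
    "set z' \<subseteq> span (set (c @ x))"
    "set c \<subseteq> span (set z)" "vol (z @ x) > 0"
proof -
  let ?V = "span (set z)" and ?n = "length z'"
  define Q where "Q ys \<longleftrightarrow> length ys = ?n \<and> set ys \<subseteq> Zsp z' \<and> set z' \<subseteq> Zsp ys" for ys
  define K where "K ys = {k. k < ?n \<and> ys ! k \<notin> ?V}" for ys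
  have finK: "finite (K ys)" for ys by (simp add: K_def)
  have Q0: "Q z'" by (auto simp: Q_def intro: Zsp_base)
  obtain ys0 where ys0: "Q ys0" "\<And>ys. Q ys \<Longrightarrow> card (K ys0) \<le> card (K ys)"
    using ex_has_least_nat[of Q z' "\<lambda>ys. card (K ys)"] Q0 by blast
  have norel: "\<not> (Q ys \<and> card (K ys) = card (K ys0)
      \<and> (\<Sum>k\<in>K ys. of_int (a k) *\<^sub>R ys ! k) \<in> ?V \<and> (\<exists>k\<in>K ys. a k \<noteq> 0))" for ys and a :: "nat \<Rightarrow> int"
  proof (induction "nat (\<Sum>k\<in>K ys. \<bar>a k\<bar>)" arbitrary: ys a rule: less_induct)
    case less
    show ?case
    proof
      assume H: "Q ys \<and> card (K ys) = card (K ys0)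
        \<and> (\<Sum>k\<in>K ys. of_int (a k) *\<^sub>R ys ! k) \<in> ?V \<and> (\<exists>k\<in>K ys. a k \<noteq> 0)"
      then obtain k where k: "k \<in> K ys" "a k \<noteq> 0" by blast
      show False
      proof (cases "\<exists>l\<in>K ys. l \<noteq> k \<and> a l \<noteq> 0")
        case False
        have "(\<Sum>k\<in>K ys. of_int (a k) *\<^sub>R ys ! k) = of_int (a k) *\<^sub>R ys ! k"
          using k False by (subst sum.remove[OF finK k(1)]) (auto intro!: sum.neutral)
        then have "of_int (a k) *\<^sub>R ys ! k \<in> ?V" using H by simp
        from span_scale[OF this, of "1 / of_int (a k)"] k(2) have "ys ! k \<in> ?V" by simp
        then show False using k(1) by (simp add: K_def)
      next
        case True
        then obtain l where l: "l \<in> K ys" "l \<noteq> k" "a l \<noteq> 0" by blast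
        obtain p q where pq: "p \<in> K ys" "q \<in> K ys" "p \<noteq> q" "a q \<noteq> 0" "\<bar>a q\<bar> \<le> \<bar>a p\<bar>"
        proof (cases "\<bar>a l\<bar> \<le> \<bar>a k\<bar>")
          case True
          then show thesis using that[of k l] k l by auto
        next
          case False
          then show thesis using that[of l k] k l by auto
        qed
        have len: "length ys = ?n" using H by (simp add: Q_def)
        have pn: "p < ?n" "q < ?n" using pq by (auto simp: K_def)
        \<comment> \<open>With this sign, a_p - s a_q is smaller in absolute value than a_p. Adding
          s y_p to y_q compensates for it, so that the value of the relation and the generated group
          are kept.\<close>
        define s where "s = sgn (a p) * sgn (a q)"
        define ys' where "ys' = ys[q := ys ! q + of_int s *\<^sub>R ys ! p]"
        define a' where "a' = a(p := a p - s * a q)"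
        have nth': "ys' ! j = (if j = q then ys ! q + of_int s *\<^sub>R ys ! p else ys ! j)" if "j < ?n" for j
          using that len by (simp add: ys'_def nth_list_update)
        have len': "length ys' = ?n" by (simp add: ys'_def len)
        have Q': "Q ys'"
          unfolding Q_def
        proof (intro conjI)
          have mem: "ys ! j \<in> Zsp z'" if "j < ?n" for j
            using H that len by (auto simp: Q_def)
          show "set ys' \<subseteq> Zsp z'"
          proof
            fix y assume "y \<in> set ys'"
            then obtain j where "j < ?n" "y = ys' ! j" by (auto simp: in_set_conv_nth len')
            then show "y \<in> Zsp z'"
              using mem pn by (simp add: nth') (auto intro!: Zsp_add Zsp_scale)
          qed
          have memz: "ys' ! j \<in> Zsp ys'" if "j < ?n" for j
            using that len' by (intro Zsp_base) simp
          have "set ys \<subseteq> Zsp ys'"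
          proof
            fix y assume "y \<in> set ys"
            then obtain j where j: "j < ?n" "y = ys ! j" by (auto simp: in_set_conv_nth len)
            show "y \<in> Zsp ys'"
            proof (cases "j = q")
              case True
              have "ys' ! q + of_int (- s) *\<^sub>R ys' ! p \<in> Zsp ys'"
                using memz pn by (intro Zsp_add Zsp_scale) auto
              then show ?thesis using True j pn pq(3) by (simp add: nth')
            next
              case False
              then show ?thesis using memz[OF j(1)] j by (simp add: nth')
            qed
          qed
          from Zsp_mono[OF this] show "set z' \<subseteq> Zsp ys'" using H by (auto simp: Q_def)
        qed (rule len')
        have sub: "K ys' \<subseteq> K ys"
          using pq(2) by (auto simp: K_def nth' split: if_splits)
        \<comment> \<open>By minimality the changed element cannot have moved into
          \<open>?V\<close>, so the shortened relation lives on the same indices.\<close>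
        have "card (K ys) \<le> card (K ys')" using ys0(2)[OF Q'] H by simp
        then have Keq: "K ys' = K ys" by (intro card_seteq finK sub)
        have "(\<Sum>j\<in>K ys. of_int (a' j) *\<^sub>R ys' ! j) = (\<Sum>j\<in>K ys. of_int (a j) *\<^sub>R ys ! j)"
        proof -
          have "(\<Sum>j\<in>K ys - {p, q}. of_int (a' j) *\<^sub>R ys' ! j) = (\<Sum>j\<in>K ys - {p, q}. of_int (a j) *\<^sub>R ys ! j)"
            by (intro sum.cong) (auto simp: a'_def nth' K_def)
          then show ?thesis
            unfolding sum_remove2[OF finK pq(1,2,3)]
            using pn pq(3) by (simp add: a'_def nth' algebra_simps)
        qed
        moreover have "nat (\<Sum>j\<in>K ys'. \<bar>a' j\<bar>) < nat (\<Sum>j\<in>K ys. \<bar>a j\<bar>)"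
        proof -
          have "\<bar>a' p\<bar> < \<bar>a p\<bar>"
            using pq(4,5) by (auto simp: a'_def s_def sgn_if abs_if split: if_splits)
          moreover have "(\<Sum>j\<in>K ys - {p, q}. \<bar>a' j\<bar>) = (\<Sum>j\<in>K ys - {p, q}. \<bar>a j\<bar>)"
            by (intro sum.cong) (auto simp: a'_def)
          moreover have "a' q = a q" using pq(3) by (simp add: a'_def)
          moreover have "0 \<le> (\<Sum>j\<in>K ys - {p, q}. \<bar>a j\<bar>)" by (intro sum_nonneg) auto
          ultimately show ?thesis
            unfolding Keq sum_remove2[OF finK pq(1,2,3)] by linarith
        qed
        moreover have "\<exists>k\<in>K ys'. a' k \<noteq> 0"
          using pq unfolding Keq by (intro bexI[of _ q]) (auto simp: a'_def)
        ultimately show False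
          using less[of a' ys'] H Q' Keq by auto
      qed
    qed
  qed
  define c where "c = filter (\<lambda>y. y \<in> ?V) ys0"
  define x where "x = filter (\<lambda>y. y \<notin> ?V) ys0"
  have set_cx: "set (c @ x) = set ys0" by (auto simp: c_def x_def)
  have len0: "length ys0 = ?n" using ys0(1) by (simp add: Q_def)
  have len_cx: "length c + length x = ?n"
    unfolding c_def x_def using sum_length_filter_compl[of "\<lambda>y. y \<in> ?V" ys0] len0 by simp
  have Qcx: "Q (c @ x)"
    unfolding Q_def
  proof (intro conjI)
    show "length (c @ x) = ?n" using len_cx by simp
    show "set (c @ x) \<subseteq> Zsp z'" using ys0(1) unfolding set_cx by (simp add: Q_def)
    have "Zsp ys0 \<subseteq> Zsp (c @ x)" by (intro Zsp_mono) (auto simp: set_cx[symmetric] intro: Zsp_base)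
    then show "set z' \<subseteq> Zsp (c @ x)" using ys0(1) by (auto simp: Q_def)
  qed
  have Kcx: "K (c @ x) = {length c..<?n}"
  proof -
    have "c ! k \<in> ?V" if "k < length c" for k using that nth_mem[of k c] by (auto simp: c_def)
    moreover have "x ! k \<notin> ?V" if "k < length x" for k using that nth_mem[of k x] by (auto simp: x_def)
    ultimately show ?thesis
      using len_cx by (auto simp: K_def nth_append not_less split: if_splits)
  qed
  have cardK: "card (K (c @ x)) = card (K ys0)"
  proof -
    have "card (K ys0) = length x"
      unfolding x_def length_filter_conv_card by (simp add: K_def len0)
    then show ?thesis using len_cx by (simp add: Kcx)
  qed
  have Zcx: "set (c @ x) \<subseteq> Zlat" using Qcx Zsp_Zlat[OF z'Z] by (auto simp: Q_def)
  have "\<forall>q. x = p @ q \<longrightarrow> vol (z @ p) > 0" for p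
  proof (induction p rule: rev_induct)
    case Nil
    then show ?case using z by simp
  next
    case (snoc b p)
    show ?case
    proof (intro allI impI)
      fix q assume xq: "x = (p @ [b]) @ q"
      with snoc have vp: "vol (z @ p) > 0" by simp
      have "b \<notin> span (set (z @ p))"
      proof
        assume bs: "b \<in> span (set (z @ p))"
        have "b \<in> Zlat" "set (z @ p) \<subseteq> Zlat" using Zcx zZ xq by auto
        then obtain a0 a where a: "a0 \<noteq> 0"
          "of_int a0 *\<^sub>R b = (\<Sum>k<length (z @ p). of_int (a k) *\<^sub>R (z @ p) ! k)"
          using integer_relation[OF _ _ bs] by blast
        \<comment> \<open>The relation for \<open>b\<close> over \<open>z @ p\<close> is rewritten
          on the indices of \<open>c @ x\<close>: \<open>b\<close> stands at position
          \<open>length c + length p\<close>, and the terms over \<open>z\<close> are left over as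
          an element of \<open>?V\<close>.\<close>
        define a' where "a' k = (if k = length c + length p then a0
          else if length c \<le> k \<and> k < length c + length p then - a (length z + (k - length c)) else 0)" for k
        have "(\<Sum>k\<in>{length c..<?n}. of_int (a' k) *\<^sub>R (c @ x) ! k)
            = (\<Sum>k<length x. of_int (a' (length c + k)) *\<^sub>R x ! k)"
          unfolding len_cx[symmetric]
          by (rule sum.reindex_bij_witness[of _ "\<lambda>k. length c + k" "\<lambda>k. k - length c"]) (auto simp: nth_append)
        also have "\<dots> = (\<Sum>k<length p + 1. of_int (a' (length c + k)) *\<^sub>R x ! k)"
          by (rule sum.mono_neutral_right) (auto simp: xq a'_def)
        also have "\<dots> = (\<Sum>k<length p. of_int (- a (length z + k)) *\<^sub>R p ! k) + of_int a0 *\<^sub>R b"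
          by (simp add: xq nth_append a'_def)
        also have "of_int a0 *\<^sub>R b = (\<Sum>k<length z. of_int (a k) *\<^sub>R z ! k)
            + (\<Sum>k<length p. of_int (a (length z + k)) *\<^sub>R p ! k)"
        proof -
          have "(\<Sum>k<length (z @ p). of_int (a k) *\<^sub>R (z @ p) ! k)
             = (\<Sum>k\<in>{..<length z} \<union> {length z..<length z + length p}. of_int (a k) *\<^sub>R (z @ p) ! k)"
            by (rule sum.cong) auto
          also have "\<dots> = (\<Sum>k<length z. of_int (a k) *\<^sub>R (z @ p) ! k)
             + (\<Sum>k\<in>{length z..<length z + length p}. of_int (a k) *\<^sub>R (z @ p) ! k)"
            by (rule sum.union_disjoint) auto
          also have "(\<Sum>k\<in>{length z..<length z + length p}. of_int (a k) *\<^sub>R (z @ p) ! k)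
             = (\<Sum>k<length p. of_int (a (length z + k)) *\<^sub>R p ! k)"
            by (rule sum.reindex_bij_witness[of _ "\<lambda>k. length z + k" "\<lambda>k. k - length z"]) (auto simp: nth_append)
          finally show ?thesis using a(2) by (simp add: nth_append)
        qed
        also have "(\<Sum>k<length p. of_int (- a (length z + k)) *\<^sub>R p ! k) + ((\<Sum>k<length z. of_int (a k) *\<^sub>R z ! k)
            + (\<Sum>k<length p. of_int (a (length z + k)) *\<^sub>R p ! k)) = (\<Sum>k<length z. of_int (a k) *\<^sub>R z ! k)"
          by (simp add: sum_negf)
        also have "\<dots> \<in> ?V" by (rule list_sum_in_span)
        finally have "(\<Sum>k\<in>K (c @ x). of_int (a' k) *\<^sub>R (c @ x) ! k) \<in> ?V"
          unfolding Kcx .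
        moreover have "\<exists>k\<in>K (c @ x). a' k \<noteq> 0"
          unfolding Kcx using a(1) len_cx by (intro bexI[of _ "length c + length p"]) (auto simp: a'_def xq)
        ultimately show False using norel[of "c @ x" a'] Qcx cardK by blast
      qed
      from vol_snoc_pos[OF vp this] show "vol (z @ p @ [b]) > 0" by simp
    qed
  qed
  then have "vol (z @ x) > 0" by simp
  moreover have "vol (map h (c @ x)) = vol (map h z')" if "linear h" for h :: "'a \<Rightarrow> 'a"
    using Qcx that by (intro vol_Zsp_eq) (auto simp: Q_def)
  moreover have "set z' \<subseteq> span (set (c @ x))" using Qcx Zsp_span[of "c @ x"] unfolding Q_def by blast
  moreover have "set c \<subseteq> ?V" by (auto simp: c_def)
  ultimately show thesis using len_cx Zcx by (intro that)
qed

text \<open>For a basis \<open>c @ x\<close> of the second lattice adapted to the first,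
  \<open>c\<close> plays the intersection and \<open>z @ x\<close> the sum. As \<open>c\<close> lies
  in the span of \<open>z\<close>, \<open>vol_append_le\<close> gives the inequality, with the same
  two lists for all \<open>h\<close>. The list \<open>x\<close> is nonempty because
  \<open>z'\<close> leaves the span of \<open>z\<close>.\<close>

lemma vol_submodular:
  fixes z z' :: "'a::euclidean_space list"
  assumes zZ: "set z \<subseteq> Zlat" and z'Z: "set z' \<subseteq> Zlat" and z: "vol z > 0" and z': "vol z' > 0"
    and len: "length z' = length z" and nsub: "\<not> set z' \<subseteq> span (set z)"
  obtains j c y where "1 \<le> j" "length c + j = length z" "length y = length z + j"
    "set c \<subseteq> Zlat" "set y \<subseteq> Zlat" "vol c > 0" "vol y > 0"
    "\<And>h :: 'a \<Rightarrow> 'a. linear h \<Longrightarrow> vol (map h y) * vol (map h c) \<le> vol (map h z) * vol (map h z')"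
proof -
  obtain c x where cx: "length c + length x = length z'" "set (c @ x) \<subseteq> Zlat"
    "\<And>h :: 'a \<Rightarrow> 'a. linear h \<Longrightarrow> vol (map h (c @ x)) = vol (map h z')"
    "set z' \<subseteq> span (set (c @ x))" "set c \<subseteq> span (set z)" "vol (z @ x) > 0"
    using adapted_basis[OF zZ z'Z z] by blast
  have "x \<noteq> []"
  proof
    assume "x = []"
    then have "span (set (c @ x)) \<subseteq> span (set z)"
      using cx(5) by (simp add: span_minimal)
    with cx(4) nsub show False by blast
  qed
  then have "1 \<le> length x" by (cases x) auto
  moreover have "vol (c @ x) > 0" using cx(3)[OF linear_id] z' by simp
  then have "vol c > 0" by (rule vol_prefix_pos)
  moreover have "vol (map h (z @ x)) * vol (map h c) \<le> vol (map h z) * vol (map h z')" if "linear h" for h :: "'a \<Rightarrow> 'a"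
  proof -
    have "set (map h c) \<subseteq> span (set (map h z))"
      using cx(5) linear_span_image[OF that, of "set z"] by auto
    from vol_append_le[OF this, of "map h x"] cx(3)[OF that] show ?thesis by simp
  qed
  ultimately show thesis
    using that[of "length x" c "z @ x"] cx zZ len by auto
qed

section \<open>Pivots of subspaces\<close>

text \<open>Gaussian elimination in which the pivot is the largest entry of the chosen vector. After
  normalization its entries are at most 1, and clearing the entries at the other pivots raises the
  bound by a factor of at most \<open>DIM('a) + 1\<close> per dimension.\<close>

lemma pivot_basis:
  fixes V :: "'a::euclidean_space set"
  assumes "subspace V"
  shows "\<exists>I w. I \<subseteq> Basis \<and> card I = dim V \<and> V = span (w ` I) \<and>
    (\<forall>b\<in>I. \<forall>b'\<in>I. w b \<bullet> b' = (if b' = b then 1 else 0)) \<and>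
    (\<forall>b\<in>I. \<forall>e\<in>Basis. \<bar>w b \<bullet> e\<bar> \<le> (real DIM('a) + 1) ^ dim V)"
  using assms
proof (induction "dim V" arbitrary: V)
  case 0
  then have "V = {0}" using dim_eq_0[of V] subspace_0[of V] by auto
  then show ?case by (intro exI[of _ "{}"]) (auto simp: dim_eq_0)
next
  case (Suc n)
  note sub = \<open>subspace V\<close>
  have "V \<noteq> {0}" using Suc(2) by auto
  then obtain v0 where v0: "v0 \<in> V" "v0 \<noteq> 0" using subspace_0[OF sub] by blast
  have "\<exists>b\<in>Basis. \<forall>e\<in>Basis. \<bar>v0 \<bullet> e\<bar> \<le> \<bar>v0 \<bullet> b\<bar>"
  proof -
    let ?S = "(\<lambda>e. \<bar>v0 \<bullet> e\<bar>) ` Basis"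
    have "Max ?S \<in> ?S" by (intro Max_in) auto
    then obtain b where "b \<in> Basis" "Max ?S = \<bar>v0 \<bullet> b\<bar>" by blast
    moreover have "\<bar>v0 \<bullet> e\<bar> \<le> Max ?S" if "e \<in> Basis" for e using that by (intro Max_ge) auto
    ultimately show ?thesis by auto
  qed
  then obtain b where b: "b \<in> Basis" "\<And>e. e \<in> Basis \<Longrightarrow> \<bar>v0 \<bullet> e\<bar> \<le> \<bar>v0 \<bullet> b\<bar>" by blast
  have b0: "v0 \<bullet> b \<noteq> 0"
  proof
    assume "v0 \<bullet> b = 0"
    then have "v0 \<bullet> e = 0" if "e \<in> Basis" for e using b(2)[OF that] by simp
    then have "v0 = 0" by (simp add: euclidean_eq_iff[of v0 0])
    with v0(2) show False by simp
  qed
  define v where "v = (1 / (v0 \<bullet> b)) *\<^sub>R v0"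
  have v: "v \<in> V" "v \<bullet> b = 1" using v0 b0 sub by (auto simp: v_def subspace_scale)
  have vle: "\<bar>v \<bullet> e\<bar> \<le> 1" if "e \<in> Basis" for e
    using b(2)[OF that] b0 by (simp add: v_def abs_mult divide_simps)
  define V' where "V' = {x \<in> V. x \<bullet> b = 0}"
  have sub': "subspace V'"
    using sub by (auto simp: V'_def real_vector.subspace_def inner_simps)
  have dec: "x - (x \<bullet> b) *\<^sub>R v \<in> V'" if "x \<in> V" for x
    using that v sub by (simp add: V'_def subspace_diff subspace_scale inner_simps)
  have Vspan: "V = span (insert v V')"
  proof (rule antisym)
    show "V \<subseteq> span (insert v V')"
      using dec span_base[of _ V'] unfolding span_breakdown_eq subset_iff by blast
    show "span (insert v V') \<subseteq> V"
      using v by (intro span_minimal sub) (auto simp: V'_def)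
  qed
  have "v \<notin> span V'" using v sub' by (simp add: span_eq_iff[THEN iffD2] V'_def)
  then have "dim (insert v V') = dim V' + 1" by (simp add: dim_insert)
  then have dimV: "dim V = dim V' + 1" by (subst Vspan) simp
  then have "n = dim V'" using Suc(2) by simp
  from Suc(1)[OF this sub'] obtain I w where I: "I \<subseteq> Basis" "card I = dim V'" "V' = span (w ` I)"
    and w: "\<And>c d. c \<in> I \<Longrightarrow> d \<in> I \<Longrightarrow> w c \<bullet> d = (if d = c then 1 else 0)"
    and wle: "\<And>c e. c \<in> I \<Longrightarrow> e \<in> Basis \<Longrightarrow> \<bar>w c \<bullet> e\<bar> \<le> (real DIM('a) + 1) ^ dim V'" by metis
  have wV': "w c \<in> V'" if "c \<in> I" for c using that I(3) by (auto intro: span_base)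
  have bI: "b \<notin> I" using w[of b b] wV'[of b] by (auto simp: V'_def)
  have finI: "finite I" using I(1) finite_subset finite_Basis by blast
  \<comment> \<open>Only the new vector has to be cleared: the old ones lie in \<open>V'\<close> and
    vanish at \<open>b\<close> already.\<close>
  define u where "u = v - (\<Sum>c\<in>I. (v \<bullet> c) *\<^sub>R w c)"
  define w' where "w' = w(b := u)"
  have sumV': "(\<Sum>c\<in>I. (v \<bullet> c) *\<^sub>R w c) \<in> V'"
    using wV' by (intro subspace_sum sub' subspace_scale)
  have uV: "u \<in> V" using v(1) sumV' sub unfolding u_def by (intro subspace_diff) (auto simp: V'_def)
  have ub: "u \<bullet> b = 1" using v(2) sumV' by (simp add: u_def inner_diff_left V'_def)
  have uc: "u \<bullet> c = 0" if "c \<in> I" for c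
  proof -
    have "(\<Sum>d\<in>I. (v \<bullet> d) * (w d \<bullet> c)) = (\<Sum>d\<in>I. if d = c then v \<bullet> c else 0)"
      using that w by (intro sum.cong) auto
    then show ?thesis using that finI by (simp add: u_def inner_diff_left inner_sum_left)
  qed
  have le1: "(1::real) \<le> (real DIM('a) + 1) ^ dim V'" by (intro one_le_power) simp
  have step: "real DIM('a) * (real DIM('a) + 1) ^ dim V' + 1 \<le> (real DIM('a) + 1) ^ dim V"
    using le1 by (simp add: dimV algebra_simps)
  have ule: "\<bar>u \<bullet> e\<bar> \<le> (real DIM('a) + 1) ^ dim V" if e: "e \<in> Basis" for e
  proof -
    have "\<bar>u \<bullet> e\<bar> \<le> \<bar>v \<bullet> e\<bar> + \<bar>\<Sum>c\<in>I. (v \<bullet> c) * (w c \<bullet> e)\<bar>"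
      by (simp add: u_def inner_diff_left inner_sum_left)
    also have "\<bar>\<Sum>c\<in>I. (v \<bullet> c) * (w c \<bullet> e)\<bar> \<le> (\<Sum>c\<in>I. \<bar>(v \<bullet> c) * (w c \<bullet> e)\<bar>)" by (rule sum_abs)
    also have "\<dots> \<le> (\<Sum>c\<in>I. 1 * (real DIM('a) + 1) ^ dim V')"
      unfolding abs_mult using I(1) vle wle e by (intro sum_mono mult_mono) auto
    also have "\<dots> = real (card I) * (real DIM('a) + 1) ^ dim V'" by simp
    also have "\<dots> \<le> real DIM('a) * (real DIM('a) + 1) ^ dim V'"
      using I(1) by (intro mult_right_mono) (auto intro: card_mono)
    finally show ?thesis using vle[OF e] step by linarith
  qed
  have mono: "(real DIM('a) + 1) ^ dim V' \<le> (real DIM('a) + 1) ^ dim V"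
    by (intro power_increasing) (auto simp: dimV)
  show ?case
  proof (intro exI conjI)
    show "insert b I \<subseteq> Basis" using I b by auto
    show "card (insert b I) = dim V" using finI bI I(2) dimV by simp
    have im: "w' ` insert b I = insert u (w ` I)" using bI by (auto simp: w'_def)
    show "V = span (w' ` insert b I)"
      unfolding im
    proof (rule antisym)
      show "span (insert u (w ` I)) \<subseteq> V"
        using uV wV' by (intro span_minimal sub) (auto simp: V'_def)
      show "V \<subseteq> span (insert u (w ` I))"
      proof
        fix x assume x: "x \<in> V"
        have "x - (x \<bullet> b) *\<^sub>R u = (x - (x \<bullet> b) *\<^sub>R v) + (x \<bullet> b) *\<^sub>R (\<Sum>c\<in>I. (v \<bullet> c) *\<^sub>R w c)"
          by (simp add: u_def algebra_simps)
        also have "\<dots> \<in> V'" using dec[OF x] sumV' sub' by (intro subspace_add subspace_scale)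
        finally show "x \<in> span (insert u (w ` I))" using I(3) unfolding span_breakdown_eq by blast
      qed
    qed
    show "\<forall>c\<in>insert b I. \<forall>d\<in>insert b I. w' c \<bullet> d = (if d = c then 1 else 0)"
      using bI ub uc w wV' by (auto simp: w'_def V'_def)
    show "\<forall>c\<in>insert b I. \<forall>e\<in>Basis. \<bar>w' c \<bullet> e\<bar> \<le> (real DIM('a) + 1) ^ dim V"
      using ule bI order_trans[OF wle mono] by (auto simp: w'_def)
  qed
qed

lemma pivot_expand:
  fixes w :: "'a::euclidean_space \<Rightarrow> 'a"
  assumes "finite I" and w: "\<And>c d. c \<in> I \<Longrightarrow> d \<in> I \<Longrightarrow> w c \<bullet> d = (if d = c then 1 else 0)"
    and y: "y \<in> span (w ` I)"
  shows "y = (\<Sum>c\<in>I. (y \<bullet> c) *\<^sub>R w c)"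
  using y
proof (induction rule: span_induct)
  case base
  show ?case
  proof (rule real_vector.subspaceI)
    fix x y assume xy: "x \<in> {a. a = (\<Sum>c\<in>I. (a \<bullet> c) *\<^sub>R w c)}" "y \<in> {a. a = (\<Sum>c\<in>I. (a \<bullet> c) *\<^sub>R w c)}"
    have "(\<Sum>c\<in>I. ((x + y) \<bullet> c) *\<^sub>R w c) = (\<Sum>c\<in>I. (x \<bullet> c) *\<^sub>R w c) + (\<Sum>c\<in>I. (y \<bullet> c) *\<^sub>R w c)"
      by (simp add: inner_add_left scaleR_add_left sum.distrib)
    with xy show "x + y \<in> {a. a = (\<Sum>c\<in>I. (a \<bullet> c) *\<^sub>R w c)}" by simp
  next
    fix r x assume x: "x \<in> {a. a = (\<Sum>c\<in>I. (a \<bullet> c) *\<^sub>R w c)}"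
    have "(\<Sum>c\<in>I. ((r *\<^sub>R x) \<bullet> c) *\<^sub>R w c) = r *\<^sub>R (\<Sum>c\<in>I. (x \<bullet> c) *\<^sub>R w c)"
      by (simp add: scaleR_sum_right)
    with x show "r *\<^sub>R x \<in> {a. a = (\<Sum>c\<in>I. (a \<bullet> c) *\<^sub>R w c)}" by simp
  qed simp
next
  case (step x)
  then obtain c where c: "c \<in> I" "x = w c" by blast
  have "(\<Sum>d\<in>I. (w c \<bullet> d) *\<^sub>R w d) = (\<Sum>d\<in>I. if d = c then w c else 0)"
    using w c(1) by (intro sum.cong) auto
  then show ?case using assms(1) c by simp
qed

text \<open>On \<open>E\<close> the non-pivot coordinates are linear in the pivot coordinates with
  bounded coefficients; a general \<open>x\<close> is compared with its nearest point of
  \<open>E\<close>. \<open>J0\<close> is cut down to \<open>CARD('m) - e\<close> indices, so that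
  what follows does not depend on the actual dimension of \<open>E\<close>.\<close>

lemma infdist_ge_pivot:
  fixes E :: "(real ^ 'm) set"
  assumes E: "subspace E" and e: "dim E \<le> e" "e \<le> CARD('m)"
  obtains J J0 \<kappa> where "J0 \<subseteq> J" "card J0 = CARD('m) - e"
    "\<And>x i. i \<in> J0 \<Longrightarrow> \<bar>x $ i - (\<Sum>l\<in>-J. (x $ l) * \<kappa> l i)\<bar>
       \<le> (1 + real CARD('m) * (real CARD('m) + 1) ^ CARD('m)) * infdist x E"
proof -
  let ?M = "(real CARD('m) + 1) ^ CARD('m)"
  obtain I w where I: "I \<subseteq> Basis" "card I = dim E" "E = span (w ` I)"
    and w: "\<And>c d. c \<in> I \<Longrightarrow> d \<in> I \<Longrightarrow> w c \<bullet> d = (if d = c then 1 else 0)"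
    and wle: "\<And>c e. c \<in> I \<Longrightarrow> e \<in> Basis \<Longrightarrow> \<bar>w c \<bullet> e\<bar> \<le> (real CARD('m) + 1) ^ dim E"
    using pivot_basis[OF E] unfolding DIM_cart DIM_real mult_1_right by metis
  have finI: "finite I" using I(1) finite_subset finite_Basis by blast
  define P where "P = {i. axis i (1::real) \<in> I}"
  have IP: "I = (\<lambda>i. axis i 1) ` P"
    using I(1) by (auto simp: P_def Basis_vec_def)
  have inj: "inj_on (\<lambda>i :: 'm. axis i (1::real)) P" by (auto simp: inj_on_def axis_eq_axis)
  have cardP: "card P = dim E" using I(2) inj by (simp add: IP card_image)
  have "CARD('m) - e \<le> card (- P)" using e cardP card_Diff_subset[of P UNIV] by (simp add: Compl_eq_Diff_UNIV)
  then obtain J0 where J0: "J0 \<subseteq> - P" "card J0 = CARD('m) - e"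
    by (meson obtain_subset_with_card_n)
  define \<kappa> where "\<kappa> l i = w (axis l 1) $ i" for l i
  have "\<bar>x $ i - (\<Sum>l\<in>- (- P). (x $ l) * \<kappa> l i)\<bar> \<le> (1 + real CARD('m) * ?M) * infdist x E"
    if "i \<in> J0" for x i
  proof -
    obtain y where y: "y \<in> E" "infdist x E = norm (x - y)"
      using infdist_span_attained[of E x] E by (metis span_eq_iff)
    have "y = (\<Sum>c\<in>I. (y \<bullet> c) *\<^sub>R w c)"
      using pivot_expand[OF finI w] y(1) I(3) by simp
    also have "\<dots> = (\<Sum>l\<in>P. (y $ l) *\<^sub>R w (axis l 1))"
      unfolding IP by (subst sum.reindex[OF inj]) (simp add: inner_axis)
    finally have "y $ i = (\<Sum>l\<in>P. (y $ l) *\<^sub>R w (axis l 1)) $ i" by (rule arg_cong[where f = "\<lambda>v. v $ i"])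
    then have yi: "y $ i = (\<Sum>l\<in>P. (y $ l) * \<kappa> l i)" by (simp add: \<kappa>_def)
    let ?d = "norm (x - y)"
    have comp: "\<bar>x $ l - y $ l\<bar> \<le> ?d" for l
      using component_le_norm_cart[of "x - y" l] by simp
    have \<kappa>le: "\<bar>\<kappa> l i\<bar> \<le> ?M" if "l \<in> P" for l
    proof -
      have "\<bar>w (axis l 1) \<bullet> axis i 1\<bar> \<le> (real CARD('m) + 1) ^ dim E"
        using that by (intro wle) (auto simp: P_def)
      also have "\<dots> \<le> ?M" using e by (intro power_increasing) auto
      finally show ?thesis by (simp add: \<kappa>_def inner_axis)
    qed
    have "x $ i - (\<Sum>l\<in>P. (x $ l) * \<kappa> l i) = (x $ i - y $ i) - (\<Sum>l\<in>P. (x $ l - y $ l) * \<kappa> l i)"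
      by (subst yi) (simp add: algebra_simps sum_subtractf)
    also have "\<bar>\<dots>\<bar> \<le> \<bar>x $ i - y $ i\<bar> + (\<Sum>l\<in>P. \<bar>(x $ l - y $ l) * \<kappa> l i\<bar>)"
      by (intro order_trans[OF abs_triangle_ineq4] add_mono order_refl sum_abs)
    also have "\<dots> \<le> ?d + (\<Sum>l\<in>P. ?d * ?M)"
      unfolding abs_mult by (intro add_mono sum_mono mult_mono comp \<kappa>le) auto
    also have "\<dots> = ?d + real (card P) * (?d * ?M)" by simp
    also have "\<dots> \<le> ?d + real CARD('m) * (?d * ?M)"
      by (intro add_left_mono mult_right_mono) (auto intro: card_mono)
    finally show ?thesis by (simp add: y(2) algebra_simps)
  qed
  with J0 show thesis by (intro that[of J0 "- P" \<kappa>])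
qed

text \<open>In a combination of vectors whose coordinate block is close to the identity, the
  coordinate that belongs to the largest coefficient is at least half of it in absolute value. The
  new vector enters its difference to the earlier span with coefficient 1, so each height is at
  least 1/2.\<close>

lemma vol_near_identity:
  fixes f :: "'m \<Rightarrow> real ^ 'm"
  assumes near: "\<And>i i'. i \<in> set la \<Longrightarrow> i' \<in> set la \<Longrightarrow> \<bar>f i $ i' - (if i = i' then 1 else 0)\<bar> \<le> \<epsilon>"
    and \<epsilon>: "0 \<le> \<epsilon>" "real CARD('m) * \<epsilon> \<le> 1 / 2" and dist: "distinct la"
  shows "vol (map f la) \<ge> (1 / 2) ^ length la"
  using near dist
proof (induction la rule: rev_induct)
  case Nil
  then show ?case by simp
next
  case (snoc i la)
  let ?l = "la @ [i]" and ?n = "length la"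
  obtain y where y: "y \<in> span (set (map f la))" "infdist (f i) (span (set (map f la))) = norm (f i - y)"
    using infdist_span_attained by blast
  obtain c where c: "y = (\<Sum>k<?n. c k *\<^sub>R map f la ! k)"
    using span_list[OF y(1)] by auto
  define d where "d k = (if k = ?n then 1 else - c k)" for k
  have z: "f i - y = (\<Sum>k<Suc ?n. d k *\<^sub>R f (?l ! k))"
    by (simp add: c d_def nth_append sum_negf)
  obtain k0 where k0: "k0 < Suc ?n" "\<And>k. k < Suc ?n \<Longrightarrow> \<bar>d k\<bar> \<le> \<bar>d k0\<bar>"
  proof -
    let ?S = "(\<lambda>k. \<bar>d k\<bar>) ` {..<Suc ?n}"
    have "Max ?S \<in> ?S" by (intro Max_in) auto
    then obtain k where k: "k < Suc ?n" "Max ?S = \<bar>d k\<bar>" by auto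
    moreover have "\<bar>d l\<bar> \<le> Max ?S" if "l < Suc ?n" for l using that by (intro Max_ge) auto
    ultimately show thesis using that[of k] by simp
  qed
  have d1: "1 \<le> \<bar>d k0\<bar>" using k0(2)[of ?n] by (simp add: d_def)
  have mem: "?l ! k \<in> set ?l" if "k < Suc ?n" for k using that by (intro nth_mem) simp
  have "card (set ?l) \<le> CARD('m)" by (intro card_mono) auto
  then have nm: "Suc ?n \<le> CARD('m)" using distinct_card[OF snoc.prems(2)] by simp
  let ?t = "?l ! k0"
  define \<delta> where "\<delta> k = (if k = k0 then 1 else (0::real))" for k
  have eq: "\<bar>f (?l ! k) $ ?t - \<delta> k\<bar> \<le> \<epsilon>" if "k < Suc ?n" for k
  proof -
    have "(?l ! k = ?t) = (k = k0)"
      using that k0(1) nth_eq_iff_index_eq[OF snoc.prems(2), of k k0] by simp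
    then show ?thesis using snoc.prems(1)[OF mem[OF that] mem[OF k0(1)]] by (simp add: \<delta>_def)
  qed
  have "(f i - y) $ ?t = (\<Sum>k<Suc ?n. d k * f (?l ! k) $ ?t)"
    unfolding z by simp
  also have "\<dots> = (\<Sum>k<Suc ?n. d k * \<delta> k) + (\<Sum>k<Suc ?n. d k * (f (?l ! k) $ ?t - \<delta> k))"
    unfolding sum.distrib[symmetric] by (intro sum.cong) (auto simp: algebra_simps)
  also have "(\<Sum>k<Suc ?n. d k * \<delta> k) = d k0"
    using k0(1) by (simp add: \<delta>_def if_distrib[of "\<lambda>t. _ * t"] sum.delta cong: if_cong del: sum.lessThan_Suc)
  finally have "\<bar>(f i - y) $ ?t\<bar> \<ge> \<bar>d k0\<bar> - \<bar>\<Sum>k<Suc ?n. d k * (f (?l ! k) $ ?t - \<delta> k)\<bar>" by linarith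
  moreover have "\<bar>\<Sum>k<Suc ?n. d k * (f (?l ! k) $ ?t - \<delta> k)\<bar> \<le> (\<Sum>k<Suc ?n. \<bar>d k0\<bar> * \<epsilon>)"
    by (intro order_trans[OF sum_abs] sum_mono) (auto simp: abs_mult intro!: mult_mono k0(2) eq)
  moreover have "(\<Sum>k<Suc ?n. \<bar>d k0\<bar> * \<epsilon>) = \<bar>d k0\<bar> * (real (Suc ?n) * \<epsilon>)" by (simp add: algebra_simps)
  moreover have "real (Suc ?n) * \<epsilon> \<le> real CARD('m) * \<epsilon>" using nm \<epsilon>(1) by (intro mult_right_mono) auto
  then have "\<bar>d k0\<bar> * (real (Suc ?n) * \<epsilon>) \<le> \<bar>d k0\<bar> * (1 / 2)" using \<epsilon>(2) by (intro mult_left_mono) auto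
  ultimately have "\<bar>(f i - y) $ ?t\<bar> \<ge> 1 / 2" using d1 by linarith
  then have "infdist (f i) (span (set (map f la))) \<ge> 1 / 2"
    using component_le_norm_cart[of "f i - y" ?t] y(2) by linarith
  moreover have "vol (map f la) \<ge> (1 / 2) ^ ?n"
    using snoc by auto
  ultimately have "(1 / 2) ^ ?n * (1 / 2) \<le> vol (map f la) * infdist (f i) (span (set (map f la)))"
    by (intro mult_mono) auto
  then show ?case by (simp add: vol_snoc)
qed

section \<open>Negative moments of uniformly distributed coordinates\<close>

text \<open>
  The reciprocal is taken in the extended reals, so that \<open>recip 0 = \<infinity>\<close>; a real reciprocal would
  make upper bounds for integrals of negative powers vacuous at the singularity.
\<close>

definition recip :: "real \<Rightarrow> ennreal" where
  "recip x = inverse (ennreal x)"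

lemma recip_mono: "x \<le> y \<Longrightarrow> recip y \<le> recip x"
  by (cases "0 < x") (simp_all add: recip_def inverse_ennreal ennreal_neg le_imp_inverse_le)

lemma recip_pos: "0 < x \<Longrightarrow> recip x = ennreal (inverse x)"
  by (simp add: recip_def inverse_ennreal)

lemma recip_1 [simp]: "recip 1 = 1"
  by (simp add: recip_pos)

lemma recip_0 [simp]: "recip 0 = \<top>"
  by (simp add: recip_def)

lemma recip_neq_0: "recip x \<noteq> 0"
  by (simp add: recip_def ennreal_inverse_eq_0_iff)

lemma recip_mult: "0 \<le> x \<Longrightarrow> 0 \<le> y \<Longrightarrow> recip (x * y) = recip x * recip y"
  by (cases "x = 0"; cases "y = 0")
     (auto simp: recip_pos ennreal_mult[symmetric] inverse_mult_distrib ennreal_mult_top ennreal_top_mult recip_neq_0)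

lemma recip_prod: "(\<And>i. i \<in> I \<Longrightarrow> 0 \<le> f i) \<Longrightarrow> recip (\<Prod>i\<in>I. f i) = (\<Prod>i\<in>I. recip (f i))"
  by (induction I rule: infinite_finite_induct) (auto simp: recip_mult prod_nonneg)

lemma borel_measurable_recip [measurable]: "recip \<in> borel_measurable borel"
  unfolding recip_def by measurable

definition unit_interval :: "real measure" where
  "unit_interval = restrict_space lborel {0..1}"

lemma space_unit_interval [simp]: "space unit_interval = {0..1}"
  by (simp add: unit_interval_def space_restrict_space)

lemma prob_space_unit_interval: "prob_space unit_interval"
  by (rule prob_spaceI) (simp add: unit_interval_def emeasure_restrict_space space_restrict_space)

lemma measurable_unit_interval [measurable_dest]: "f \<in> borel_measurable borel \<Longrightarrow> f \<in> borel_measurable unit_interval"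
  unfolding unit_interval_def by (intro measurable_restrict_space1) simp

text \<open>Dyadic decomposition: the set where the absolute value of \<open>\<rho> * t + c\<close>
  is at most 2^(-k) is an interval whose length does not depend on \<open>c\<close>, and
  \<open>a k\<close> bounds the integrand on the shell between 2^(-k-1) and 2^(-k). The resulting
  series is geometric because \<gamma> < 1.\<close>

lemma integral_inverse_power_le:
  fixes \<rho> \<gamma> :: real
  assumes \<rho>: "0 < \<rho>" and \<gamma>: "0 < \<gamma>" "\<gamma> < 1"
  obtains C where "1 \<le> C" "\<And>c. (\<integral>\<^sup>+ t. recip (\<bar>\<rho> * t + c\<bar> powr \<gamma>) \<partial>unit_interval) \<le> ennreal C"
proof -
  define a where "a k = 2 powr (\<gamma> * (real k + 1))" for k :: nat
  define b where "b k = a k * (2 * (1 / 2) ^ k / \<rho>)" for k :: nat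
  have b_eq: "b k = (2 powr \<gamma> * 2 / \<rho>) * (2 powr (\<gamma> - 1)) ^ k" for k
  proof -
    have "(2 powr (\<gamma> - 1)) ^ k = 2 powr (\<gamma> * real k) * (1 / 2) ^ k"
      by (simp add: powr_realpow[symmetric] powr_powr powr_diff powr_minus powr_mult_base algebra_simps powr_add[symmetric] power_one_over divide_simps flip: powr_realpow)
    moreover have "a k = 2 powr \<gamma> * 2 powr (\<gamma> * real k)"
      by (simp add: a_def distrib_left powr_add)
    ultimately show ?thesis by (simp add: b_def)
  qed
  have r: "2 powr (\<gamma> - 1) < (1::real)" using \<gamma> powr_less_mono[of "\<gamma> - 1" 0 2] by simp
  have sb: "summable b"
    unfolding b_eq using r by (intro summable_mult summable_geometric) simp
  have b0: "0 \<le> b k" for k using \<rho> by (simp add: b_def a_def)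
  define C where "C = 1 + suminf b"
  have "(\<integral>\<^sup>+ t. recip (\<bar>\<rho> * t + c\<bar> powr \<gamma>) \<partial>unit_interval) \<le> ennreal C" for c
  proof -
    define S where "S k = {t. \<bar>\<rho> * t + c\<bar> \<le> (1 / 2) ^ k}" for k :: nat
    have S_eq: "S k = {(- c - (1 / 2) ^ k) / \<rho> .. (- c + (1 / 2) ^ k) / \<rho>}" for k
      using \<rho> by (auto simp: S_def abs_le_iff field_simps)
    have [measurable]: "S k \<in> sets borel" for k unfolding S_eq by simp
    have eS: "emeasure lborel (S k) = ennreal (2 * (1 / 2) ^ k / \<rho>)" for k
      unfolding S_eq using \<rho> by (subst emeasure_lborel_Icc) (auto simp: field_simps)
    have pt: "recip (\<bar>\<rho> * t + c\<bar> powr \<gamma>) \<le> 1 + (\<Sum>k. ennreal (a k) * indicator (S k) t)"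
      if t: "\<rho> * t + c \<noteq> 0" for t
    proof -
      let ?u = "\<bar>\<rho> * t + c\<bar>"
      have u: "0 < ?u" using t by simp
      show ?thesis
      proof (cases "1 \<le> ?u")
        case True
        then have "1 \<le> ?u powr \<gamma>" using \<gamma> by (simp add: ge_one_powr_ge_zero)
        from recip_mono[OF this] show ?thesis by (simp add: add_increasing2)
      next
        case False
        have "\<exists>k. (1 / 2) ^ k < ?u" using real_arch_pow_inv[OF u, of "1 / 2"] by simp
        then obtain n where n: "(1 / 2) ^ n < ?u" "\<And>m. m < n \<Longrightarrow> \<not> (1 / 2) ^ m < ?u"
          using exists_least_iff[of "\<lambda>k. (1 / 2) ^ k < ?u"] by auto
        have "n \<noteq> 0" using n(1) False by (intro notI) simp
        then obtain k where k: "n = Suc k" by (cases n) auto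
        have tS: "t \<in> S k" using n(2)[of k] k by (simp add: S_def)
        have "((1 / 2) ^ Suc k) powr \<gamma> \<le> ?u powr \<gamma>"
          using n(1) k \<gamma> by (intro powr_mono2) auto
        moreover have "((1 / 2) ^ Suc k) powr \<gamma> = inverse (a k)"
        proof -
          have "(1 / 2 :: real) ^ Suc k = 2 powr (- (real k + 1))"
            by (subst powr_minus) (simp add: powr_add powr_realpow divide_simps)
          then show ?thesis by (simp add: a_def powr_powr powr_minus[symmetric] algebra_simps)
        qed
        ultimately have "recip (?u powr \<gamma>) \<le> recip (inverse (a k))" by (intro recip_mono) simp
        also have "\<dots> = ennreal (a k) * indicator (S k) t" using tS by (simp add: recip_pos a_def)
        also have "\<dots> = (\<Sum>i\<in>{k}. ennreal (a i) * indicator (S i) t)"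
          by (simp only: sum.insert sum.empty finite.emptyI empty_iff not_False_eq_True add_0_right)
        also have "\<dots> \<le> (\<Sum>k. ennreal (a k) * indicator (S k) t)" by (intro sum_le_suminf) auto
        finally show ?thesis by (simp add: add_increasing)
      qed
    qed
    have "(\<integral>\<^sup>+ t. recip (\<bar>\<rho> * t + c\<bar> powr \<gamma>) \<partial>unit_interval)
        = (\<integral>\<^sup>+ t. recip (\<bar>\<rho> * t + c\<bar> powr \<gamma>) * indicator {0..1} t \<partial>lborel)"
      unfolding unit_interval_def by (subst nn_integral_restrict_space) auto
    also have "\<dots> \<le> (\<integral>\<^sup>+ t. indicator {0..1} t + (\<Sum>k. ennreal (a k) * indicator (S k) t) \<partial>lborel)"
    proof (rule nn_integral_mono_AE)
      \<comment> \<open>The integrand is infinite at this single point, which the pointwise bound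
        \<open>pt\<close> leaves out.\<close>
      have "AE t in lborel. t \<noteq> - c / \<rho>" by (rule AE_lborel_singleton)
      then show "AE t in lborel. recip (\<bar>\<rho> * t + c\<bar> powr \<gamma>) * indicator {0..1} t
          \<le> indicator {0..1} t + (\<Sum>k. ennreal (a k) * indicator (S k) t)"
      proof (eventually_elim)
        case (elim t)
        then have "\<rho> * t + c \<noteq> 0" using \<rho> by (auto simp: field_simps add_eq_0_iff)
        from pt[OF this] show ?case by (auto split: split_indicator)
      qed
    qed
    also have "\<dots> = (\<integral>\<^sup>+ t. indicator {0..1::real} t \<partial>lborel) + (\<Sum>k. \<integral>\<^sup>+ t. ennreal (a k) * indicator (S k) t \<partial>lborel)"
      by (subst nn_integral_add) (auto simp: nn_integral_suminf)
    also have "\<dots> = 1 + (\<Sum>k. ennreal (b k))"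
    proof -
      have "ennreal (a k) * ennreal (2 * (1 / 2) ^ k / \<rho>) = ennreal (b k)" for k
        unfolding b_def using \<rho> by (intro ennreal_mult[symmetric]) (simp_all add: a_def)
      then show ?thesis by (simp add: nn_integral_cmult eS)
    qed
    also have "\<dots> = ennreal C"
      using sb b0 by (simp add: C_def suminf_ennreal2 suminf_nonneg)
    finally show ?thesis .
  qed
  moreover have "1 \<le> C" using sb b0 by (simp add: C_def suminf_nonneg)
  ultimately show thesis using that by blast
qed

definition cube :: "('x::finite \<Rightarrow> real) measure" where
  "cube = PiM UNIV (\<lambda>_. unit_interval)"

lemma prob_space_cube: "prob_space cube"
  unfolding cube_def by (intro prob_space_PiM prob_space_unit_interval)

lemma space_cube: "space cube = {\<sigma>. \<forall>x. 0 \<le> \<sigma> x \<and> \<sigma> x \<le> 1}"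
  by (auto simp: cube_def space_PiM PiE_def Pi_def)

lemma measurable_cube_component [measurable]: "(\<lambda>\<sigma>. \<sigma> x) \<in> borel_measurable cube"
proof -
  have "(\<lambda>\<sigma>. \<sigma> x) \<in> measurable cube unit_interval" unfolding cube_def by simp
  moreover have "(\<lambda>t. t) \<in> borel_measurable unit_interval" by (intro measurable_unit_interval) simp
  ultimately show ?thesis using measurable_compose by blast
qed

definition mix :: "'x set \<Rightarrow> ('x \<Rightarrow> real) \<Rightarrow> ('x \<Rightarrow> real) \<Rightarrow> 'x \<Rightarrow> real" where
  "mix \<Omega> \<sigma> \<tau> x = (if x \<in> \<Omega> then \<tau> x else \<sigma> x)"

lemma measurable_mix: "(\<lambda>p. mix \<Omega> (fst p) (snd p)) \<in> measurable (cube \<Otimes>\<^sub>M cube) cube"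
proof -
  have 1: "(\<lambda>p. (fst p) x) \<in> measurable (cube \<Otimes>\<^sub>M cube) unit_interval" for x
    unfolding cube_def by (rule measurable_compose[OF measurable_fst]) simp
  have 2: "(\<lambda>p. (snd p) x) \<in> measurable (cube \<Otimes>\<^sub>M cube) unit_interval" for x
    unfolding cube_def by (rule measurable_compose[OF measurable_snd]) simp
  have "(\<lambda>p. mix \<Omega> (fst p) (snd p) x) \<in> measurable (cube \<Otimes>\<^sub>M cube) unit_interval" for x
    unfolding mix_def using 1 2 by (cases "x \<in> \<Omega>") auto
  then have "(\<lambda>p. \<lambda>x\<in>UNIV. mix \<Omega> (fst p) (snd p) x) \<in> measurable (cube \<Otimes>\<^sub>M cube) (PiM UNIV (\<lambda>_. unit_interval))"
    by (intro measurable_restrict)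
  then show ?thesis by (simp add: cube_def restrict_UNIV)
qed

text \<open>Fubini in the form that redrawing the coordinates in \<Omega> independently does not
  change the law. Both variables keep the full index set, so it can be applied repeatedly with
  different \<Omega>.\<close>

lemma nn_integral_resample:
  fixes F :: "('x::finite \<Rightarrow> real) \<Rightarrow> ennreal"
  assumes F: "F \<in> borel_measurable cube"
  shows "(\<integral>\<^sup>+ \<sigma>. F \<sigma> \<partial>cube) = (\<integral>\<^sup>+ \<sigma>. \<integral>\<^sup>+ \<tau>. F (mix \<Omega> \<sigma> \<tau>) \<partial>cube \<partial>cube)"
proof -
  interpret U: prob_space unit_interval by (rule prob_space_unit_interval)
  interpret P: product_prob_space "\<lambda>_ :: 'x. unit_interval" UNIV ..
  interpret C: prob_space "cube :: ('x \<Rightarrow> real) measure" by (rule prob_space_cube)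
  let ?N = "PiM (- \<Omega>) (\<lambda>_. unit_interval)" and ?O = "PiM \<Omega> (\<lambda>_. unit_interval)"
  interpret N: prob_space ?N by (intro prob_space_PiM prob_space_unit_interval)
  interpret O: prob_space ?O by (intro prob_space_PiM prob_space_unit_interval)
  have fold: "(\<integral>\<^sup>+ \<sigma>. G \<sigma> \<partial>cube) = (\<integral>\<^sup>+ x. \<integral>\<^sup>+ y. G (merge (- \<Omega>) \<Omega> (x, y)) \<partial>?O \<partial>?N)"
    if "G \<in> borel_measurable cube" for G :: "('x \<Rightarrow> real) \<Rightarrow> ennreal"
  proof -
    have "- \<Omega> \<union> \<Omega> = UNIV" by auto
    then show ?thesis
      using P.product_nn_integral_fold[of "- \<Omega>" \<Omega> G] that by (simp add: cube_def)
  qed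
  have mixm: "(\<lambda>p. F (mix \<Omega> (fst p) (snd p))) \<in> borel_measurable (cube \<Otimes>\<^sub>M cube)"
    by (rule measurable_compose[OF measurable_mix F])
  have inner: "(\<integral>\<^sup>+ \<tau>. F (mix \<Omega> \<sigma> \<tau>) \<partial>cube) = (\<integral>\<^sup>+ y. F (mix \<Omega> \<sigma> y) \<partial>?O)" if "\<sigma> \<in> space cube" for \<sigma>
  proof -
    have m: "(\<lambda>\<tau>. F (mix \<Omega> \<sigma> \<tau>)) \<in> borel_measurable cube"
      using measurable_compose[OF measurable_Pair1'[OF that] mixm] by simp
    have "mix \<Omega> \<sigma> (merge (- \<Omega>) \<Omega> (x, y)) = mix \<Omega> \<sigma> y" for x y
      by (rule ext) (simp add: mix_def merge_def)
    then show ?thesis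
      unfolding fold[OF m] by (simp add: N.emeasure_space_1)
  qed
  have "(\<integral>\<^sup>+ \<sigma>. \<integral>\<^sup>+ \<tau>. F (mix \<Omega> \<sigma> \<tau>) \<partial>cube \<partial>cube)
     = (\<integral>\<^sup>+ x. \<integral>\<^sup>+ y'. (\<integral>\<^sup>+ \<tau>. F (mix \<Omega> (merge (- \<Omega>) \<Omega> (x, y')) \<tau>) \<partial>cube) \<partial>?O \<partial>?N)"
  proof (rule fold)
    show "(\<lambda>\<sigma>. \<integral>\<^sup>+ \<tau>. F (mix \<Omega> \<sigma> \<tau>) \<partial>cube) \<in> borel_measurable cube"
      using C.borel_measurable_nn_integral_fst[OF mixm] by simp
  qed
  also have "\<dots> = (\<integral>\<^sup>+ x. \<integral>\<^sup>+ y'. (\<integral>\<^sup>+ y. F (merge (- \<Omega>) \<Omega> (x, y)) \<partial>?O) \<partial>?O \<partial>?N)"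
  proof (intro nn_integral_cong)
    fix x :: "'x \<Rightarrow> real" and y' :: "'x \<Rightarrow> real" assume xy: "x \<in> space ?N" "y' \<in> space ?O"
    have "merge (- \<Omega>) \<Omega> (x, y') \<in> space cube"
      using xy by (auto simp: space_cube space_PiM merge_def PiE_def Pi_def)
    from inner[OF this]
    have "(\<integral>\<^sup>+ \<tau>. F (mix \<Omega> (merge (- \<Omega>) \<Omega> (x, y')) \<tau>) \<partial>cube)
       = (\<integral>\<^sup>+ y. F (mix \<Omega> (merge (- \<Omega>) \<Omega> (x, y')) y) \<partial>?O)" .
    also have "\<dots> = (\<integral>\<^sup>+ y. F (merge (- \<Omega>) \<Omega> (x, y)) \<partial>?O)"
      by (intro nn_integral_cong arg_cong[where f = F]) (auto simp: mix_def merge_def)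
    finally show "(\<integral>\<^sup>+ \<tau>. F (mix \<Omega> (merge (- \<Omega>) \<Omega> (x, y')) \<tau>) \<partial>cube)
       = (\<integral>\<^sup>+ y. F (merge (- \<Omega>) \<Omega> (x, y)) \<partial>?O)" .
  qed
  also have "\<dots> = (\<integral>\<^sup>+ x. \<integral>\<^sup>+ y. F (merge (- \<Omega>) \<Omega> (x, y)) \<partial>?O \<partial>?N)"
    by (simp add: O.emeasure_space_1)
  finally show ?thesis using fold[OF F] by simp
qed

text \<open>
  A point whose coordinates are independent and uniform stays away from a subspace of codimension
  \<open>p\<close>: by pivoting, \<open>p\<close> of its coordinates are close to given functions of the remaining ones
  whenever it is close to the subspace.
\<close>

lemma integral_infdist_power:
  fixes \<rho> \<beta> :: real
  assumes \<rho>: "0 < \<rho>" and \<beta>: "0 < \<beta>" "\<beta> < real (CARD('m) - e)" and e: "e \<le> CARD('m)"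
  obtains C where "0 \<le> C" "\<And>(E :: (real ^ 'm::finite) set) g (ps :: 'm \<Rightarrow> 'x::finite).
    subspace E \<Longrightarrow> dim E \<le> e \<Longrightarrow> inj ps \<Longrightarrow>
    (\<integral>\<^sup>+ \<tau>. recip (infdist ((\<chi> i. \<rho> * \<tau> (ps i)) + g) E powr \<beta>) \<partial>cube) \<le> ennreal C"
proof -
  let ?p = "CARD('m) - e"
  \<comment> \<open>The exponent is shared equally among the \<open>?p\<close> dependent
    coordinates; each share is below 1, hence integrable in one variable.\<close>
  define \<gamma> where "\<gamma> = \<beta> / real ?p"
  have p: "0 < ?p" using \<beta> by (cases ?p) auto
  have \<gamma>: "0 < \<gamma>" "\<gamma> < 1" using \<beta> p by (auto simp: \<gamma>_def)
  obtain C1 where C1: "1 \<le> C1" "\<And>c. (\<integral>\<^sup>+ t. recip (\<bar>\<rho> * t + c\<bar> powr \<gamma>) \<partial>unit_interval) \<le> ennreal C1"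
    using integral_inverse_power_le[OF \<rho> \<gamma>] by blast
  define K where "K = 1 + real CARD('m) * (real CARD('m) + 1) ^ CARD('m)"
  have K: "1 \<le> K" by (simp add: K_def)
  define C where "C = K powr \<beta> * C1 ^ CARD('x)"
  have "(\<integral>\<^sup>+ \<tau>. recip (infdist ((\<chi> i. \<rho> * \<tau> (ps i)) + g) E powr \<beta>) \<partial>cube) \<le> ennreal C"
    if E: "subspace E" "dim E \<le> e" and inj: "inj ps" for E :: "(real ^ 'm) set" and g and ps :: "'m \<Rightarrow> 'x"
  proof -
    interpret U: prob_space unit_interval by (rule prob_space_unit_interval)
    interpret P: product_prob_space "\<lambda>_ :: 'x. unit_interval" UNIV ..
    interpret Cu: prob_space "cube :: ('x \<Rightarrow> real) measure" by (rule prob_space_cube)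
    obtain J J0 \<kappa> where J: "J0 \<subseteq> J" "card J0 = ?p"
      "\<And>x i. i \<in> J0 \<Longrightarrow> \<bar>x $ i - (\<Sum>l\<in>-J. (x $ l) * \<kappa> l i)\<bar> \<le> K * infdist x E"
      by (rule infdist_ge_pivot[OF E e, folded K_def], rule that, assumption, assumption, assumption)
    define c where "c \<tau> i = g $ i - (\<Sum>l\<in>-J. (\<rho> * \<tau> (ps l) + g $ l) * \<kappa> l i)" for \<tau> :: "'x \<Rightarrow> real" and i
    define F where "F \<tau> = (\<Prod>i\<in>J0. recip (\<bar>\<rho> * \<tau> (ps i) + c \<tau> i\<bar> powr \<gamma>))" for \<tau>
    have cm [measurable]: "(\<lambda>\<tau>. c \<tau> i) \<in> borel_measurable cube" for i
      unfolding c_def by measurable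
    have Fm: "F \<in> borel_measurable cube"
      unfolding F_def by measurable
    have pt: "recip (infdist ((\<chi> i. \<rho> * \<tau> (ps i)) + g) E powr \<beta>) \<le> ennreal (K powr \<beta>) * F \<tau>" for \<tau>
    proof -
      define d where "d = infdist ((\<chi> i. \<rho> * \<tau> (ps i)) + g) E"
      have d: "0 \<le> d" by (simp add: d_def infdist_nonneg)
      have le: "\<bar>\<rho> * \<tau> (ps i) + c \<tau> i\<bar> \<le> K * d" if "i \<in> J0" for i
        using J(3)[OF that, of "(\<chi> i. \<rho> * \<tau> (ps i)) + g"] by (simp add: c_def d_def algebra_simps)
      have "(\<Prod>i\<in>J0. \<bar>\<rho> * \<tau> (ps i) + c \<tau> i\<bar> powr \<gamma>) \<le> (\<Prod>i\<in>J0. (K * d) powr \<gamma>)"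
        using le \<gamma> by (intro prod_mono) (auto intro!: powr_mono2)
      also have "\<dots> = (K * d) powr \<beta>"
        using p d K \<gamma> J(2) by (cases "d = 0") (simp_all add: powr_realpow[symmetric] powr_powr \<gamma>_def zero_power)
      also have "\<dots> = K powr \<beta> * d powr \<beta>" by (rule powr_mult)
      finally have "recip (K powr \<beta> * d powr \<beta>) \<le> recip (\<Prod>i\<in>J0. \<bar>\<rho> * \<tau> (ps i) + c \<tau> i\<bar> powr \<gamma>)"
        by (rule recip_mono)
      then have "recip (K powr \<beta>) * recip (d powr \<beta>) \<le> F \<tau>" by (simp add: recip_mult recip_prod F_def)
      then have "ennreal (K powr \<beta>) * (recip (K powr \<beta>) * recip (d powr \<beta>)) \<le> ennreal (K powr \<beta>) * F \<tau>"
        by (intro mult_left_mono) auto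
      moreover have "ennreal (K powr \<beta>) * recip (K powr \<beta>) = 1"
        using K by (simp add: recip_pos ennreal_mult[symmetric])
      ultimately show ?thesis by (simp add: d_def mult.assoc[symmetric])
    qed
    have Fint: "(\<integral>\<^sup>+ \<tau>. F \<tau> \<partial>cube) \<le> ennreal (C1 ^ CARD('x))"
    proof -
      \<comment> \<open>Only the coordinates that belong to \<open>J0\<close> are redrawn. The
        offsets \<open>c\<close> involve indices outside \<open>J\<close> only, so they stay fixed
        and the inner integral factorizes.\<close>
      let ?\<Omega> = "ps ` J0"
      have "(\<integral>\<^sup>+ \<tau>. F \<tau> \<partial>cube) = (\<integral>\<^sup>+ \<tau>. \<integral>\<^sup>+ \<tau>'. F (mix ?\<Omega> \<tau> \<tau>') \<partial>cube \<partial>cube)"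
        by (rule nn_integral_resample[OF Fm])
      also have "\<dots> \<le> (\<integral>\<^sup>+ \<tau>. ennreal (C1 ^ CARD('x)) \<partial>(cube :: ('x \<Rightarrow> real) measure))"
      proof (intro nn_integral_mono)
        fix \<tau> :: "'x \<Rightarrow> real"
        define f where "f x t = (if x \<in> ?\<Omega> then recip (\<bar>\<rho> * t + c \<tau> (the_inv ps x)\<bar> powr \<gamma>) else 1)" for x t
        have "F (mix ?\<Omega> \<tau> \<tau>') = (\<Prod>x\<in>UNIV. f x (\<tau>' x))" for \<tau>'
        proof -
          have "c (mix ?\<Omega> \<tau> \<tau>') i = c \<tau> i" for i
            unfolding c_def using J(1) inj
            by (intro arg_cong2[of _ _ _ _ "(-)"] refl sum.cong) (auto simp: mix_def inj_eq)
          then have "F (mix ?\<Omega> \<tau> \<tau>') = (\<Prod>i\<in>J0. f (ps i) (\<tau>' (ps i)))"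
            unfolding F_def using inj by (intro prod.cong) (auto simp: f_def mix_def the_inv_f_f)
          also have "\<dots> = (\<Prod>x\<in>?\<Omega>. f x (\<tau>' x))"
            by (simp add: prod.reindex[OF inj_on_subset[OF inj subset_UNIV]])
          also have "\<dots> = (\<Prod>x\<in>UNIV. f x (\<tau>' x))"
            by (rule prod.mono_neutral_left) (auto simp: f_def)
          finally show ?thesis .
        qed
        then have "(\<integral>\<^sup>+ \<tau>'. F (mix ?\<Omega> \<tau> \<tau>') \<partial>cube) = (\<integral>\<^sup>+ \<tau>'. (\<Prod>x\<in>UNIV. f x (\<tau>' x)) \<partial>cube)" by simp
        also have "\<dots> = (\<Prod>x\<in>UNIV. \<integral>\<^sup>+ t. f x t \<partial>unit_interval)"
          unfolding cube_def
        proof (rule P.product_nn_integral_prod)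
          fix x
          have "f x \<in> borel_measurable borel" unfolding f_def by (cases "x \<in> ?\<Omega>") simp_all
          then show "f x \<in> borel_measurable unit_interval" by (rule measurable_unit_interval)
        qed simp
        also have "\<dots> \<le> (\<Prod>x\<in>(UNIV :: 'x set). ennreal C1)"
        proof (intro prod_mono_ennreal)
          fix x
          show "(\<integral>\<^sup>+ t. f x t \<partial>unit_interval) \<le> ennreal C1"
          proof (cases "x \<in> ?\<Omega>")
            case True
            then show ?thesis using C1(2) by (simp add: f_def)
          next
            case False
            then have "(\<integral>\<^sup>+ t. f x t \<partial>unit_interval) = 1" using U.emeasure_space_1 by (simp add: f_def)
            then show ?thesis using C1(1) by simp
          qed
        qed
        also have "\<dots> = ennreal (C1 ^ CARD('x))" using C1(1) by (simp add: ennreal_power)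
        finally show "(\<integral>\<^sup>+ \<tau>'. F (mix ?\<Omega> \<tau> \<tau>') \<partial>cube) \<le> ennreal (C1 ^ CARD('x))" .
      qed
      also have "\<dots> = ennreal (C1 ^ CARD('x))" by (simp add: Cu.emeasure_space_1)
      finally show ?thesis .
    qed
    have "(\<integral>\<^sup>+ \<tau>. recip (infdist ((\<chi> i. \<rho> * \<tau> (ps i)) + g) E powr \<beta>) \<partial>cube) \<le> (\<integral>\<^sup>+ \<tau>. ennreal (K powr \<beta>) * F \<tau> \<partial>cube)"
      by (intro nn_integral_mono pt)
    also have "\<dots> = ennreal (K powr \<beta>) * (\<integral>\<^sup>+ \<tau>. F \<tau> \<partial>cube)" by (rule nn_integral_cmult[OF Fm])
    also have "\<dots> \<le> ennreal (K powr \<beta>) * ennreal (C1 ^ CARD('x))" by (intro mult_left_mono Fint) simp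
    also have "\<dots> = ennreal C" using C1(1) by (simp add: C_def ennreal_mult)
    finally show ?thesis .
  qed
  moreover have "0 \<le> C" using C1(1) K by (simp add: C_def)
  ultimately show thesis using that by blast
qed

section \<open>Moments of the expanded component\<close>

definition mat_app :: "('m::finite \<Rightarrow> 'n::finite \<Rightarrow> real) \<Rightarrow> real ^ 'n \<Rightarrow> real ^ 'm" where
  "mat_app s q = (\<chi> i. \<Sum>j\<in>UNIV. s i j * q $ j)"

definition expand :: "('m::finite \<Rightarrow> 'n::finite \<Rightarrow> real) \<Rightarrow> (real ^ 'm) \<times> (real ^ 'n) \<Rightarrow> real ^ 'm" where
  "expand s v = fst v + mat_app s (snd v)"

lemma linear_mat_app: "linear (mat_app s)"
  by (intro linearI) (simp_all add: mat_app_def Finite_Cartesian_Product.vec_eq_iff sum.distrib distrib_left sum_distrib_left mult_ac)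

lemma linear_expand: "linear (expand s)"
  unfolding expand_def
  by (intro linearI)
     (simp_all add: linear_add[OF linear_mat_app] linear_scale[OF linear_mat_app] algebra_simps)

lemma expand_nth: "expand s v $ i = fst v $ i + (\<Sum>j\<in>UNIV. s i j * snd v $ j)"
  by (simp add: expand_def mat_app_def)

lemma borel_measurable_det:
  fixes f :: "nat \<Rightarrow> nat \<Rightarrow> 'a \<Rightarrow> real"
  assumes "\<And>i j. i < n \<Longrightarrow> j < n \<Longrightarrow> f i j \<in> borel_measurable M"
  shows "(\<lambda>\<sigma>. Determinant.det (Matrix.mat n n (\<lambda>(i, j). f i j \<sigma>))) \<in> borel_measurable M"
proof -
  have "Determinant.det (Matrix.mat n n (\<lambda>(i, j). f i j \<sigma>))
    = (\<Sum>p\<in>{p. p permutes {0..<n}}. signof p * (\<Prod>i = 0..<n. f i (p i) \<sigma>))" for \<sigma>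
  proof (subst det_def'[of _ n], simp, intro sum.cong refl arg_cong2[of _ _ _ _ "(*)"] prod.cong)
    fix p i assume "p \<in> {p. p permutes {0..<n}}" "i \<in> {0..<n}"
    then show "Matrix.mat n n (\<lambda>(i, j). f i j \<sigma>) $$ (i, p i) = f i (p i) \<sigma>"
      using permutes_in_image[of p "{0..<n}" i] by simp
  qed
  moreover have "(\<lambda>\<sigma>. \<Sum>p\<in>{p. p permutes {0..<n}}. signof p * (\<Prod>i = 0..<n. f i (p i) \<sigma>)) \<in> borel_measurable M"
  proof (intro borel_measurable_sum borel_measurable_times borel_measurable_const borel_measurable_prod)
    fix p i assume "p \<in> {p. p permutes {0..<n}}" "i \<in> {0..<n}"
    then show "f i (p i) \<in> borel_measurable M"
      using permutes_in_image[of p "{0..<n}" i] assms by simp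
  qed
  ultimately show ?thesis by simp
qed

lemma vol_map: "vol (map f v) = sqrt (Determinant.det (Matrix.mat (length v) (length v) (\<lambda>(i, j). f (v ! i) \<bullet> f (v ! j))))"
proof -
  have "Matrix.mat (length v) (length v) (\<lambda>(i, j). map f v ! i \<bullet> map f v ! j)
      = Matrix.mat (length v) (length v) (\<lambda>(i, j). f (v ! i) \<bullet> f (v ! j))"
    by (intro cong_mat) auto
  then show ?thesis by (simp add: vol_def gdet_def)
qed

lemma measurable_vol_expand [measurable]:
  fixes pos :: "'m::finite \<Rightarrow> 'n::finite \<Rightarrow> 'x::finite"
  shows "(\<lambda>\<sigma>. vol (map (expand (\<lambda>i j. \<rho> * \<sigma> (pos i j))) v)) \<in> borel_measurable cube"
  unfolding vol_map
proof (intro measurable_compose[OF _ borel_measurable_sqrt] borel_measurable_det)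
  fix k l
  have "expand (\<lambda>i j. \<rho> * \<sigma> (pos i j)) (v ! k) \<bullet> expand (\<lambda>i j. \<rho> * \<sigma> (pos i j)) (v ! l)
     = (\<Sum>i\<in>UNIV. (fst (v ! k) $ i + (\<Sum>j\<in>UNIV. \<rho> * \<sigma> (pos i j) * snd (v ! k) $ j))
         * (fst (v ! l) $ i + (\<Sum>j\<in>UNIV. \<rho> * \<sigma> (pos i j) * snd (v ! l) $ j)))" for \<sigma>
    by (simp add: inner_vec_def expand_nth)
  then show "(\<lambda>\<sigma>. expand (\<lambda>i j. \<rho> * \<sigma> (pos i j)) (v ! k) \<bullet> expand (\<lambda>i j. \<rho> * \<sigma> (pos i j)) (v ! l)) \<in> borel_measurable cube"
    by simp
qed

lemma measurable_infdist_affine [measurable]: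
  fixes g :: "real ^ 'm::finite" and ps :: "'m \<Rightarrow> 'x::finite"
  shows "(\<lambda>\<tau>. infdist ((\<chi> i. \<rho> * \<tau> (ps i)) + g) E) \<in> borel_measurable cube"
proof -
  have "(\<lambda>\<tau>. (\<chi> i. \<rho> * \<tau> (ps i)) + g) \<in> borel_measurable cube"
    by (subst borel_measurable_euclidean_space) (auto simp: Basis_vec_def inner_axis)
  moreover have "(\<lambda>x. infdist x E) \<in> borel_measurable borel"
    by (intro borel_measurable_continuous_onI continuous_on_infdist continuous_on_id)
  ultimately show ?thesis by (rule measurable_compose)
qed

definition pivot_const :: "nat \<Rightarrow> real" where
  "pivot_const d = (real d + 1) ^ d"

lemma pivot_const_ge_1: "1 \<le> pivot_const d"
  by (simp add: pivot_const_def)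

text \<open>\<open>pivot_basis\<close> for the span of \<open>v\<close>, with the pivots sorted by
  the factor they belong to. Vectors with a pivot in the first factor form an identity block there
  and vanish at the pivots of the second; this shape is what allows single columns of the matrix to
  be integrated out.\<close>

lemma pivot_basis_pair:
  fixes v :: "((real ^ 'm) \<times> (real ^ 'n)) list"
  assumes v: "vol v > 0"
  obtains la :: "'m list" and lb :: "'n list" and wa wb where
    "distinct la" "distinct lb" "length la + length lb = length v"
    "vol (map wa la @ map wb lb) > 0"
    "set v \<subseteq> span (set (map wa la @ map wb lb))"
    "\<And>i i'. i \<in> set la \<Longrightarrow> i' \<in> set la \<Longrightarrow> fst (wa i) $ i' = (if i = i' then 1 else 0)"
    "\<And>i j. i \<in> set la \<Longrightarrow> j \<in> set lb \<Longrightarrow> snd (wa i) $ j = 0"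
    "\<And>j j'. j \<in> set lb \<Longrightarrow> j' \<in> set lb \<Longrightarrow> snd (wb j) $ j' = (if j = j' then 1 else 0)"
    "\<And>i j. i \<in> set la \<Longrightarrow> \<bar>snd (wa i) $ j\<bar> \<le> pivot_const (CARD('m) + CARD('n))"
    "vol (map wa la @ map wb lb) \<le> (real (CARD('m) + CARD('n)) * pivot_const (CARD('m) + CARD('n))) ^ length v"
proof -
  let ?D = "CARD('m) + CARD('n)" and ?V = "span (set v)"
  have D: "DIM((real ^ 'm) \<times> (real ^ 'n)) = ?D" by simp
  have dimV: "dim ?V = length v" by (rule dim_span_list[OF v])
  obtain I and w :: "(real ^ 'm) \<times> (real ^ 'n) \<Rightarrow> (real ^ 'm) \<times> (real ^ 'n)"
    where I: "I \<subseteq> Basis" "card I = dim ?V" "?V = span (w ` I)"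
    and w: "\<And>c d. c \<in> I \<Longrightarrow> d \<in> I \<Longrightarrow> w c \<bullet> d = (if d = c then 1 else 0)"
    and wle': "\<And>c e. c \<in> I \<Longrightarrow> e \<in> Basis \<Longrightarrow> \<bar>w c \<bullet> e\<bar> \<le> (real ?D + 1) ^ dim ?V"
    using pivot_basis[OF subspace_span[of "set v"]] unfolding D by metis
  have wle: "\<bar>w c \<bullet> e\<bar> \<le> pivot_const ?D" if "c \<in> I" "e \<in> Basis" for c e
  proof -
    have "(real ?D + 1) ^ dim ?V \<le> pivot_const ?D"
      unfolding pivot_const_def dimV using length_le_DIM[OF v] unfolding D by (intro power_increasing) auto
    with wle'[OF that] show ?thesis by linarith
  qed
  define fa :: "'m \<Rightarrow> (real ^ 'm) \<times> (real ^ 'n)" where "fa i = (axis i 1, 0)" for i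
  define fb :: "'n \<Rightarrow> (real ^ 'm) \<times> (real ^ 'n)" where "fb j = (0, axis j 1)" for j
  have inja: "inj fa" and injb: "inj fb" by (auto simp: inj_def fa_def fb_def axis_eq_axis)
  have disj: "fa i \<noteq> fb j" for i j by (auto simp: fa_def fb_def axis_eq_0_iff)
  have Bas: "Basis = range fa \<union> range fb"
    by (auto simp: fa_def fb_def Basis_prod_def Basis_vec_def)
  obtain la where la: "set la = fa -` I" "distinct la" using finite_distinct_list[of "fa -` I"] by auto
  obtain lb where lb: "set lb = fb -` I" "distinct lb" using finite_distinct_list[of "fb -` I"] by auto
  have Idec: "I = fa ` set la \<union> fb ` set lb" using I(1) unfolding Bas la lb by auto
  have len: "length la + length lb = length v"
  proof -
    have "card I = card (fa ` set la) + card (fb ` set lb)"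
      unfolding Idec
    proof (intro card_Un_disjoint)
      show "fa ` set la \<inter> fb ` set lb = {}" using disj by (metis disjoint_iff imageE)
    qed auto
    also have "\<dots> = length la + length lb"
      using inja injb la(2) lb(2) by (simp add: card_image inj_on_subset[OF _ subset_UNIV] distinct_card)
    finally show ?thesis using I(2) dimV by simp
  qed
  define wa where "wa i = w (fa i)" for i
  define wb where "wb j = w (fb j)" for j
  have fstn: "fst x $ i = x \<bullet> fa i" and sndn: "snd x $ j = x \<bullet> fb j" for x i j
    by (simp_all add: fa_def fb_def inner_prod_def inner_axis)
  have set': "set (map wa la @ map wb lb) = w ` I"
    unfolding Idec by (auto simp: wa_def wb_def image_iff)
  have sub: "set v \<subseteq> span (set (map wa la @ map wb lb))"
    unfolding set' using I(3) span_superset[of "set v"] by simp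
  have nle: "norm (w c) \<le> real ?D * pivot_const ?D" if "c \<in> I" for c
  proof -
    have "norm (w c) \<le> (\<Sum>e\<in>Basis. \<bar>w c \<bullet> e\<bar>)" by (rule norm_le_l1)
    also have "\<dots> \<le> (\<Sum>e\<in>(Basis :: ((real ^ 'm) \<times> (real ^ 'n)) set). pivot_const ?D)"
      using that wle by (intro sum_mono) auto
    also have "\<dots> = real ?D * pivot_const ?D" using D by simp
    finally show ?thesis .
  qed
  show thesis
  proof (rule that[of la lb wa wb])
    show "vol (map wa la @ map wb lb) > 0"
      by (rule vol_pos_in_span[OF _ sub v]) (simp add: len)
    have "vol (map wa la @ map wb lb) \<le> (real ?D * pivot_const ?D) ^ length (map wa la @ map wb lb)"
      using nle set' by (intro vol_le_prod_norm) auto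
    then show "vol (map wa la @ map wb lb) \<le> (real ?D * pivot_const ?D) ^ length v"
      using len by simp
    show "\<bar>snd (wa i) $ j\<bar> \<le> pivot_const ?D" if "i \<in> set la" for i j
      unfolding wa_def sndn using that la(1) Bas by (intro wle) auto
    show "fst (wa i) $ i' = (if i = i' then 1 else 0)" if "i \<in> set la" "i' \<in> set la" for i i'
      unfolding wa_def fstn using that la(1) inja by (subst w) (auto simp: inj_eq)
    show "snd (wa i) $ j = 0" if "i \<in> set la" "j \<in> set lb" for i j
      unfolding wa_def sndn using that la(1) lb(1) disj[of i j] by (subst w) auto
    show "snd (wb j) $ j' = (if j = j' then 1 else 0)" if "j \<in> set lb" "j' \<in> set lb" for j j'
      unfolding wb_def sndn using that lb(1) injb by (subst w) (auto simp: inj_eq)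
  qed (use la lb len sub in auto)
qed

text \<open>
  The pivots in the first factor keep the corresponding vectors nearly orthonormal under the small
  perturbation, whatever the matrix is. Each pivot \<open>j\<close> in the second factor brings in the \<open>j\<close>-th
  column of the matrix, which enters no other basis vector with such a pivot, so these columns
  can be integrated out one after the other.
\<close>

lemma expand_moment:
  fixes pos :: "'m::finite \<Rightarrow> 'n::finite \<Rightarrow> 'x::finite"
  assumes inj: "\<And>i j i' j'. pos i j = pos i' j' \<Longrightarrow> i = i' \<and> j = j'"
    and k: "1 \<le> k" "k \<le> CARD('m)" and \<beta>: "0 < \<beta>" "\<beta> < real (CARD('m) - (k - 1))"
    and \<rho>: "0 < \<rho>" "2 * \<rho> * real CARD('m) * real CARD('n) * pivot_const (CARD('m) + CARD('n)) \<le> 1"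
  obtains C where "0 \<le> C"
    "\<And>v :: ((real ^ 'm) \<times> (real ^ 'n)) list. length v = k \<Longrightarrow> vol v > 0 \<Longrightarrow>
      (\<integral>\<^sup>+ \<sigma>. recip ((vol (map (expand (\<lambda>i j. \<rho> * \<sigma> (pos i j))) v) / vol v) powr \<beta>) \<partial>cube) \<le> ennreal C"
proof -
  let ?D = "CARD('m) + CARD('n)"
  let ?M = "pivot_const ?D"
  have e: "k - 1 \<le> CARD('m)" using k by simp
  obtain C0 where C0: "0 \<le> C0" "\<And>(E :: (real ^ 'm) set) g (ps :: 'm \<Rightarrow> 'x).
    subspace E \<Longrightarrow> dim E \<le> k - 1 \<Longrightarrow> inj ps \<Longrightarrow>
    (\<integral>\<^sup>+ \<tau>. recip (infdist ((\<chi> i. \<rho> * \<tau> (ps i)) + g) E powr \<beta>) \<partial>cube) \<le> ennreal C0"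
  proof (rule integral_infdist_power[where ?'x = 'x, OF \<rho>(1) \<beta> e])
    fix C assume C: "0 \<le> C" "\<And>(E :: (real ^ 'm) set) g (ps :: 'm \<Rightarrow> 'x).
      subspace E \<Longrightarrow> dim E \<le> k - 1 \<Longrightarrow> inj ps \<Longrightarrow>
      (\<integral>\<^sup>+ \<tau>. recip (infdist ((\<chi> i. \<rho> * \<tau> (ps i)) + g) E powr \<beta>) \<partial>cube) \<le> ennreal C"
    show thesis by (rule that[OF C])
  qed
  define C1 where "C1 = max 1 C0"
  have C1: "1 \<le> C1" "C0 \<le> C1" by (auto simp: C1_def)
  define K where "K = real ?D * ?M"
  have K: "0 \<le> K" using pivot_const_ge_1[of ?D] by (simp add: K_def)
  define C where "C = ((2 ^ k) powr \<beta> * C1 ^ k) * (K ^ k) powr \<beta>"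
  interpret Cu: prob_space "cube :: ('x \<Rightarrow> real) measure" by (rule prob_space_cube)
  have "(\<integral>\<^sup>+ \<sigma>. recip ((vol (map (expand (\<lambda>i j. \<rho> * \<sigma> (pos i j))) v) / vol v) powr \<beta>) \<partial>cube) \<le> ennreal C"
    if v: "length v = k" "vol v > 0" for v :: "((real ^ 'm) \<times> (real ^ 'n)) list"
  proof -
    define t where "t \<sigma> = expand (\<lambda>i j. \<rho> * \<sigma> (pos i j))" for \<sigma> :: "'x \<Rightarrow> real"
    obtain la :: "'m list" and lb :: "'n list" and wa wb where
      w: "distinct la" "distinct lb" "length la + length lb = length v"
      "vol (map wa la @ map wb lb) > 0"
      "set v \<subseteq> span (set (map wa la @ map wb lb))"
      "\<And>i i'. i \<in> set la \<Longrightarrow> i' \<in> set la \<Longrightarrow> fst (wa i) $ i' = (if i = i' then 1 else 0)"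
      "\<And>i j. i \<in> set la \<Longrightarrow> j \<in> set lb \<Longrightarrow> snd (wa i) $ j = 0"
      "\<And>j j'. j \<in> set lb \<Longrightarrow> j' \<in> set lb \<Longrightarrow> snd (wb j) $ j' = (if j = j' then 1 else 0)"
      "\<And>i j. i \<in> set la \<Longrightarrow> \<bar>snd (wa i) $ j\<bar> \<le> ?M"
      "vol (map wa la @ map wb lb) \<le> (real ?D * ?M) ^ length v"
      by (rule pivot_basis_pair[OF v(2)], rule that, assumption+)
    define u where "u l = map wa la @ map wb l" for l
    have um [measurable]: "(\<lambda>\<sigma>. vol (map (t \<sigma>) y)) \<in> borel_measurable cube" for y
      unfolding t_def by (rule measurable_vol_expand)
    have claim: "(\<integral>\<^sup>+ \<sigma>. recip (vol (map (t \<sigma>) (u l)) powr \<beta>) \<partial>cube) \<le> ennreal ((2 ^ length la) powr \<beta> * C1 ^ length l)"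
      if "distinct l" "set l \<subseteq> set lb" for l
      using that
    proof (induction l rule: rev_induct)
      case Nil
      have "recip (vol (map (t \<sigma>) (u [])) powr \<beta>) \<le> ennreal ((2 ^ length la) powr \<beta>)" if \<sigma>: "\<sigma> \<in> space cube" for \<sigma>
      proof -
        \<comment> \<open>The largest deviation from the identity block: \<rho> times
          \<open>CARD('n)\<close> summands of size at most \<open>?M\<close>. The bound on \<rho>
          makes \<open>CARD('m)\<close> times it at most 1/2.\<close>
        define \<epsilon> where "\<epsilon> = \<rho> * real CARD('n) * ?M"
        have "\<epsilon> \<ge> 0" using \<rho> pivot_const_ge_1[of ?D] by (simp add: \<epsilon>_def)
        moreover have "real CARD('m) * \<epsilon> \<le> 1 / 2" using \<rho>(2) by (simp add: \<epsilon>_def algebra_simps)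
        moreover have "\<bar>t \<sigma> (wa i) $ i' - (if i = i' then 1 else 0)\<bar> \<le> \<epsilon>" if "i \<in> set la" "i' \<in> set la" for i i'
        proof -
          have "t \<sigma> (wa i) $ i' - (if i = i' then 1 else 0) = (\<Sum>j\<in>UNIV. \<rho> * \<sigma> (pos i' j) * snd (wa i) $ j)"
            using w(6)[OF that] by (simp add: t_def expand_nth)
          also have "\<bar>\<dots>\<bar> \<le> (\<Sum>j\<in>(UNIV :: 'n set). \<rho> * ?M)"
          proof (intro order_trans[OF sum_abs] sum_mono)
            fix j
            have "\<sigma> (pos i' j) * \<bar>snd (wa i) $ j\<bar> \<le> 1 * ?M"
              using \<sigma> w(9)[OF that(1)] by (intro mult_mono) (auto simp: space_cube)
            then show "\<bar>\<rho> * \<sigma> (pos i' j) * snd (wa i) $ j\<bar> \<le> \<rho> * ?M"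
              using \<sigma> \<rho>(1) by (simp add: abs_mult space_cube)
          qed
          also have "\<dots> = \<epsilon>" by (simp add: \<epsilon>_def)
          finally show ?thesis .
        qed
        ultimately have "(1 / 2) ^ length la \<le> vol (map (\<lambda>i. t \<sigma> (wa i)) la)"
          using w(1) by (intro vol_near_identity[of la _ \<epsilon>])
        then have "((1 / 2) ^ length la) powr \<beta> \<le> vol (map (t \<sigma>) (u [])) powr \<beta>"
          using \<beta>(1) by (intro powr_mono2) (auto simp: u_def o_def)
        then have "recip (vol (map (t \<sigma>) (u [])) powr \<beta>) \<le> recip (((1 / 2) ^ length la) powr \<beta>)" by (rule recip_mono)
        also have "\<dots> = ennreal ((2 ^ length la) powr \<beta>)"
          by (simp add: recip_pos powr_divide power_one_over)
        finally show ?thesis .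
      qed
      then have "(\<integral>\<^sup>+ \<sigma>. recip (vol (map (t \<sigma>) (u [])) powr \<beta>) \<partial>cube) \<le> (\<integral>\<^sup>+ \<sigma>. ennreal ((2 ^ length la) powr \<beta>) \<partial>(cube :: ('x \<Rightarrow> real) measure))"
        by (rule nn_integral_mono)
      then show ?case by (simp add: Cu.emeasure_space_1)
    next
      case (snoc j l)
      then have jl: "j \<in> set lb" "j \<notin> set l" "distinct l" "set l \<subseteq> set lb" by auto
      define \<Omega> where "\<Omega> = range (\<lambda>i. pos i j)"
      have inj': "inj (\<lambda>i. pos i j)" using inj by (auto simp: inj_def)
      define F where "F l' \<sigma> = recip (vol (map (t \<sigma>) (u l')) powr \<beta>)" for l' \<sigma>
      have Fm: "F l' \<in> borel_measurable cube" for l'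
        unfolding F_def by measurable
      \<comment> \<open>At most k - 1 vectors precede the new one, so their span has codimension at
        least \<open>CARD('m) - (k - 1)\<close>, which exceeds \<beta>.\<close>
      have lenl: "length (u l) \<le> k - 1"
      proof -
        have "length (l @ [j]) \<le> length lb"
          using snoc.prems card_mono[of "set lb" "set (l @ [j])"] w(2) by (simp add: distinct_card del: set_append distinct_append length_append) 
        then show ?thesis using w(3) v(1) by (simp add: u_def)
      qed
      have inner: "(\<integral>\<^sup>+ \<tau>. F (l @ [j]) (mix \<Omega> \<sigma> \<tau>) \<partial>cube) \<le> F l \<sigma> * ennreal C1" for \<sigma>
      proof -
        define E where "E = span (set (map (t \<sigma>) (u l)))"
        define g where "g = (\<chi> i. fst (wb j) $ i + (\<Sum>j'\<in>UNIV - {j}. \<rho> * \<sigma> (pos i j') * snd (wb j) $ j'))"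
        \<comment> \<open>A vector that vanishes at j does not see the redrawn column.\<close>
        have old: "t (mix \<Omega> \<sigma> \<tau>) y = t \<sigma> y" if "snd y $ j = 0" for y \<tau>
        proof -
          have "(\<Sum>j'\<in>UNIV. \<rho> * mix \<Omega> \<sigma> \<tau> (pos i j') * snd y $ j') = (\<Sum>j'\<in>UNIV. \<rho> * \<sigma> (pos i j') * snd y $ j')" for i
            using that inj by (intro sum.cong) (auto simp: mix_def \<Omega>_def)
          then show ?thesis by (simp add: t_def Finite_Cartesian_Product.vec_eq_iff expand_nth)
        qed
        have zero: "snd y $ j = 0" if "y \<in> set (u l)" for y
        proof -
          have "y \<in> wa ` set la \<or> y \<in> wb ` set l" using that by (auto simp: u_def)
          then show ?thesis using w(7)[OF _ jl(1)] w(8)[OF _ jl(1)] jl by auto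
        qed
        have new: "t (mix \<Omega> \<sigma> \<tau>) (wb j) = (\<chi> i. \<rho> * \<tau> (pos i j)) + g" for \<tau>
        proof -
          have "(\<Sum>j'\<in>UNIV. \<rho> * mix \<Omega> \<sigma> \<tau> (pos i j') * snd (wb j) $ j')
             = \<rho> * \<tau> (pos i j) + (\<Sum>j'\<in>UNIV - {j}. \<rho> * \<sigma> (pos i j') * snd (wb j) $ j')" for i
          proof -
            have "(\<Sum>j'\<in>UNIV - {j}. \<rho> * mix \<Omega> \<sigma> \<tau> (pos i j') * snd (wb j) $ j')
               = (\<Sum>j'\<in>UNIV - {j}. \<rho> * \<sigma> (pos i j') * snd (wb j) $ j')"
              using inj by (intro sum.cong) (auto simp: mix_def \<Omega>_def)
            then show ?thesis
              using w(8)[OF jl(1) jl(1)] by (subst sum.remove[of _ j]) (auto simp: mix_def \<Omega>_def)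
          qed
          then show ?thesis by (simp add: t_def Finite_Cartesian_Product.vec_eq_iff expand_nth g_def)
        qed
        have "F (l @ [j]) (mix \<Omega> \<sigma> \<tau>) = F l \<sigma> * recip (infdist ((\<chi> i. \<rho> * \<tau> (pos i j)) + g) E powr \<beta>)" for \<tau>
        proof -
          have "map (t (mix \<Omega> \<sigma> \<tau>)) (u (l @ [j])) = map (t \<sigma>) (u l) @ [(\<chi> i. \<rho> * \<tau> (pos i j)) + g]"
            using old zero new by (simp add: u_def)
          then have "vol (map (t (mix \<Omega> \<sigma> \<tau>)) (u (l @ [j])))
             = vol (map (t \<sigma>) (u l)) * infdist ((\<chi> i. \<rho> * \<tau> (pos i j)) + g) E"
            by (simp only: vol_snoc E_def)
          then show ?thesis
            by (simp add: F_def powr_mult infdist_nonneg recip_mult)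
        qed
        then have "(\<integral>\<^sup>+ \<tau>. F (l @ [j]) (mix \<Omega> \<sigma> \<tau>) \<partial>cube)
           = (\<integral>\<^sup>+ \<tau>. F l \<sigma> * recip (infdist ((\<chi> i. \<rho> * \<tau> (pos i j)) + g) E powr \<beta>) \<partial>cube)" by simp
        also have "\<dots> = F l \<sigma> * (\<integral>\<^sup>+ \<tau>. recip (infdist ((\<chi> i. \<rho> * \<tau> (pos i j)) + g) E powr \<beta>) \<partial>cube)"
          by (intro nn_integral_cmult) measurable
        also have "\<dots> \<le> F l \<sigma> * ennreal C0"
        proof (intro mult_left_mono C0(2) inj')
          show "subspace E" by (simp add: E_def)
          have "dim E \<le> card (set (map (t \<sigma>) (u l)))" unfolding E_def dim_span by (intro dim_le_card') simp
          also have "\<dots> \<le> length (u l)" using card_length[of "map (t \<sigma>) (u l)"] by simp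
          finally show "dim E \<le> k - 1" using lenl by simp
        qed simp
        also have "\<dots> \<le> F l \<sigma> * ennreal C1" using C1(2) by (intro mult_left_mono ennreal_leI) auto
        finally show ?thesis .
      qed
      have "(\<integral>\<^sup>+ \<sigma>. F (l @ [j]) \<sigma> \<partial>cube) = (\<integral>\<^sup>+ \<sigma>. \<integral>\<^sup>+ \<tau>. F (l @ [j]) (mix \<Omega> \<sigma> \<tau>) \<partial>cube \<partial>cube)"
        by (rule nn_integral_resample[OF Fm])
      also have "\<dots> \<le> (\<integral>\<^sup>+ \<sigma>. F l \<sigma> * ennreal C1 \<partial>cube)" by (intro nn_integral_mono inner)
      also have "\<dots> = (\<integral>\<^sup>+ \<sigma>. F l \<sigma> \<partial>cube) * ennreal C1" by (intro nn_integral_multc Fm)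
      also have "\<dots> \<le> ennreal ((2 ^ length la) powr \<beta> * C1 ^ length l) * ennreal C1"
        using snoc.IH[OF jl(3,4)] by (intro mult_right_mono) (simp_all add: F_def)
      also have "\<dots> = ennreal ((2 ^ length la) powr \<beta> * C1 ^ length (l @ [j]))"
        using C1(1) by (simp add: ennreal_mult[symmetric] mult_ac)
      finally show ?case by (simp add: F_def)
    qed
    \<comment> \<open>The distortion is the same on the pivot basis, and the volume of that basis
      itself is bounded.\<close>
    have ratio: "vol (map (t \<sigma>) v) / vol v = vol (map (t \<sigma>) (u lb)) / vol (u lb)" for \<sigma>
    proof -
      have "vol (map (t \<sigma>) v) * vol (u lb) = vol v * vol (map (t \<sigma>) (u lb))"
        unfolding u_def t_def using w(3,5) by (intro vol_ratio linear_expand) auto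
      then show ?thesis using v(2) w(4) by (simp add: u_def field_simps)
    qed
    have ul: "0 < vol (u lb)" "vol (u lb) \<le> K ^ k" using w(4,10) v(1) by (auto simp: u_def K_def)
    have pt: "recip ((vol (map (t \<sigma>) v) / vol v) powr \<beta>) \<le> recip (vol (map (t \<sigma>) (u lb)) powr \<beta>) * ennreal ((K ^ k) powr \<beta>)" for \<sigma>
    proof -
      have "recip ((vol (map (t \<sigma>) v) / vol v) powr \<beta>) = recip (vol (map (t \<sigma>) (u lb)) powr \<beta> * inverse (vol (u lb) powr \<beta>))"
        unfolding ratio using ul by (subst powr_divide) (simp_all add: divide_inverse)
      also have "\<dots> = recip (vol (map (t \<sigma>) (u lb)) powr \<beta>) * ennreal (vol (u lb) powr \<beta>)"
        using ul by (subst recip_mult) (auto simp: recip_pos)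
      also have "\<dots> \<le> recip (vol (map (t \<sigma>) (u lb)) powr \<beta>) * ennreal ((K ^ k) powr \<beta>)"
        using ul \<beta>(1) by (intro mult_left_mono ennreal_leI powr_mono2) auto
      finally show ?thesis .
    qed
    have "(\<integral>\<^sup>+ \<sigma>. recip ((vol (map (t \<sigma>) v) / vol v) powr \<beta>) \<partial>cube)
       \<le> (\<integral>\<^sup>+ \<sigma>. recip (vol (map (t \<sigma>) (u lb)) powr \<beta>) * ennreal ((K ^ k) powr \<beta>) \<partial>cube)"
      by (intro nn_integral_mono pt)
    also have "\<dots> = (\<integral>\<^sup>+ \<sigma>. recip (vol (map (t \<sigma>) (u lb)) powr \<beta>) \<partial>cube) * ennreal ((K ^ k) powr \<beta>)"
      by (intro nn_integral_multc) measurable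
    also have "\<dots> \<le> ennreal ((2 ^ k) powr \<beta> * C1 ^ k) * ennreal ((K ^ k) powr \<beta>)"
    proof (intro mult_right_mono)
      have "(2 ^ length la) powr \<beta> * C1 ^ length lb \<le> (2 ^ k) powr \<beta> * C1 ^ k"
        using w(3) v(1) \<beta>(1) C1(1) by (intro mult_mono powr_mono2 power_increasing) auto
      then show "(\<integral>\<^sup>+ \<sigma>. recip (vol (map (t \<sigma>) (u lb)) powr \<beta>) \<partial>cube) \<le> ennreal ((2 ^ k) powr \<beta> * C1 ^ k)"
        using order_trans[OF claim[OF w(2) subset_refl] ennreal_leI] by blast
    qed simp
    also have "\<dots> = ennreal C" using C1(1) by (simp add: C_def ennreal_mult)
    finally show ?thesis by (simp add: t_def)
  qed
  moreover have "0 \<le> C" using C1(1) by (simp add: C_def)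
  ultimately show thesis using that by blast
qed

section \<open>The flow on the space of lattices\<close>

text \<open>The unipotent matrix of \<open>s\<close> followed by the diagonal matrix with entries
  \<open>A\<close> and 1 / \<open>B\<close>. The two parameters are independent here; the unimodular
  case is A^m = B^n.\<close>

definition flow :: "real \<Rightarrow> real \<Rightarrow> ('m::finite \<Rightarrow> 'n::finite \<Rightarrow> real) \<Rightarrow> (real ^ 'm) \<times> (real ^ 'n) \<Rightarrow> (real ^ 'm) \<times> (real ^ 'n)" where
  "flow A B s v = (A *\<^sub>R expand s v, (1 / B) *\<^sub>R snd v)"

lemma linear_flow: "linear (flow A B s)"
  unfolding flow_def
  by (intro linearI)
     (simp_all add: linear_add[OF linear_expand] linear_scale[OF linear_expand] algebra_simps)

text \<open>Conjugation by the diagonal part scales the unipotent part by \<open>A' * B'\<close>. A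
  perturbation of size 1 after the first flow is one of size 1 / (A' B') before it, which is why one
  step divides each side of a cell into A B parts.\<close>

lemma flow_comp:
  assumes "A' \<noteq> 0" "B' \<noteq> 0"
  shows "flow A B t (flow A' B' s v) = flow (A * A') (B * B') (\<lambda>i j. s i j + t i j / (A' * B')) v"
proof -
  have "(A *\<^sub>R expand t (A' *\<^sub>R expand s v, (1 / B') *\<^sub>R snd v)) $ i
     = ((A * A') *\<^sub>R expand (\<lambda>i j. s i j + t i j / (A' * B')) v) $ i" for i
  proof -
    have "(\<Sum>j\<in>UNIV. (s i j + t i j / (A' * B')) * snd v $ j)
        = (\<Sum>j\<in>UNIV. s i j * snd v $ j) + (\<Sum>j\<in>UNIV. t i j / (A' * B') * snd v $ j)"
      by (simp add: distrib_right sum.distrib)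
    moreover have "A' * (\<Sum>j\<in>UNIV. t i j / (A' * B') * snd v $ j) = (\<Sum>j\<in>UNIV. t i j * ((1 / B') * snd v $ j))"
      unfolding sum_distrib_left using assms by (intro sum.cong) (auto simp: field_simps)
    ultimately show ?thesis by (simp add: expand_nth algebra_simps)
  qed
  then show ?thesis by (simp add: flow_def Finite_Cartesian_Product.vec_eq_iff)
qed

lemma flow_id: "flow 1 1 (\<lambda>i j. 0) v = v"
  by (simp add: flow_def prod_eq_iff Finite_Cartesian_Product.vec_eq_iff expand_nth)

lemma inj_flow:
  assumes "A \<noteq> 0" "B \<noteq> 0"
  shows "inj (flow A B s)"
proof (rule inj_on_inverseI)
  fix v
  show "flow (1 / A) (1 / B) (\<lambda>i j. - s i j * (A * B)) (flow A B s v) = v"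
    using assms by (simp add: flow_comp flow_id)
qed

lemma norm_mat_app_le:
  fixes s :: "'m::finite \<Rightarrow> 'n::finite \<Rightarrow> real"
  assumes "\<And>i j. \<bar>s i j\<bar> \<le> r"
  shows "norm (mat_app s q) \<le> real CARD('m) * real CARD('n) * r * norm q"
proof -
  have "norm (mat_app s q) \<le> (\<Sum>i\<in>UNIV. \<bar>mat_app s q $ i\<bar>)" by (rule norm_le_l1_cart)
  also have "\<dots> \<le> (\<Sum>i\<in>(UNIV :: 'm set). \<Sum>j\<in>(UNIV :: 'n set). r * norm q)"
  proof (intro sum_mono)
    fix i :: 'm
    have "\<bar>mat_app s q $ i\<bar> \<le> (\<Sum>j\<in>UNIV. \<bar>s i j * q $ j\<bar>)" by (simp add: mat_app_def sum_abs)
    also have "\<dots> \<le> (\<Sum>j\<in>(UNIV :: 'n set). r * norm q)"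
      unfolding abs_mult using assms order_trans[OF abs_ge_zero assms]
      by (intro sum_mono mult_mono component_le_norm_cart) auto
    finally show "\<bar>mat_app s q $ i\<bar> \<le> (\<Sum>j\<in>(UNIV :: 'n set). r * norm q)" .
  qed
  finally show ?thesis by simp
qed

lemma norm_unipotent_le:
  fixes s :: "'m::finite \<Rightarrow> 'n::finite \<Rightarrow> real"
  assumes "\<And>i j. \<bar>s i j\<bar> \<le> r" "real CARD('m) * real CARD('n) * r \<le> 1"
  shows "norm (flow 1 1 s v) \<le> 2 * norm v"
proof -
  have "flow 1 1 s v = v + (mat_app s (snd v), 0)" by (simp add: flow_def expand_def prod_eq_iff)
  then have "norm (flow 1 1 s v) \<le> norm v + norm (mat_app s (snd v), 0 :: real ^ 'n)"
    using norm_triangle_ineq by metis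
  also have "norm (mat_app s (snd v), 0 :: real ^ 'n) \<le> (real CARD('m) * real CARD('n) * r) * norm (snd v)"
    using norm_mat_app_le[OF assms(1)] by (simp add: norm_Pair)
  also have "\<dots> \<le> 1 * norm v"
    using assms(2) norm_snd_le[of "snd v" "fst v"] by (intro mult_mono) auto
  finally show ?thesis by simp
qed

lemma norm_diag_le:
  fixes v :: "(real ^ 'm::finite) \<times> (real ^ 'n::finite)"
  assumes "\<bar>A\<bar> \<le> K" "\<bar>1 / B\<bar> \<le> K"
  shows "norm (flow A B (\<lambda>i j. 0) v) \<le> K * norm v"
proof -
  have "expand (\<lambda>i j. 0) v = fst v" by (simp add: expand_def mat_app_def Finite_Cartesian_Product.vec_eq_iff)
  then have "norm (flow A B (\<lambda>i j. 0) v) = sqrt ((\<bar>A\<bar> * norm (fst v))\<^sup>2 + (\<bar>1 / B\<bar> * norm (snd v))\<^sup>2)"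
    by (simp add: flow_def norm_Pair)
  also have "\<dots> \<le> sqrt ((K * norm (fst v))\<^sup>2 + (K * norm (snd v))\<^sup>2)"
    using assms by (intro real_sqrt_le_mono add_mono power_mono mult_right_mono) auto
  also have "\<dots> = sqrt (K\<^sup>2 * ((norm (fst v))\<^sup>2 + (norm (snd v))\<^sup>2))"
    by (simp add: power_mult_distrib distrib_left)
  also have "\<dots> = K * norm v"
    using assms(1) by (simp add: real_sqrt_mult norm_prod_def)
  finally show ?thesis .
qed

lemma flow_split: "A \<noteq> 0 \<Longrightarrow> B \<noteq> 0 \<Longrightarrow> flow A B s v = flow A B (\<lambda>i j. 0) (flow 1 1 s v)"
  by (simp add: flow_comp)


text \<open>The images are triangular: the first component of a later vector lies in the span of the
  images of the first factor, so only 1 / \<open>B\<close> counts for it.\<close>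

lemma vol_flow_basis:
  fixes s :: "'m::finite \<Rightarrow> 'n::finite \<Rightarrow> real"
  assumes A: "0 < A" and B: "0 < B" and la: "set la = UNIV" "distinct la" and lb: "distinct lb"
  shows "vol (map (flow A B s) (map (\<lambda>i. (axis i 1, 0)) la @ map (\<lambda>j. (0, axis j 1)) lb)) = A ^ CARD('m) * (1 / B) ^ length lb"
proof -
  define fa where "fa i = flow A B s (axis i 1, 0)" for i
  define fb where "fb j = flow A B s (0, axis j 1)" for j
  have fa: "fa i = (axis i A, 0)" for i
    by (simp add: fa_def flow_def expand_def mat_app_def prod_eq_iff Finite_Cartesian_Product.vec_eq_iff axis_def)
  have fb: "fb j = (A *\<^sub>R (\<chi> i. s i j), axis j (1 / B))" for j
  proof -
    have "expand s (0, axis j 1) $ i = s i j" for i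
    proof -
      have "(\<Sum>j'\<in>UNIV. s i j' * axis j 1 $ j') = (\<Sum>j'\<in>UNIV. if j' = j then s i j else 0)"
        by (intro sum.cong) (auto simp: axis_def)
      then show ?thesis by (simp add: expand_nth)
    qed
    then show ?thesis by (simp add: fb_def flow_def prod_eq_iff Finite_Cartesian_Product.vec_eq_iff axis_def)
  qed
  have 1: "vol (map fa l) = A ^ length l" if "distinct l" for l
    using that
  proof (induction l rule: rev_induct)
    case Nil
    then show ?case by simp
  next
    case (snoc i l)
    have z: "fst w $ i = 0" if "w \<in> span (set (map fa l))" for w
      using that
    proof (induction rule: span_induct)
      case base
      show ?case by (rule real_vector.subspaceI) auto
    next
      case (step x)
      then show ?case using snoc.prems by (auto simp: fa axis_def)
    qed
    have "infdist (0 + fa i) (span (set (map fa l))) = norm (fa i)"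
    proof (rule infdist_span)
      fix w assume "w \<in> span (set (map fa l))"
      then show "fa i \<bullet> w = 0" using z by (simp add: fa inner_prod_def inner_axis')
    qed (rule span_zero)
    moreover have "norm (fa i) = A" using A by (simp add: fa norm_Pair norm_eq_sqrt_inner inner_axis_axis)
    ultimately show ?case using snoc by (simp add: vol_snoc)
  qed
  have "vol (map fa la @ map fb l) = A ^ CARD('m) * (1 / B) ^ length l" if "distinct l" for l
    using that
  proof (induction l rule: rev_induct)
    case Nil
    show ?case using 1[OF la(2)] distinct_card[OF la(2)] la(1) by simp
  next
    case (snoc j l)
    let ?S = "span (set (map fa la @ map fb l))"
    have z: "snd w $ j = 0" if "w \<in> ?S" for w
      using that
    proof (induction rule: span_induct)
      case base
      show ?case by (rule real_vector.subspaceI) auto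
    next
      case (step x)
      then show ?case using snoc.prems by (auto simp: fa fb axis_def)
    qed
    have dec: "fb j = (A *\<^sub>R (\<chi> i. s i j), 0) + (0, axis j (1 / B))" by (simp add: fb)
    have "infdist (fb j) ?S = norm (0 :: real ^ 'm, axis j (1 / B))"
      unfolding dec
    proof (rule infdist_span)
      have "(A *\<^sub>R (\<chi> i. s i j), 0) = (\<Sum>i\<in>UNIV. s i j *\<^sub>R fa i)"
        by (simp add: fa prod_eq_iff fst_sum snd_sum Finite_Cartesian_Product.vec_eq_iff axis_def if_distrib[of "\<lambda>t. _ * t"] sum.delta mult.commute cong: if_cong)
      also have "\<dots> \<in> ?S"
        using la(1) by (intro span_sum span_scale span_base) auto
      finally show "(A *\<^sub>R (\<chi> i. s i j), 0) \<in> ?S" .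
      fix w assume "w \<in> ?S"
      then show "(0, axis j (1 / B)) \<bullet> w = 0" using z by (simp add: inner_prod_def inner_axis')
    qed
    also have "\<dots> = 1 / B" using B by (simp add: norm_Pair norm_eq_sqrt_inner inner_axis_axis real_sqrt_divide)
    finally have "vol ((map fa la @ map fb l) @ [fb j]) = A ^ CARD('m) * (1 / B) ^ length l * (1 / B)"
      using snoc unfolding vol_snoc by simp
    then show ?case by simp
  qed
  from this[OF lb] show ?thesis by (simp add: fa_def[abs_def] fb_def[abs_def] o_def)
qed

text \<open>On the standard basis the powers of \<open>A\<close> and \<open>B\<close> cancel, and
  \<open>vol_ratio\<close> carries this to every list of full length.\<close>

lemma vol_flow:
  fixes s :: "'m::finite \<Rightarrow> 'n::finite \<Rightarrow> real" and xs :: "((real ^ 'm) \<times> (real ^ 'n)) list"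
  assumes AB: "0 < A" "0 < B" "A ^ CARD('m) = B ^ CARD('n)" and len: "length xs = CARD('m) + CARD('n)"
  shows "vol (map (flow A B s) xs) = vol xs"
proof -
  obtain la :: "'m list" where la: "set la = UNIV" "distinct la" using finite_distinct_list[of "UNIV :: 'm set"] by auto
  obtain lb :: "'n list" where lb: "set lb = UNIV" "distinct lb" using finite_distinct_list[of "UNIV :: 'n set"] by auto
  define e :: "((real ^ 'm) \<times> (real ^ 'n)) list"
    where "e = map (\<lambda>i. (axis i 1, 0)) la @ map (\<lambda>j. (0, axis j 1)) lb"
  have llb: "length lb = CARD('n)" and lla: "length la = CARD('m)"
    using la lb distinct_card by metis+
  have "vol (map (flow 1 1 (\<lambda>(i :: 'm) (j :: 'n). 0)) e) = 1"
    unfolding e_def by (subst vol_flow_basis[OF _ _ la lb(2)]) auto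
  then have ve: "vol e = 1" by (simp add: flow_id cong: map_cong)
  have vg: "vol (map (flow A B s) e) = 1"
    unfolding e_def using AB by (subst vol_flow_basis[OF AB(1,2) la lb(2)]) (simp add: llb power_one_over)
  have le: "length xs = length e" using len lla llb by (simp add: e_def)
  have "dim (span (set e)) = DIM((real ^ 'm) \<times> (real ^ 'n))"
    using dim_span_list[of e] ve le len by simp
  then have "span (set e) = UNIV" using dim_eq_full[of "set e"] by simp
  then have "vol (map (flow A B s) xs) * vol e = vol xs * vol (map (flow A B s) e)"
    by (intro vol_ratio linear_flow le) simp
  then show ?thesis by (simp add: ve vg)
qed

lemma vol_isometry:
  assumes "\<And>x y. f x \<bullet> f y = x \<bullet> y"
  shows "vol (map f xs) = vol xs"
  unfolding vol_map assms by (simp add: vol_def gdet_def)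

lemma gdet_orthonormal:
  assumes "\<And>k l. k < length b \<Longrightarrow> l < length b \<Longrightarrow> b ! k \<bullet> b ! l = (if k = l then 1 else 0)"
  shows "gdet b = 1"
proof -
  have "Matrix.mat (length b) (length b) (\<lambda>(i, j). b ! i \<bullet> b ! j) = 1\<^sub>m (length b)"
    by (rule eq_matI) (auto simp: assms)
  then show ?thesis by (simp add: gdet_def)
qed

text \<open>
  Passing to the orthogonal complement and the contragredient map exchanges the roles of the
  expanded and of the contracted directions.
\<close>

lemma vol_complement:
  fixes v :: "'a::euclidean_space list"
  assumes v: "vol v > 0"
  obtains u :: "'a list" where "length u + length v = DIM('a)" "vol u = 1"
    "\<And>g g' :: 'a \<Rightarrow> 'a. linear g \<Longrightarrow> (\<And>x y. g x \<bullet> g' y = x \<bullet> y) \<Longrightarrow>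
       (\<And>xs. length xs = DIM('a) \<Longrightarrow> vol (map g xs) = vol xs) \<Longrightarrow>
       vol (map g v) / vol v = vol (map g' u)"
proof -
  let ?V = "span (set v)"
  define W where "W = {y \<in> (UNIV :: 'a set). \<forall>x\<in>?V. real_inner_class.orthogonal x y}"
  have subW: "subspace W"
    unfolding W_def by (rule real_vector.subspaceI) (auto simp: real_inner_class.orthogonal_def inner_simps)
  have dimW: "dim W + dim ?V = DIM('a)"
    using dim_subspace_orthogonal_to_vectors[of ?V UNIV] by (simp add: W_def)
  obtain B1 where B1: "B1 \<subseteq> ?V" "pairwise real_inner_class.orthogonal B1" "\<And>x. x \<in> B1 \<Longrightarrow> norm x = 1"
    "independent B1" "card B1 = dim ?V" "span B1 = ?V"
    using orthonormal_basis_subspace[OF subspace_span] by blast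
  obtain B2 where B2: "B2 \<subseteq> W" "pairwise real_inner_class.orthogonal B2" "\<And>x. x \<in> B2 \<Longrightarrow> norm x = 1"
    "independent B2" "card B2 = dim W" "span B2 = W"
    using orthonormal_basis_subspace[OF subW] by blast
  have fin: "finite B1" "finite B2" using B1(4) B2(4) independent_imp_finite by blast+
  obtain l1 where l1: "set l1 = B1" "distinct l1" using finite_distinct_list[OF fin(1)] by blast
  obtain l2 where l2: "set l2 = B2" "distinct l2" using finite_distinct_list[OF fin(2)] by blast
  have len1: "length l1 = length v" using l1 B1(5) dim_span_list[OF v] distinct_card[OF l1(2)] by simp
  have len2: "length l2 + length v = DIM('a)"
    using l2 B2(5) dimW dim_span_list[OF v] distinct_card[OF l2(2)] by simp
  define b where "b = l1 @ l2"
  have lenb: "length b = DIM('a)" using len1 len2 by (simp add: b_def)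
  have orth12: "x \<bullet> y = 0" "y \<bullet> x = 0" if "x \<in> B1" "y \<in> B2" for x y
  proof -
    have "x \<in> ?V" "y \<in> W" using that B1(1) B2(1) by auto
    then show "x \<bullet> y = 0" unfolding W_def real_inner_class.orthogonal_def by blast
    then show "y \<bullet> x = 0" by (simp add: inner_commute)
  qed
  have disj: "B1 \<inter> B2 = {}"
  proof -
    have "x \<bullet> x = 1" if "x \<in> B1" for x using B1(3)[OF that] by (simp add: norm_eq_1)
    then show ?thesis using orth12 by fastforce
  qed
  have distb: "distinct b" using l1 l2 disj by (simp add: b_def)
  have setb: "x \<bullet> y = (if x = y then 1 else 0)" if "x \<in> set b" "y \<in> set b" for x y
  proof (cases "x = y")
    case True
    then show ?thesis using that B1(3) B2(3) l1 l2 by (auto simp: b_def norm_eq_1)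
  next
    case False
    then show ?thesis using that B1(2) B2(2) l1 l2 orth12
      by (auto simp: b_def pairwise_def real_inner_class.orthogonal_def)
  qed
  have orthb: "b ! k \<bullet> b ! l = (if k = l then 1 else 0)" if "k < length b" "l < length b" for k l
    using that distb by (simp add: setb nth_eq_iff_index_eq)
  have vl1: "vol l1 = 1"
  proof -
    have "l1 ! k \<bullet> l1 ! l = (if k = l then 1 else 0)" if "k < length l1" "l < length l1" for k l
      using that l1 by (subst setb) (auto simp: b_def nth_eq_iff_index_eq)
    from gdet_orthonormal[OF this] show ?thesis by (simp add: vol_def)
  qed
  have vl2: "vol l2 = 1"
  proof -
    have "l2 ! k \<bullet> l2 ! l = (if k = l then 1 else 0)" if "k < length l2" "l < length l2" for k l
      using that l2 by (subst setb) (auto simp: b_def nth_eq_iff_index_eq)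
    from gdet_orthonormal[OF this] show ?thesis by (simp add: vol_def)
  qed
  have vb: "vol b = 1" using gdet_orthonormal[of b] orthb by (simp add: vol_def)
  have "vol (map g v) / vol v = vol (map g' l2)"
    if g: "linear g" and gg': "\<And>x y. g x \<bullet> g' y = x \<bullet> y"
      and pres: "\<And>xs. length xs = DIM('a) \<Longrightarrow> vol (map g xs) = vol xs" for g g' :: "'a \<Rightarrow> 'a"
  proof -
    \<comment> \<open>As \<open>g'\<close> is contragredient to \<open>g\<close>, these are dual
      bases, and \<open>gdet_complement\<close> relates the part over the span of \<open>v\<close>
      to the complementary part.\<close>
    let ?X = "map g b" and ?Y = "map g' b"
    have vX: "vol ?X = 1" using pres[OF lenb] vb by simp
    have "span (set ?X) = UNIV"
      using dim_span_list[of ?X] vX lenb dim_eq_full[of "set ?X"] by simp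
    then have sub: "set ?Y \<subseteq> span (set ?X)" by blast
    have bi: "?X ! k \<bullet> ?Y ! l = (if k = l then 1 else 0)" if "k < length ?X" "l < length ?X" for k l
      using that by (simp add: gg' orthb)
    have "gdet (take (length l1) ?X) = gdet ?X * gdet (drop (length l1) ?Y)"
      by (rule gdet_complement[OF _ _ sub bi]) (simp_all add: b_def)
    moreover have "gdet ?X = 1" using vX by (simp add: vol_def)
    ultimately have "vol (map g l1) = vol (map g' l2)" by (simp add: vol_def b_def)
    moreover have "vol (map g v) * vol l1 = vol v * vol (map g l1)"
      using len1 l1 B1(6) span_superset[of "set v"] g by (intro vol_ratio) auto
    ultimately show ?thesis using v vl1 by (simp add: field_simps)
  qed
  with len2 vl2 that show thesis by blast
qed

section \<open>Exponents that give every rank the same rate of contraction\<close>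

definition tent :: "nat \<Rightarrow> nat \<Rightarrow> nat \<Rightarrow> real" where
  "tent m n i = min (real i / real m) ((real m + real n - real i) / real n)"

text \<open>\<open>tent\<close> is 0 at the ranks 0 and m+n and 1 at m. Under this exponent the
  scale A^i for i <= m, and likewise B^(m+n-i) for i >= m, becomes (A^m)^(1-\<eta>) in every rank.
  The factor 1-\<eta> keeps the exponent strictly below the threshold of integrability.\<close>

definition beta :: "real \<Rightarrow> nat \<Rightarrow> nat \<Rightarrow> nat \<Rightarrow> real" where
  "beta \<eta> m n i = (1 - \<eta>) / tent m n i"

lemma tent_left: "0 < m \<Longrightarrow> 0 < n \<Longrightarrow> i \<le> m \<Longrightarrow> tent m n i = real i / real m"
  unfolding tent_def by (intro min_absorb1) (auto simp: divide_simps, smt (verit) of_nat_le_iff mult_mono of_nat_0_le_iff mult.commute)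

lemma tent_right: "0 < m \<Longrightarrow> 0 < n \<Longrightarrow> m \<le> i \<Longrightarrow> i \<le> m + n \<Longrightarrow> tent m n i = real (m + n - i) / real n"
  unfolding tent_def
proof (subst min_absorb2)
  assume H: "0 < m" "0 < n" "m \<le> i" "i \<le> m + n"
  have "(real m + real n - real i) / real n \<le> 1" using H by (simp add: divide_simps)
  also have "1 \<le> real i / real m" using H by (simp add: divide_simps)
  finally show "(real m + real n - real i) / real n \<le> real i / real m" .
  show "(real m + real n - real i) / real n = real (m + n - i) / real n" using H by (simp add: of_nat_diff)
qed

text \<open>From (k-1)(m-k) >= 0 follows m <= k(m-k+1), with equality at k = 1 and k = m; the slack
  \<eta> makes the inequality strict there.\<close>

lemma exponent_bound:
  assumes "1 \<le> k" "k \<le> m" "0 < \<eta>"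
  shows "(1 - \<eta>) / (real k / real m) < real (m - (k - 1))"
proof -
  have "(real k - 1) * (real m - real k) \<ge> 0" using assms by (intro mult_nonneg_nonneg) auto
  then have "real m \<le> real k * (real m - (real k - 1))" by (simp add: algebra_simps)
  also have "real m - (real k - 1) = real (m - (k - 1))" using assms by (simp add: of_nat_diff)
  finally have "real m \<le> real k * real (m - (k - 1))" .
  moreover have "(1 - \<eta>) * real m < real m" using assms by simp
  ultimately have "(1 - \<eta>) * real m < real k * real (m - (k - 1))" by (rule order.strict_trans2[rotated])
  then show ?thesis using assms by (simp add: divide_simps mult_ac)
qed

text \<open>The side of the cube of perturbations, small enough for \<open>expand_moment\<close>.\<close>

definition radius :: "nat \<Rightarrow> nat \<Rightarrow> real" where
  "radius m n = 1 / (2 * real m * real n * pivot_const (m + n))"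

lemma radius_pos: "0 < m \<Longrightarrow> 0 < n \<Longrightarrow> 0 < radius m n"
  using pivot_const_ge_1[of "m + n"] by (simp add: radius_def)

lemma radius_le: "0 < m \<Longrightarrow> 0 < n \<Longrightarrow> real m * real n * radius m n \<le> 1"
  using pivot_const_ge_1[of "m + n"] by (simp add: radius_def divide_simps)

lemma radius_bound: "0 < m \<Longrightarrow> 0 < n \<Longrightarrow> 2 * radius m n * real m * real n * pivot_const (m + n) \<le> 1"
  using pivot_const_ge_1[of "m + n"] by (simp add: radius_def)

definition point :: "('m::finite \<times> 'n::finite \<Rightarrow> real) \<Rightarrow> 'm \<Rightarrow> 'n \<Rightarrow> real" where
  "point \<sigma> i j = radius CARD('m) CARD('n) * \<sigma> (i, j)"

text \<open>For i <= m, projecting to the first component does not increase volumes and exhibits the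
  factor A^i beside the volume treated in \<open>expand_moment\<close>. For i > m the same is done
  on the orthogonal complement, of rank m+n-i, where the contragredient map expands the second
  component by \<open>B\<close>.\<close>

lemma step_moment:
  assumes \<eta>: "0 < \<eta>" "\<eta> < 1" and i: "0 < i" "i < CARD('m::finite) + CARD('n::finite)"
  obtains C where "0 \<le> C"
    "\<And>A B (v :: ((real ^ 'm) \<times> (real ^ 'n)) list). 0 < A \<Longrightarrow> 0 < B \<Longrightarrow> A ^ CARD('m) = B ^ CARD('n) \<Longrightarrow>
      length v = i \<Longrightarrow> vol v > 0 \<Longrightarrow>
      (\<integral>\<^sup>+ \<sigma>. recip ((vol (map (flow A B (point \<sigma>)) v) / vol v) powr beta \<eta> CARD('m) CARD('n) i) \<partial>cube)
        \<le> ennreal (C * (A ^ CARD('m)) powr - (1 - \<eta>))"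
proof -
  let ?m = "CARD('m)" and ?n = "CARD('n)"
  let ?b = "beta \<eta> ?m ?n i" and ?\<rho> = "radius ?m ?n"
  have mn: "0 < ?m" "0 < ?n" by auto
  show thesis
  proof (cases "i \<le> ?m")
    case True
    have b: "?b = (1 - \<eta>) / (real i / real ?m)" using True by (simp add: beta_def tent_left)
    have b0: "0 < ?b" using i \<eta> unfolding b by simp
    have ib: "real i * ?b = real ?m * (1 - \<eta>)" using i unfolding b by simp
    have b1: "?b < real (?m - (i - 1))" unfolding b using True i \<eta> by (intro exponent_bound) auto
    have i1: "1 \<le> i" using i by simp
    show thesis
    proof (rule expand_moment[where pos = "Pair :: 'm \<Rightarrow> 'n \<Rightarrow> 'm \<times> 'n", OF _ i1 True b0 b1 radius_pos[OF mn] radius_bound[OF mn]])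
      fix C assume C: "0 \<le> C" "\<And>v :: ((real ^ 'm) \<times> (real ^ 'n)) list. length v = i \<Longrightarrow> vol v > 0 \<Longrightarrow>
        (\<integral>\<^sup>+ \<sigma>. recip ((vol (map (expand (\<lambda>i j. ?\<rho> * \<sigma> (i, j))) v) / vol v) powr ?b) \<partial>cube) \<le> ennreal C"
      show thesis
      proof (rule that[OF C(1)])
        fix A B :: real and v :: "((real ^ 'm) \<times> (real ^ 'n)) list"
        assume AB: "0 < A" "0 < B" "A ^ ?m = B ^ ?n" and v: "length v = i" "vol v > 0"
        have pt: "recip ((vol (map (flow A B (point \<sigma>)) v) / vol v) powr ?b)
            \<le> ennreal ((A ^ ?m) powr - (1 - \<eta>)) * recip ((vol (map (expand (point \<sigma>)) v) / vol v) powr ?b)" for \<sigma>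
        proof -
          let ?t = "vol (map (expand (point \<sigma>)) v)" and ?g = "vol (map (flow A B (point \<sigma>)) v)"
          let ?f = "\<lambda>x :: (real ^ 'm) \<times> (real ^ 'n). (1 / A) *\<^sub>R fst x"
          have "vol (map ?f (map (flow A B (point \<sigma>)) v)) \<le> (1 / A) ^ length (map (flow A B (point \<sigma>)) v) * ?g"
          proof (rule vol_map_le)
            show "linear ?f" by (intro linearI) (simp_all add: algebra_simps)
            show "norm (?f x) \<le> (1 / A) * norm x" for x
              using AB norm_fst_le[of "fst x" "snd x"] by (simp add: divide_right_mono)
          qed (use AB in simp)
          also have "map ?f (map (flow A B (point \<sigma>)) v) = map (expand (point \<sigma>)) v"
            using AB by (simp add: flow_def)
          finally have "A ^ i * ?t \<le> ?g" using AB v(1) by (simp add: field_simps)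
          then have "A ^ i * (?t / vol v) \<le> ?g / vol v" using v(2) by (simp add: divide_right_mono)
          then have "(A ^ i * (?t / vol v)) powr ?b \<le> (?g / vol v) powr ?b"
            using AB b0 by (intro powr_mono2) auto
          moreover have "(A ^ i * (?t / vol v)) powr ?b = (A ^ ?m) powr (1 - \<eta>) * (?t / vol v) powr ?b"
          proof -
            have "(A ^ i) powr ?b = A powr (real i * ?b)" using AB by (simp add: powr_realpow[symmetric] powr_powr)
            also have "\<dots> = (A ^ ?m) powr (1 - \<eta>)" using AB(1,2) unfolding ib by (simp add: powr_realpow[symmetric] powr_powr)
            finally show ?thesis by (simp only: powr_mult)
          qed
          ultimately have "recip ((?g / vol v) powr ?b) \<le> recip ((A ^ ?m) powr (1 - \<eta>) * (?t / vol v) powr ?b)"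
            by (intro recip_mono) simp
          also have "\<dots> = recip ((A ^ ?m) powr (1 - \<eta>)) * recip ((?t / vol v) powr ?b)" by (simp add: recip_mult)
          also have "recip ((A ^ ?m) powr (1 - \<eta>)) = ennreal ((A ^ ?m) powr - (1 - \<eta>))"
            using AB(1) by (subst recip_pos) (simp, simp only: powr_minus)
          finally show ?thesis .
        qed
        have m: "(\<lambda>\<sigma>. recip ((vol (map (expand (point \<sigma>)) v) / vol v) powr ?b)) \<in> borel_measurable cube"
          unfolding point_def[abs_def] by measurable
        have "(\<integral>\<^sup>+ \<sigma>. recip ((vol (map (flow A B (point \<sigma>)) v) / vol v) powr ?b) \<partial>cube)
          \<le> (\<integral>\<^sup>+ \<sigma>. ennreal ((A ^ ?m) powr - (1 - \<eta>)) * recip ((vol (map (expand (point \<sigma>)) v) / vol v) powr ?b) \<partial>cube)"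
          by (intro nn_integral_mono pt)
        also have "\<dots> = ennreal ((A ^ ?m) powr - (1 - \<eta>)) * (\<integral>\<^sup>+ \<sigma>. recip ((vol (map (expand (point \<sigma>)) v) / vol v) powr ?b) \<partial>cube)"
          by (rule nn_integral_cmult[OF m])
        also have "\<dots> \<le> ennreal ((A ^ ?m) powr - (1 - \<eta>)) * ennreal C"
          using C(2)[OF v] by (intro mult_left_mono) (simp_all add: point_def[abs_def])
        also have "\<dots> = ennreal (C * (A ^ ?m) powr - (1 - \<eta>))" using C(1) by (simp add: ennreal_mult[symmetric] mult.commute)
        finally show "(\<integral>\<^sup>+ \<sigma>. recip ((vol (map (flow A B (point \<sigma>)) v) / vol v) powr ?b) \<partial>cube)
          \<le> ennreal (C * (A ^ ?m) powr - (1 - \<eta>))" .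
      qed
    qed auto
  next
    case False
    define k where "k = ?m + ?n - i"
    have k: "1 \<le> k" "k \<le> ?n" using False i by (auto simp: k_def)
    have b: "?b = (1 - \<eta>) / (real k / real ?n)" using False i by (simp add: beta_def tent_right k_def)
    have b0: "0 < ?b" using k \<eta> unfolding b by simp
    have ib: "real k * ?b = real ?n * (1 - \<eta>)" using k unfolding b by simp
    have b1: "?b < real (?n - (k - 1))" unfolding b using k \<eta> by (intro exponent_bound) auto
    have rb: "2 * ?\<rho> * real ?n * real ?m * pivot_const (?n + ?m) \<le> 1"
      using radius_bound[OF mn] by (simp add: mult_ac add.commute)
    show thesis
    proof (rule expand_moment[where pos = "\<lambda>(j :: 'n) (i :: 'm). (i, j)", OF _ k b0 b1 radius_pos[OF mn] rb])
      fix C assume C: "0 \<le> C" "\<And>v :: ((real ^ 'n) \<times> (real ^ 'm)) list. length v = k \<Longrightarrow> vol v > 0 \<Longrightarrow>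
        (\<integral>\<^sup>+ \<sigma>. recip ((vol (map (expand (\<lambda>j i. ?\<rho> * \<sigma> (i, j))) v) / vol v) powr ?b) \<partial>cube) \<le> ennreal C"
      show thesis
      proof (rule that[OF C(1)])
        fix A B :: real and v :: "((real ^ 'm) \<times> (real ^ 'n)) list"
        assume AB: "0 < A" "0 < B" "A ^ ?m = B ^ ?n" and v: "length v = i" "vol v > 0"
        obtain u :: "((real ^ 'm) \<times> (real ^ 'n)) list" where u: "length u + length v = DIM((real ^ 'm) \<times> (real ^ 'n))" "vol u = 1"
          "\<And>g g' :: (real ^ 'm) \<times> (real ^ 'n) \<Rightarrow> (real ^ 'm) \<times> (real ^ 'n). linear g \<Longrightarrow> (\<And>x y. g x \<bullet> g' y = x \<bullet> y) \<Longrightarrow>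
             (\<And>xs. length xs = DIM((real ^ 'm) \<times> (real ^ 'n)) \<Longrightarrow> vol (map g xs) = vol xs) \<Longrightarrow>
             vol (map g v) / vol v = vol (map g' u)"
          using vol_complement[OF v(2)] by blast
        have lenu: "length u = k" using u(1) v(1) by (simp add: k_def)
        \<comment> \<open>The contragredient of the unipotent part carries minus the transposed
          matrix. Swapping the factors with a sign turns its second component into
          \<open>expand\<close> of the transposed matrix.\<close>
        define R :: "(real ^ 'm) \<times> (real ^ 'n) \<Rightarrow> (real ^ 'n) \<times> (real ^ 'm)" where "R x = (snd x, - fst x)" for x
        define w where "w = map R u"
        have vw: "vol w = 1" unfolding w_def by (subst vol_isometry) (auto simp: R_def inner_prod_def u)
        have lw: "length w = k" by (simp add: w_def lenu)
        define t where "t \<sigma> = expand (\<lambda>j i. ?\<rho> * \<sigma> (i, j))" for \<sigma> :: "'m \<times> 'n \<Rightarrow> real"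
        have pt: "recip ((vol (map (flow A B (point \<sigma>)) v) / vol v) powr ?b)
            \<le> ennreal ((A ^ ?m) powr - (1 - \<eta>)) * recip ((vol (map (t \<sigma>) w) / vol w) powr ?b)" for \<sigma>
        proof -
          define g' where "g' x = ((1 / A) *\<^sub>R fst x, B *\<^sub>R t \<sigma> (R x))" for x
          have adj: "flow A B (point \<sigma>) x \<bullet> g' y = x \<bullet> y" for x y
          proof -
            have "(\<Sum>i\<in>UNIV. (\<Sum>j\<in>UNIV. point \<sigma> i j * snd x $ j) * fst y $ i)
              = (\<Sum>j\<in>UNIV. snd x $ j * (\<Sum>i\<in>UNIV. point \<sigma> i j * fst y $ i))"
              unfolding sum_distrib_left sum_distrib_right by (subst sum.swap) (simp add: mult_ac)
            then show ?thesis
              using AB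
              by (simp add: flow_def g'_def t_def R_def inner_prod_def inner_vec_def expand_nth point_def
                  algebra_simps sum.distrib sum_negf sum_subtractf sum_distrib_left)
          qed
          have pres: "vol (map (flow A B (point \<sigma>)) xs) = vol xs"
            if "length xs = DIM((real ^ 'm) \<times> (real ^ 'n))" for xs
            using that by (intro vol_flow AB) simp
          have eq: "vol (map (flow A B (point \<sigma>)) v) / vol v = vol (map g' u)"
            by (rule u(3)[OF linear_flow adj pres])
          let ?f = "\<lambda>x :: (real ^ 'm) \<times> (real ^ 'n). (1 / B) *\<^sub>R snd x"
          have "vol (map ?f (map g' u)) \<le> (1 / B) ^ length (map g' u) * vol (map g' u)"
          proof (rule vol_map_le)
            show "linear ?f" by (intro linearI) (simp_all add: algebra_simps)
            show "norm (?f x) \<le> (1 / B) * norm x" for x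
              using AB norm_snd_le[of "snd x" "fst x"] by (simp add: divide_right_mono)
          qed (use AB in simp)
          also have "map ?f (map g' u) = map (t \<sigma>) w"
            using AB by (simp add: g'_def w_def)
          finally have "B ^ k * vol (map (t \<sigma>) w) \<le> vol (map g' u)" using AB lenu by (simp add: field_simps)
          then have "(B ^ k * vol (map (t \<sigma>) w)) powr ?b \<le> vol (map g' u) powr ?b"
            using AB b0 by (intro powr_mono2) auto
          moreover have "(B ^ k * vol (map (t \<sigma>) w)) powr ?b = (A ^ ?m) powr (1 - \<eta>) * vol (map (t \<sigma>) w) powr ?b"
          proof -
            have "(B ^ k) powr ?b = B powr (real k * ?b)" using AB by (simp add: powr_realpow[symmetric] powr_powr)
            also have "\<dots> = (B ^ ?n) powr (1 - \<eta>)" using AB(1,2) unfolding ib by (simp add: powr_realpow[symmetric] powr_powr)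
            finally show ?thesis by (simp only: powr_mult AB(3))
          qed
          ultimately have "recip (vol (map g' u) powr ?b) \<le> recip ((A ^ ?m) powr (1 - \<eta>) * vol (map (t \<sigma>) w) powr ?b)"
            by (intro recip_mono) simp
          also have "\<dots> = recip ((A ^ ?m) powr (1 - \<eta>)) * recip (vol (map (t \<sigma>) w) powr ?b)" by (simp add: recip_mult)
          also have "recip ((A ^ ?m) powr (1 - \<eta>)) = ennreal ((A ^ ?m) powr - (1 - \<eta>))"
            using AB(1) by (subst recip_pos) (simp, simp only: powr_minus)
          finally show ?thesis unfolding eq vw by simp
        qed
        have m: "(\<lambda>\<sigma>. recip ((vol (map (t \<sigma>) w) / vol w) powr ?b)) \<in> borel_measurable cube"
          unfolding t_def by measurable
        have "(\<integral>\<^sup>+ \<sigma>. recip ((vol (map (flow A B (point \<sigma>)) v) / vol v) powr ?b) \<partial>cube)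
          \<le> (\<integral>\<^sup>+ \<sigma>. ennreal ((A ^ ?m) powr - (1 - \<eta>)) * recip ((vol (map (t \<sigma>) w) / vol w) powr ?b) \<partial>cube)"
          by (intro nn_integral_mono pt)
        also have "\<dots> = ennreal ((A ^ ?m) powr - (1 - \<eta>)) * (\<integral>\<^sup>+ \<sigma>. recip ((vol (map (t \<sigma>) w) / vol w) powr ?b) \<partial>cube)"
          by (rule nn_integral_cmult[OF m])
        also have "\<dots> \<le> ennreal ((A ^ ?m) powr - (1 - \<eta>)) * ennreal C"
          using C(2)[OF lw] vw by (intro mult_left_mono) (simp_all add: t_def)
        also have "\<dots> = ennreal (C * (A ^ ?m) powr - (1 - \<eta>))" using C(1) by (simp add: ennreal_mult[symmetric] mult.commute)
        finally show "(\<integral>\<^sup>+ \<sigma>. recip ((vol (map (flow A B (point \<sigma>)) v) / vol v) powr ?b) \<partial>cube)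
          \<le> ennreal (C * (A ^ ?m) powr - (1 - \<eta>))" .
      qed
    qed auto
  qed
qed

section \<open>The height function and its contraction\<close>

text \<open>Positivity of \<open>vol\<close> encodes linear independence of the list.\<close>

definition Zt :: "nat \<Rightarrow> 'a::euclidean_space list set" where
  "Zt i = {z. length z = i \<and> set z \<subseteq> Zlat \<and> vol z > 0}"

definition alpha :: "nat \<Rightarrow> ('a::euclidean_space \<Rightarrow> 'a) \<Rightarrow> real" where
  "alpha i h = (SUP z\<in>Zt i. 1 / vol (map h z))"

text \<open>Unimodularity, expressed by volumes of full lists instead of a determinant.\<close>

definition good :: "('a::euclidean_space \<Rightarrow> 'a) \<Rightarrow> bool" where
  "good h \<longleftrightarrow> linear h \<and> inj h \<and> (\<forall>xs. length xs = DIM('a) \<longrightarrow> vol (map h xs) = vol xs)"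

lemma good_comp:
  assumes "good g" "good h"
  shows "good (g \<circ> h)"
  unfolding good_def
proof (intro conjI allI impI)
  show "linear (g \<circ> h)" using assms by (auto simp: good_def intro: linear_compose)
  show "inj (g \<circ> h)" using assms by (auto simp: good_def intro: inj_compose)
  fix xs :: "'a list" assume len: "length xs = DIM('a)"
  have "vol (map (g \<circ> h) xs) = vol (map g (map h xs))" by simp
  also have "\<dots> = vol (map h xs)" using assms(1) len by (simp add: good_def del: map_map)
  also have "\<dots> = vol xs" using assms(2) len by (simp add: good_def)
  finally show "vol (map (g \<circ> h) xs) = vol xs" .
qed

lemma vol_map_ge:
  assumes "good h"
  obtains c where "0 < c" "\<And>z. length z = i \<Longrightarrow> c * vol z \<le> vol (map h z)"
proof -
  obtain g where g: "linear g" "g \<circ> h = id"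
    using linear_injective_left_inverse[of h] assms by (auto simp: good_def)
  obtain K where K: "0 < K" "\<And>x. norm (g x) \<le> K * norm x"
    using linear_bounded_pos[OF g(1)] by blast
  have "(1 / K ^ i) * vol z \<le> vol (map h z)" if "length z = i" for z
  proof -
    have "vol (map g (map h z)) \<le> K ^ length (map h z) * vol (map h z)"
      using K by (intro vol_map_le g) auto
    then show ?thesis using that K g(2) by (simp add: divide_simps mult.commute)
  qed
  then show thesis using that[of "1 / K ^ i"] K by simp
qed

lemma vol_map_pos: "good h \<Longrightarrow> vol z > 0 \<Longrightarrow> vol (map h z) > 0"
  using vol_map_ge[of h "length z"] by (metis mult_pos_pos order_less_le_trans)

lemma Zt_ne:
  assumes "i \<le> DIM('a::euclidean_space)"
  shows "(Zt i :: 'a list set) \<noteq> {}"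
proof -
  obtain l where l: "set l = (Basis :: 'a set)" "distinct l" using finite_distinct_list[of "Basis :: 'a set"] by auto
  then have len: "length l = DIM('a)" by (metis distinct_card)
  let ?z = "take i l"
  have "?z ! k \<bullet> ?z ! k' = (if k = k' then 1 else 0)" if "k < length ?z" "k' < length ?z" for k k'
    using that l nth_mem[of k l] nth_mem[of k' l] by (auto simp: inner_Basis nth_eq_iff_index_eq)
  from gdet_orthonormal[OF this] have "vol ?z = 1" by (simp add: vol_def)
  moreover have "set ?z \<subseteq> Zlat" using l(1) set_take_subset[of i l] by (auto intro: Zlat_Basis)
  ultimately have "?z \<in> Zt i" using len assms by (simp add: Zt_def)
  then show ?thesis by blast
qed

text \<open>A left inverse of \<open>h\<close> is bounded, and independent integer lists have volume
  at least 1, so the covolumes stay away from 0. Only then does the real supremum in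
  \<open>alpha\<close> have its meaning.\<close>

lemma alpha_bdd:
  fixes h :: "'a::euclidean_space \<Rightarrow> 'a"
  assumes "good h"
  shows "bdd_above ((\<lambda>z. 1 / vol (map h z)) ` Zt i)"
proof -
  obtain c where c: "0 < c" "\<And>z. length z = i \<Longrightarrow> c * vol z \<le> vol (map h z)"
    using vol_map_ge[OF assms] by blast
  show ?thesis
  proof (rule bdd_aboveI2)
    fix z :: "'a list" assume z: "z \<in> Zt i"
    then have "c * 1 \<le> c * vol z" using c(1) vol_Zlat_ge_1[of z] by (intro mult_left_mono) (auto simp: Zt_def)
    also have "\<dots> \<le> vol (map h z)" using c(2) z by (simp add: Zt_def)
    finally show "1 / vol (map h z) \<le> 1 / c" using c(1) by (intro divide_left_mono) auto
  qed
qed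

lemma alpha_ge: "good h \<Longrightarrow> z \<in> Zt i \<Longrightarrow> 1 / vol (map h z) \<le> alpha i h"
  unfolding alpha_def by (intro cSUP_upper alpha_bdd)

lemma alpha_le:
  fixes h :: "'a::euclidean_space \<Rightarrow> 'a"
  assumes "i \<le> DIM('a)" "\<And>z. z \<in> Zt i \<Longrightarrow> 1 / vol (map h z) \<le> c"
  shows "alpha i h \<le> c"
  unfolding alpha_def using assms Zt_ne by (intro cSUP_least) auto

lemma alpha_pos:
  fixes h :: "'a::euclidean_space \<Rightarrow> 'a"
  assumes "good h" "i \<le> DIM('a)"
  shows "0 < alpha i h"
proof -
  obtain z where z: "z \<in> (Zt i :: 'a list set)" using Zt_ne[OF assms(2)] by blast
  then have "0 < 1 / vol (map h z)" using vol_map_pos[OF assms(1)] by (simp add: Zt_def)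
  with alpha_ge[OF assms(1) z] show ?thesis by linarith
qed

lemma alpha_0_le:
  fixes h :: "'a::euclidean_space \<Rightarrow> 'a"
  shows "alpha 0 h \<le> 1"
  by (rule alpha_le) (auto simp: Zt_def)

text \<open>A good map preserves full volumes, which are at least 1 on integer lists. Together with
  \<open>alpha_0_le\<close> this controls the two trivial ranks, which occur as neighbours in the
  submodular comparison.\<close>

lemma alpha_DIM_le:
  fixes h :: "'a::euclidean_space \<Rightarrow> 'a"
  assumes "good h"
  shows "alpha DIM('a) h \<le> 1"
proof (rule alpha_le)
  fix z :: "'a list" assume z: "z \<in> Zt DIM('a)"
  then have "vol (map h z) = vol z" "1 \<le> vol z" using assms vol_Zlat_ge_1[of z] by (auto simp: Zt_def good_def)
  then show "1 / vol (map h z) \<le> 1" by simp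
qed simp

lemma alpha_distort:
  fixes g h :: "'a::euclidean_space \<Rightarrow> 'a"
  assumes h: "good h" and i: "i \<le> DIM('a)" and R: "0 < R"
    and le: "\<And>xs. length xs = i \<Longrightarrow> vol xs \<le> R * vol (map g xs)"
  shows "alpha i (g \<circ> h) \<le> R * alpha i h"
proof (rule alpha_le[OF i])
  fix z :: "'a list" assume z: "z \<in> Zt i"
  have pos: "0 < vol (map h z)" using z vol_map_pos[OF h] by (simp add: Zt_def)
  have "vol (map h z) \<le> R * vol (map (g \<circ> h) z)" using le[of "map h z"] z by (simp add: Zt_def)
  then have "1 / vol (map (g \<circ> h) z) \<le> R * (1 / vol (map h z))"
  proof -
    have "0 < R * vol (map (g \<circ> h) z)" using pos \<open>vol (map h z) \<le> _\<close> by linarith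
    then have "0 < vol (map (g \<circ> h) z)" using R by (simp add: zero_less_mult_iff)
    then show ?thesis using pos \<open>vol (map h z) \<le> _\<close> by (simp add: field_simps)
  qed
  also have "\<dots> \<le> R * alpha i h" using R alpha_ge[OF h z] by (intro mult_left_mono) auto
  finally show "1 / vol (map (g \<circ> h) z) \<le> R * alpha i h" .
qed

text \<open>
  In the second case two sublattices with nearly minimal covolume span different subspaces, and
  submodularity is applied to them.
\<close>

lemma alpha_dichotomy:
  fixes h :: "'a::euclidean_space \<Rightarrow> 'a"
  assumes h: "good h" and i: "i \<le> DIM('a)" and R: "1 \<le> R"
  obtains (unique) z where "z \<in> Zt i"
    "\<And>g. linear g \<Longrightarrow> (\<And>xs. length xs = i \<Longrightarrow> vol (map g xs) \<le> R * vol xs) \<Longrightarrow>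
       (\<And>xs. length xs = i \<Longrightarrow> vol xs \<le> R * vol (map g xs)) \<Longrightarrow>
       alpha i (g \<circ> h) \<le> alpha i h / (vol (map g (map h z)) / vol (map h z))"
  | (several) j where "1 \<le> j" "j \<le> i" "i + j \<le> DIM('a)"
    "(alpha i h)\<^sup>2 \<le> 4 * R ^ 4 * (alpha (i - j) h * alpha (i + j) h)"
proof -
  let ?a = "alpha i h"
  have a: "0 < ?a" by (rule alpha_pos[OF h i])
  have lin: "linear h" using h by (simp add: good_def)
  have hpos: "0 < vol (map h z)" if "z \<in> Zt i" for z
    using that vol_map_pos[OF h] by (simp add: Zt_def)
  \<comment> \<open>The nearly shortest sublattices. The 2 makes room for \<open>z0\<close>, which
    attains the supremum only up to this factor; the square of \<open>R\<close> ensures that a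
    sublattice outside \<open>S\<close>, shrunk by at most \<open>R\<close>, does not undercut the
    bound from \<open>z0\<close>, whose distortion is at most \<open>R\<close>.\<close>
  define S where "S = {z \<in> Zt i. vol (map h z) \<le> 2 * R\<^sup>2 / ?a}"
  obtain z0 where z0: "z0 \<in> Zt i" "?a / 2 < 1 / vol (map h z0)"
  proof -
    have "?a / 2 < alpha i h" using a by simp
    then show thesis
      unfolding alpha_def using less_cSUP_iff[OF Zt_ne[OF i] alpha_bdd[OF h, of i]] that
      by (auto simp: alpha_def)
  qed
  have "vol (map h z0) \<le> 2 / ?a" using z0(2) hpos[OF z0(1)] a by (simp add: field_simps)
  also have "\<dots> \<le> 2 * R\<^sup>2 / ?a" using R a one_le_power[OF R, of 2] by (intro divide_right_mono) auto
  finally have z0S: "z0 \<in> S" using z0 by (simp add: S_def)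
  show thesis
  proof (cases "\<forall>z\<in>S. set z \<subseteq> span (set z0)")
    case True
    show thesis
    proof (rule unique[OF z0(1)])
      fix g :: "'a \<Rightarrow> 'a"
      assume g: "linear g" and up: "\<And>xs. length xs = i \<Longrightarrow> vol (map g xs) \<le> R * vol xs"
        and low: "\<And>xs. length xs = i \<Longrightarrow> vol xs \<le> R * vol (map g xs)"
      let ?v = "map h z0"
      let ?J = "vol (map g ?v) / vol ?v"
      have lz0: "length z0 = i" using z0 by (simp add: Zt_def)
      have v: "0 < vol ?v" by (rule hpos[OF z0(1)])
      have gv: "0 < vol (map g ?v)"
      proof -
        have "0 < R * vol (map g ?v)" using low[of ?v] v lz0 by (simp del: map_map)
        then show ?thesis using R by (simp add: zero_less_mult_iff)
      qed
      have J: "0 < ?J" "?J \<le> R"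
        using v gv up[of ?v] lz0 by (simp_all add: divide_le_eq del: map_map)
      have key: "?J / ?a \<le> vol (map (g \<circ> h) z)" if z: "z \<in> Zt i" for z
      proof (cases "z \<in> S")
        case True
        \<comment> \<open>Inside \<open>S\<close> everything lies in the span of \<open>z0\<close>,
          so it is distorted by the same factor \<open>?J\<close>.\<close>
        then have "set z \<subseteq> span (set z0)" using \<open>\<forall>z\<in>S. _\<close> by blast
        then have "set (map h z) \<subseteq> span (set ?v)"
          using linear_span_image[OF lin, of "set z0"] by auto
        then have "vol (map g (map h z)) * vol ?v = vol (map h z) * vol (map g ?v)"
          using z lz0 g by (intro vol_ratio) (auto simp: Zt_def)
        then have "vol (map (g \<circ> h) z) = ?J * vol (map h z)" using v by (simp add: field_simps)
        moreover have "1 / ?a \<le> vol (map h z)"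
          using alpha_ge[OF h z] hpos[OF z] a by (simp add: field_simps)
        ultimately show ?thesis using J mult_left_mono[of "1 / ?a" "vol (map h z)" ?J] by simp
      next
        case False
        then have "2 * R\<^sup>2 / ?a < vol (map h z)" using z by (simp add: S_def)
        also have "\<dots> \<le> R * vol (map (g \<circ> h) z)" using low[of "map h z"] z by (simp add: Zt_def)
        finally have "R * (2 * R / ?a) < R * vol (map (g \<circ> h) z)" by (simp add: power2_eq_square mult_ac)
        then have "2 * R / ?a < vol (map (g \<circ> h) z)"
          using R by (subst (asm) mult_less_cancel_left_pos) auto
        moreover have "?J / ?a \<le> 2 * R / ?a" using J R a by (intro divide_right_mono) auto
        ultimately show ?thesis by linarith
      qed
      show "alpha i (g \<circ> h) \<le> ?a / ?J"
      proof (rule alpha_le[OF i])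
        fix z :: "'a list" assume z: "z \<in> Zt i"
        have p: "0 < ?J / ?a" by (rule divide_pos_pos[OF J(1) a])
        then have p': "0 < vol (map (g \<circ> h) z)" using key[OF z] by linarith
        have "1 / vol (map (g \<circ> h) z) \<le> 1 / (?J / ?a)"
          by (rule divide_left_mono[OF key[OF z] _ mult_pos_pos[OF p' p]]) simp
        then show "1 / vol (map (g \<circ> h) z) \<le> ?a / ?J" by (simp add: mult.commute)
      qed
    qed
  next
    case False
    then obtain z' where z': "z' \<in> S" "\<not> set z' \<subseteq> span (set z0)" by blast
    have props: "set z0 \<subseteq> Zlat" "set z' \<subseteq> Zlat" "vol z0 > 0" "vol z' > 0" "length z' = length z0" "length z0 = i"
      using z0(1) z'(1) by (auto simp: S_def Zt_def)
    obtain j c y where y: "1 \<le> j" "length c + j = length z0" "length y = length z0 + j"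
      "set c \<subseteq> Zlat" "set y \<subseteq> Zlat" "vol c > 0" "vol y > 0"
      "\<And>h :: 'a \<Rightarrow> 'a. linear h \<Longrightarrow> vol (map h y) * vol (map h c) \<le> vol (map h z0) * vol (map h z')"
      by (rule vol_submodular[OF props(1-5) z'(2)], rule that, assumption+)
    have c: "c \<in> Zt (i - j)" and yZ: "y \<in> Zt (i + j)" using y props(6) by (auto simp: Zt_def)
    have ij: "j \<le> i" "i + j \<le> DIM('a)" using y(2,3) props(6) length_le_DIM[OF y(7)] by auto
    have pc: "0 < vol (map h c)" and py: "0 < vol (map h y)" using vol_map_pos[OF h] y by auto
    have "vol (map h y) * vol (map h c) \<le> (2 * R\<^sup>2 / ?a) * (2 * R\<^sup>2 / ?a)"
      using y(8)[OF lin] z0S z'(1) a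
      by (intro order_trans[OF y(8)[OF lin]] mult_mono) (auto simp: S_def)
    also have "\<dots> = 4 * R ^ 4 / ?a\<^sup>2" by (simp add: power2_eq_square power4_eq_xxxx)
    finally have le: "vol (map h y) * vol (map h c) \<le> 4 * R ^ 4 / ?a\<^sup>2" .
    have "(1 / vol (map h c)) * (1 / vol (map h y)) \<le> alpha (i - j) h * alpha (i + j) h"
      using alpha_ge[OF h c] alpha_ge[OF h yZ] pc py less_imp_le[OF alpha_pos[OF h, of "i - j"]] i
      by (intro mult_mono) simp_all
    moreover have "?a\<^sup>2 / (4 * R ^ 4) \<le> (1 / vol (map h c)) * (1 / vol (map h y))"
    proof -
      have "1 / (4 * R ^ 4 / ?a\<^sup>2) \<le> 1 / (vol (map h y) * vol (map h c))"
        using le pc py a R by (intro divide_left_mono) auto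
      then show ?thesis by (simp add: mult.commute)
    qed
    ultimately have "?a\<^sup>2 / (4 * R ^ 4) \<le> alpha (i - j) h * alpha (i + j) h" by linarith
    then have "?a\<^sup>2 \<le> 4 * R ^ 4 * (alpha (i - j) h * alpha (i + j) h)"
      using R by (simp add: divide_le_eq mult.commute)
    then show thesis using several y(1) ij by blast
  qed
qed

section \<open>Subdivision of the cube of perturbations\<close>

definition digits :: "nat \<Rightarrow> ('x::finite \<Rightarrow> nat) set" where
  "digits L = {j. \<forall>x. j x < L}"

definition corner :: "nat \<Rightarrow> ('x \<Rightarrow> nat) \<Rightarrow> 'x \<Rightarrow> real" where
  "corner L j x = real (j x) / real L"

lemma digits_PiE: "digits L = (UNIV :: 'x::finite set) \<rightarrow>\<^sub>E {..<L}"
  by (auto simp: digits_def PiE_def Pi_def)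

lemma finite_digits [simp]: "finite (digits L :: ('x::finite \<Rightarrow> nat) set)"
  unfolding digits_PiE by (intro finite_PiE) auto

lemma card_digits: "card (digits L :: ('x::finite \<Rightarrow> nat) set) = L ^ CARD('x)"
  unfolding digits_PiE by (simp add: card_PiE)

text \<open>The cells are half open, hence disjoint, and all have mass L^(-d) for d coordinates. A
  lower bound for \<open>F\<close> on every cell therefore bounds a sum over cells by the
  integral.\<close>

lemma cell_sum_le:
  fixes F :: "('x::finite \<Rightarrow> real) \<Rightarrow> ennreal"
  assumes F: "F \<in> borel_measurable cube" and L: "0 < L"
    and le: "\<And>j \<sigma>. j \<in> digits L \<Longrightarrow> (\<And>x. real (j x) / real L \<le> \<sigma> x \<and> \<sigma> x < (real (j x) + 1) / real L) \<Longrightarrow> a j \<le> F \<sigma>"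
  shows "(\<Sum>j\<in>digits L. a j) \<le> ennreal (real L ^ CARD('x)) * (\<integral>\<^sup>+ \<sigma>. F \<sigma> \<partial>cube)"
proof -
  interpret U: prob_space unit_interval by (rule prob_space_unit_interval)
  interpret P: product_prob_space "\<lambda>_ :: 'x. unit_interval" UNIV ..
  define I where "I k = {real k / real L ..< (real k + 1) / real L}" for k :: nat
  define cell where "cell j = (\<Pi>\<^sub>E x\<in>(UNIV :: 'x set). I (j x))" for j
  have mem: "\<sigma> \<in> cell j \<longleftrightarrow> (\<forall>x. real (j x) / real L \<le> \<sigma> x \<and> \<sigma> x < (real (j x) + 1) / real L)" for \<sigma> j
    by (auto simp: cell_def I_def PiE_def Pi_def)
  have Isub: "I k \<subseteq> {0..1}" if "k < L" for k
  proof -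
    have "(real k + 1) / real L \<le> 1" "0 \<le> real k / real L" using that L by (auto simp: divide_le_eq)
    then show ?thesis unfolding I_def by (metis atLeastLessThan_subseteq_atLeastAtMost_iff)
  qed
  have Iset: "I k \<in> sets unit_interval" if "k < L" for k
    using Isub[OF that] by (auto simp: unit_interval_def sets_restrict_space_iff I_def)
  have Iem: "emeasure unit_interval (I k) = ennreal (1 / real L)" if "k < L" for k
  proof -
    have "emeasure unit_interval (I k) = emeasure lborel (I k)"
      unfolding unit_interval_def using Isub[OF that] by (intro emeasure_restrict_space) auto
    also have "\<dots> = ennreal ((real k + 1) / real L - real k / real L)"
      unfolding I_def using L by (intro emeasure_lborel_Ico divide_right_mono) auto
    also have "(real k + 1) / real L - real k / real L = 1 / real L" by (simp add: diff_divide_distrib[symmetric])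
    finally show ?thesis .
  qed
  have cset: "cell j \<in> sets cube" if "j \<in> digits L" for j
    unfolding cell_def cube_def using that by (intro sets_PiM_I_finite) (auto simp: digits_def Iset)
  have cem: "emeasure cube (cell j) = ennreal ((1 / real L) ^ CARD('x))" if "j \<in> digits L" for j
  proof -
    have "emeasure cube (cell j) = (\<Prod>x\<in>UNIV. emeasure unit_interval (I (j x)))"
      unfolding cell_def cube_def using that by (intro P.emeasure_PiM) (auto simp: digits_def Iset)
    also have "\<dots> = (\<Prod>x\<in>(UNIV :: 'x set). ennreal (1 / real L))"
      using that by (intro prod.cong) (auto simp: digits_def Iem)
    finally show ?thesis by (simp add: ennreal_power)
  qed
  have uniq: "j = j'" if "\<sigma> \<in> cell j" "\<sigma> \<in> cell j'" for \<sigma> j j'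
  proof
    fix x
    have "real (j x) / real L < (real (j' x) + 1) / real L" "real (j' x) / real L < (real (j x) + 1) / real L"
      using that unfolding mem by (meson order_le_less_trans)+
    then have "real (j x) < real (j' x) + 1" "real (j' x) < real (j x) + 1"
      using L by (auto simp: divide_less_cancel)
    then show "j x = j' x" by linarith
  qed
  have "(\<Sum>j\<in>digits L. a j * indicator (cell j) \<sigma>) \<le> F \<sigma>" for \<sigma>
  proof (cases "\<exists>j\<in>digits L. \<sigma> \<in> cell j")
    case True
    then obtain j where j: "j \<in> digits L" "\<sigma> \<in> cell j" by blast
    have "(\<Sum>j\<in>digits L. a j * indicator (cell j) \<sigma>) = (\<Sum>j'\<in>{j}. a j' * indicator (cell j') \<sigma>)"
      using j uniq by (intro sum.mono_neutral_right) (auto split: split_indicator)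
    also have "\<dots> = a j" by (simp only: sum.insert sum.empty finite.emptyI empty_iff not_False_eq_True indicator_simps(1)[OF j(2)] mult_1_right add_0_right)
    also have "a j \<le> F \<sigma>" using j(1) j(2)[unfolded mem] by (intro le) auto
    finally show ?thesis .
  next
    case False
    then have "(\<Sum>j\<in>digits L. a j * indicator (cell j) \<sigma>) = 0"
      by (intro sum.neutral) (auto split: split_indicator)
    then show ?thesis by simp
  qed
  then have "(\<integral>\<^sup>+ \<sigma>. (\<Sum>j\<in>digits L. a j * indicator (cell j) \<sigma>) \<partial>cube) \<le> (\<integral>\<^sup>+ \<sigma>. F \<sigma> \<partial>cube)"
    by (intro nn_integral_mono)
  moreover have "(\<integral>\<^sup>+ \<sigma>. (\<Sum>j\<in>digits L. a j * indicator (cell j) \<sigma>) \<partial>cube) = (\<Sum>j\<in>digits L. a j * ennreal ((1 / real L) ^ CARD('x)))"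
    using cset cem by (subst nn_integral_sum) (auto simp: nn_integral_cmult_indicator intro!: sum.cong)
  ultimately have "(\<Sum>j\<in>digits L. a j) * ennreal ((1 / real L) ^ CARD('x)) \<le> (\<integral>\<^sup>+ \<sigma>. F \<sigma> \<partial>cube)"
    by (simp add: sum_distrib_right)
  then have "ennreal (real L ^ CARD('x)) * ((\<Sum>j\<in>digits L. a j) * ennreal ((1 / real L) ^ CARD('x)))
     \<le> ennreal (real L ^ CARD('x)) * (\<integral>\<^sup>+ \<sigma>. F \<sigma> \<partial>cube)"
    by (intro mult_left_mono) auto
  moreover have "ennreal (real L ^ CARD('x)) * ennreal ((1 / real L) ^ CARD('x)) = 1"
    using L by (simp add: ennreal_mult[symmetric] power_mult_distrib[symmetric])
  ultimately show ?thesis by (simp add: mult.left_commute[of _ "sum a _"])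
qed

text \<open>The moment over the whole cube is transferred to the corners of the cells, since within
  a cell the volume distortion at a point is at most 2^i times that at the corner.\<close>

lemma step_sum:
  assumes \<eta>: "0 < \<eta>" "\<eta> < 1" and i: "0 < i" "i < CARD('m::finite) + CARD('n::finite)"
  obtains C where "0 \<le> C"
    "\<And>L A B (v :: ((real ^ 'm) \<times> (real ^ 'n)) list). 0 < L \<Longrightarrow> 0 < A \<Longrightarrow> 0 < B \<Longrightarrow> A * B = real L \<Longrightarrow>
      A ^ CARD('m) = B ^ CARD('n) \<Longrightarrow> length v = i \<Longrightarrow> vol v > 0 \<Longrightarrow>
      (\<Sum>j\<in>digits L. (vol (map (flow A B (point (corner L j))) v) / vol v) powr - beta \<eta> CARD('m) CARD('n) i)
        \<le> C * real L ^ (CARD('m) * CARD('n)) * (A ^ CARD('m)) powr - (1 - \<eta>)"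
proof -
  let ?m = "CARD('m)" and ?n = "CARD('n)"
  let ?b = "beta \<eta> ?m ?n i" and ?\<rho> = "radius ?m ?n"
  have mn: "0 < ?m" "0 < ?n" by auto
  have b0: "0 < ?b" using \<eta> i mn by (auto simp: beta_def tent_def intro!: divide_pos_pos)
  obtain C where C: "0 \<le> C"
    "\<And>A B (v :: ((real ^ 'm) \<times> (real ^ 'n)) list). 0 < A \<Longrightarrow> 0 < B \<Longrightarrow> A ^ CARD('m) = B ^ CARD('n) \<Longrightarrow>
      length v = i \<Longrightarrow> vol v > 0 \<Longrightarrow>
      (\<integral>\<^sup>+ \<sigma>. recip ((vol (map (flow A B (point \<sigma>)) v) / vol v) powr ?b) \<partial>cube)
        \<le> ennreal (C * (A ^ CARD('m)) powr - (1 - \<eta>))"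
    by (rule step_moment[OF \<eta> i], rule that, assumption+)
  have "(\<Sum>j\<in>digits L. (vol (map (flow A B (point (corner L j))) v) / vol v) powr - ?b)
      \<le> ((2 ^ i) powr ?b * C) * real L ^ (?m * ?n) * (A ^ ?m) powr - (1 - \<eta>)"
    if L: "0 < L" and A: "0 < A" and B: "0 < B" and AB: "A * B = real L" and AmBn: "A ^ ?m = B ^ ?n"
      and v: "length v = i" "vol v > 0" for L A B and v :: "((real ^ 'm) \<times> (real ^ 'n)) list"
  proof -
    define J where "J \<sigma> = vol (map (flow A B (point \<sigma>)) v) / vol v" for \<sigma>
    have Jpos: "0 < J \<sigma>" for \<sigma>
    proof -
      obtain g where g: "linear g" "g \<circ> flow A B (point \<sigma>) = id"
        using linear_injective_left_inverse[OF linear_flow inj_flow] A B by (metis less_numeral_extra(3))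
      obtain K where K: "0 < K" "\<And>x. norm (g x) \<le> K * norm x" using linear_bounded_pos[OF g(1)] by blast
      have "vol (map g (map (flow A B (point \<sigma>)) v)) \<le> K ^ length (map (flow A B (point \<sigma>)) v) * vol (map (flow A B (point \<sigma>)) v)"
        using K by (intro vol_map_le g) auto
      then have "0 < K ^ i * vol (map (flow A B (point \<sigma>)) v)" using v g(2) by simp
      then show ?thesis using K v by (simp add: J_def zero_less_mult_iff)
    qed
    have near: "J \<sigma> \<le> 2 ^ i * J (corner L j)"
      if \<sigma>: "\<And>x. real (j x) / real L \<le> \<sigma> x \<and> \<sigma> x < (real (j x) + 1) / real L" for j \<sigma>
    proof -
      \<comment> \<open>The flow magnifies the difference between a point and the corner of its cell
        by A B = L. It becomes a unipotent map with entries at most \<open>?\<rho>\<close>, whose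
        norm is at most 2.\<close>
      define t where "t a b = real L * (point \<sigma> a b - point (corner L j) a b)" for a b
      have tle: "\<bar>t a b\<bar> \<le> ?\<rho>" for a b
      proof -
        have "real L * (\<sigma> (a, b) - corner L j (a, b)) = real L * \<sigma> (a, b) - real (j (a, b))"
          using L by (simp add: corner_def right_diff_distrib)
        moreover have "real (j (a, b)) \<le> real L * \<sigma> (a, b)" "real L * \<sigma> (a, b) < real (j (a, b)) + 1"
          using \<sigma>[of "(a, b)"] L by (simp_all add: divide_le_eq less_divide_eq mult.commute)
        ultimately have "\<bar>real L * (\<sigma> (a, b) - corner L j (a, b))\<bar> \<le> 1" by simp
        moreover have "t a b = ?\<rho> * (real L * (\<sigma> (a, b) - corner L j (a, b)))"
          by (simp add: t_def point_def algebra_simps)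
        ultimately show ?thesis
          using radius_pos[OF mn] mult_left_mono[of "\<bar>real L * (\<sigma> (a, b) - corner L j (a, b))\<bar>" 1 ?\<rho>] by (simp add: abs_mult)
      qed
      have eq: "flow 1 1 t (flow A B (point (corner L j)) x) = flow A B (point \<sigma>) x" for x
        using A B L by (simp add: flow_comp AB t_def)
      have "vol (map (flow 1 1 t) (map (flow A B (point (corner L j))) v))
         \<le> 2 ^ length (map (flow A B (point (corner L j))) v) * vol (map (flow A B (point (corner L j))) v)"
        by (intro vol_map_le linear_flow norm_unipotent_le[of _ ?\<rho>] tle radius_le mn) simp
      then have "vol (map (flow A B (point \<sigma>)) v) \<le> 2 ^ i * vol (map (flow A B (point (corner L j))) v)"
        using v(1) by (simp add: o_def eq)
      then show ?thesis using v(2) by (simp add: J_def divide_right_mono)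
    qed
    define F where "F \<sigma> = recip (J \<sigma> powr ?b)" for \<sigma>
    have Fm: "F \<in> borel_measurable cube"
    proof -
      have "flow A B (point \<sigma>) x \<bullet> flow A B (point \<sigma>) y
         = A\<^sup>2 * (\<Sum>i\<in>UNIV. (fst x $ i + (\<Sum>j\<in>UNIV. ?\<rho> * \<sigma> (i, j) * snd x $ j))
         * (fst y $ i + (\<Sum>j\<in>UNIV. ?\<rho> * \<sigma> (i, j) * snd y $ j))) + (1 / B)\<^sup>2 * (snd x \<bullet> snd y)" for \<sigma> and x y :: "(real ^ 'm) \<times> (real ^ 'n)"
        by (simp add: flow_def inner_prod_def power2_eq_square) (simp add: inner_vec_def expand_nth point_def)
      then have "(\<lambda>\<sigma>. flow A B (point \<sigma>) x \<bullet> flow A B (point \<sigma>) y) \<in> borel_measurable cube"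
        for x y :: "(real ^ 'm) \<times> (real ^ 'n)"
        by simp
      then have [measurable]: "(\<lambda>\<sigma>. vol (map (flow A B (point \<sigma>)) v)) \<in> borel_measurable cube"
        unfolding vol_map by (intro measurable_compose[OF _ borel_measurable_sqrt] borel_measurable_det)
      show ?thesis unfolding F_def J_def by measurable
    qed
    have "(\<Sum>j\<in>digits L. ennreal ((2 ^ i * J (corner L j)) powr - ?b))
        \<le> ennreal (real L ^ CARD('m \<times> 'n)) * (\<integral>\<^sup>+ \<sigma>. F \<sigma> \<partial>cube)"
    proof (rule cell_sum_le[OF Fm L])
      fix j and \<sigma> :: "'m \<times> 'n \<Rightarrow> real"
      assume "\<And>x. real (j x) / real L \<le> \<sigma> x \<and> \<sigma> x < (real (j x) + 1) / real L"
      from near[OF this] have "J \<sigma> powr ?b \<le> (2 ^ i * J (corner L j)) powr ?b"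
        using b0 Jpos[of \<sigma>] by (intro powr_mono2) auto
      then have "recip ((2 ^ i * J (corner L j)) powr ?b) \<le> F \<sigma>" unfolding F_def by (rule recip_mono)
      moreover have "recip ((2 ^ i * J (corner L j)) powr ?b) = ennreal ((2 ^ i * J (corner L j)) powr - ?b)"
        using Jpos[of "corner L j"] by (subst recip_pos) (simp, simp only: powr_minus)
      ultimately show "ennreal ((2 ^ i * J (corner L j)) powr - ?b) \<le> F \<sigma>" by simp
    qed
    also have "\<dots> \<le> ennreal (real L ^ CARD('m \<times> 'n)) * ennreal (C * (A ^ ?m) powr - (1 - \<eta>))"
      using C(2)[OF A B AmBn v] by (intro mult_left_mono) (simp_all add: F_def J_def)
    also have "\<dots> = ennreal (real L ^ (?m * ?n) * (C * (A ^ ?m) powr - (1 - \<eta>)))"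
      using C(1) by (simp add: ennreal_mult)
    finally have "(\<Sum>j\<in>digits L. (2 ^ i * J (corner L j)) powr - ?b) \<le> real L ^ (?m * ?n) * (C * (A ^ ?m) powr - (1 - \<eta>))"
      using C(1) by (subst (asm) sum_ennreal) auto
    moreover have "(2 ^ i * J (corner L j)) powr - ?b = inverse ((2 ^ i) powr ?b) * J (corner L j) powr - ?b" for j
      by (simp only: powr_mult powr_minus[of "2 ^ i"])
    ultimately have "inverse ((2 ^ i) powr ?b) * (\<Sum>j\<in>digits L. J (corner L j) powr - ?b) \<le> real L ^ (?m * ?n) * (C * (A ^ ?m) powr - (1 - \<eta>))"
      by (simp add: sum_distrib_left)
    then have "(2 ^ i) powr ?b * (inverse ((2 ^ i) powr ?b) * (\<Sum>j\<in>digits L. J (corner L j) powr - ?b))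
       \<le> (2 ^ i) powr ?b * (real L ^ (?m * ?n) * (C * (A ^ ?m) powr - (1 - \<eta>)))"
      by (intro mult_left_mono) auto
    moreover have "(2 ^ i) powr ?b * (inverse ((2 ^ i) powr ?b) * S) = S" for S :: real
      by (subst mult.assoc[symmetric]) simp
    ultimately show ?thesis by (simp only: J_def mult_ac)
  qed
  moreover have "0 \<le> (2 ^ i) powr ?b * C" using C(1) by simp
  ultimately show thesis using that by blast
qed

section \<open>The weighted height and its convexity properties\<close>

definition weight :: "real \<Rightarrow> nat \<Rightarrow> nat \<Rightarrow> real" where
  "weight \<kappa> d i = exp (- \<kappa> * real i * real (d - i))"

text \<open>
  The weights are strictly log-convex in the rank, while the inverse exponents \<open>tent\<close> are concave
  and vanish at the two trivial ranks; both facts together control the second case of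
  the dichotomy.
\<close>

definition covol_height :: "real \<Rightarrow> real \<Rightarrow> ((real ^ 'm::finite) \<times> (real ^ 'n::finite) \<Rightarrow> (real ^ 'm) \<times> (real ^ 'n)) \<Rightarrow> real" where
  "covol_height \<eta> \<kappa> h = (\<Sum>i\<in>{1..<CARD('m) + CARD('n)}.
     (weight \<kappa> (CARD('m) + CARD('n)) i * alpha i h) powr beta \<eta> CARD('m) CARD('n) i)"

text \<open>A minimum of two affine functions is concave.\<close>

lemma tent_concave:
  assumes "j \<le> i"
  shows "tent m n (i - j) + tent m n (i + j) \<le> 2 * tent m n i"
proof -
  have r: "real (i - j) = real i - real j" using assms by (simp add: of_nat_diff)
  have "tent m n (i - j) \<le> real (i - j) / real m" "tent m n (i + j) \<le> real (i + j) / real m"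
    "tent m n (i - j) \<le> (real m + real n - real (i - j)) / real n"
    "tent m n (i + j) \<le> (real m + real n - real (i + j)) / real n"
    by (simp_all add: tent_def)
  then have "tent m n (i - j) + tent m n (i + j) \<le> 2 * (real i / real m)"
    "tent m n (i - j) + tent m n (i + j) \<le> 2 * ((real m + real n - real i) / real n)"
    unfolding r by (simp_all add: add_divide_distrib diff_divide_distrib)
  then show ?thesis unfolding tent_def[of m n i] by (simp add: min_def)
qed

lemma tent_pos: "0 < m \<Longrightarrow> 0 < n \<Longrightarrow> 0 < i \<Longrightarrow> i < m + n \<Longrightarrow> 0 < tent m n i"
  by (simp add: tent_def)

lemma tent_le_1: "0 < m \<Longrightarrow> 0 < n \<Longrightarrow> tent m n i \<le> 1"
  unfolding tent_def
  by (cases "i \<le> m") (auto simp: divide_le_eq intro: min.coboundedI1 min.coboundedI2)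

lemma tent_ends: "tent m n 0 = 0" "0 < m \<Longrightarrow> 0 < n \<Longrightarrow> tent m n (m + n) = 0"
  by (simp_all add: tent_def)

lemma weight_pos [simp]: "0 < weight \<kappa> d i" "0 \<le> weight \<kappa> d i"
  by (simp_all add: weight_def)

text \<open>The function i(d-i) has second difference -2 j^2 for step j, whatever i is. The
  resulting factor is the reserve from which the constants of the dichotomy are paid.\<close>

lemma weight_convex:
  assumes "j \<le> i" "i + j \<le> d"
  shows "(weight \<kappa> d i)\<^sup>2 = exp (- 2 * \<kappa> * (real j)\<^sup>2) * (weight \<kappa> d (i - j) * weight \<kappa> d (i + j))"
proof -
  have r: "real (i - j) = real i - real j" "real (d - i) = real d - real i"
    "real (d - (i - j)) = real d - real i + real j" "real (d - (i + j)) = real d - real i - real j"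
    using assms by (simp_all add: of_nat_diff)
  show ?thesis
    unfolding weight_def exp_of_nat_mult[of 2, symmetric, simplified] exp_add[symmetric] r
    by (simp add: algebra_simps power2_eq_square exp_add[symmetric])
qed

context
  fixes A B :: real and L :: nat
  assumes AB1: "1 \<le> A" "1 \<le> B" and AB: "A * B = real L" and L0: "0 < L"
begin

text \<open>A crude bound in both directions; what matters is that it depends on \<open>A\<close>
  and \<open>B\<close> only, since the weights will absorb it.\<close>

lemma norm_flow_le:
  fixes v :: "(real ^ 'm::finite) \<times> (real ^ 'n::finite)"
  assumes s: "\<And>i j. \<bar>s i j\<bar> \<le> radius CARD('m) CARD('n)"
  shows "norm (flow A B s v) \<le> 2 * (A + B) * norm v"
    and "norm v \<le> 2 * (A + B) * norm (flow A B s v)"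
proof -
  have mn: "0 < CARD('m)" "0 < CARD('n)" by auto
  have ne: "A \<noteq> 0" "B \<noteq> 0" using AB1 by auto
  have B1: "\<bar>1 / B\<bar> \<le> 1" using AB1 by simp
  have "norm (flow A B s v) = norm (flow A B (\<lambda>i j. 0) (flow 1 1 s v))" using flow_split[OF ne] by metis
  also have "\<dots> \<le> (A + B) * norm (flow 1 1 s v)" using AB1 B1 by (intro norm_diag_le) linarith+
  also have "\<dots> \<le> (A + B) * (2 * norm v)"
    using AB1 by (intro mult_left_mono norm_unipotent_le[OF s radius_le[OF mn]]) auto
  finally show "norm (flow A B s v) \<le> 2 * (A + B) * norm v" by (simp add: mult_ac)
  have "v = flow 1 1 (\<lambda>i j. - s i j) (flow 1 1 s v)" by (simp add: flow_comp flow_id)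
  also have "flow 1 1 s v = flow (1 / A) (1 / B) (\<lambda>i j. 0) (flow A B s v)" using ne by (simp add: flow_comp)
  finally have "norm v = norm (flow 1 1 (\<lambda>i j. - s i j) (flow (1 / A) (1 / B) (\<lambda>i j. 0) (flow A B s v)))" by simp
  also have "\<dots> \<le> 2 * norm (flow (1 / A) (1 / B) (\<lambda>i j. 0) (flow A B s v))"
    using s by (intro norm_unipotent_le[of _ "radius CARD('m) CARD('n)"] radius_le[OF mn]) simp
  also have "\<dots> \<le> 2 * ((A + B) * norm (flow A B s v))"
  proof (intro mult_left_mono norm_diag_le)
    have "\<bar>1 / A\<bar> \<le> 1" using AB1 by simp
    then show "\<bar>1 / A\<bar> \<le> A + B" using AB1 by linarith
  qed (use AB1 in auto)
  finally show "norm v \<le> 2 * (A + B) * norm (flow A B s v)" by (simp only: mult.assoc)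
qed

lemma vol_flow_distort:
  fixes xs :: "((real ^ 'm::finite) \<times> (real ^ 'n::finite)) list"
  assumes s: "\<And>i j. \<bar>s i j\<bar> \<le> radius CARD('m) CARD('n)" and len: "length xs \<le> d"
  shows "vol (map (flow A B s) xs) \<le> (2 * (A + B)) ^ d * vol xs"
    and "vol xs \<le> (2 * (A + B)) ^ d * vol (map (flow A B s) xs)"
proof -
  have ne: "A \<noteq> 0" "B \<noteq> 0" using AB1 by auto
  have pw: "(2 * (A + B)) ^ length xs \<le> (2 * (A + B)) ^ d"
    using AB1 len by (intro power_increasing) auto
  have "vol (map (flow A B s) xs) \<le> (2 * (A + B)) ^ length xs * vol xs"
    using AB1 by (intro vol_map_le linear_flow norm_flow_le(1)[OF s]) auto
  also have "\<dots> \<le> (2 * (A + B)) ^ d * vol xs" by (intro mult_right_mono pw) simp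
  finally show "vol (map (flow A B s) xs) \<le> (2 * (A + B)) ^ d * vol xs" .
  obtain g where g: "linear g" "g \<circ> flow A B s = id"
    using linear_injective_left_inverse[OF linear_flow inj_flow] ne by metis
  have surj: "surj (flow A B s)"
    using linear_injective_imp_surjective[OF linear_flow inj_flow] ne by blast
  have "norm (g y) \<le> 2 * (A + B) * norm y" for y
  proof -
    obtain x where "y = flow A B s x" using surj by blast
    then show ?thesis using norm_flow_le(2)[of s x, OF s] g(2) by (metis comp_apply id_apply)
  qed
  then have "vol (map g (map (flow A B s) xs)) \<le> (2 * (A + B)) ^ length (map (flow A B s) xs) * vol (map (flow A B s) xs)"
    using AB1 by (intro vol_map_le g) auto
  then have "vol xs \<le> (2 * (A + B)) ^ length xs * vol (map (flow A B s) xs)" using g(2) by simp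
  also have "\<dots> \<le> (2 * (A + B)) ^ d * vol (map (flow A B s) xs)" by (intro mult_right_mono pw) simp
  finally show "vol xs \<le> (2 * (A + B)) ^ d * vol (map (flow A B s) xs)" .
qed

lemma point_corner_le:
  fixes j :: "'m::finite \<times> 'n::finite \<Rightarrow> nat"
  assumes "j \<in> digits L"
  shows "\<bar>point (corner L j) a b\<bar> \<le> radius CARD('m) CARD('n)"
proof -
  have "\<bar>corner L j (a, b)\<bar> \<le> 1" using assms L0 by (auto simp: corner_def digits_def less_imp_le)
  then show ?thesis
    using radius_pos[of "CARD('m)" "CARD('n)"] mult_left_mono[of "\<bar>corner L j (a, b)\<bar>" 1 "radius CARD('m) CARD('n)"]
    by (simp add: point_def abs_mult)
qed

end


lemma good_flow:
  fixes s :: "'m::finite \<Rightarrow> 'n::finite \<Rightarrow> real"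
  assumes "0 < A" "0 < B" "A ^ CARD('m) = B ^ CARD('n)"
  shows "good (flow A B s)"
  unfolding good_def using linear_flow inj_flow[of A B s] vol_flow[OF assms] assms by simp

text \<open>\<open>C\<close> is fixed before \<open>L\<close>, \<open>A\<close> and
  \<open>B\<close>, while \<kappa> and \<open>R\<close> come after them; this order later permits
  steps so long that \<open>C\<close> becomes negligible. In the first case of the dichotomy the
  bound is \<open>step_sum\<close>; in the second the weights produce the contraction in every
  single subcube.\<close>

lemma covol_height_contraction:
  assumes \<eta>: "0 < \<eta>" "\<eta> < 1"
  obtains C where "0 < C"
    "\<And>L A B. 0 < L \<Longrightarrow> 1 \<le> A \<Longrightarrow> 1 \<le> B \<Longrightarrow> A * B = real L \<Longrightarrow> A ^ CARD('m::finite) = B ^ CARD('n::finite) \<Longrightarrow>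
      \<exists>\<kappa> R. 0 \<le> R \<and> (\<forall>h :: (real ^ 'm) \<times> (real ^ 'n) \<Rightarrow> (real ^ 'm) \<times> (real ^ 'n). good h \<longrightarrow>
        (\<forall>j\<in>digits L. covol_height \<eta> \<kappa> (flow A B (point (corner L j)) \<circ> h) \<le> R * covol_height \<eta> \<kappa> h) \<and>
        (1 \<le> covol_height \<eta> \<kappa> h \<longrightarrow> (\<Sum>j\<in>digits L. covol_height \<eta> \<kappa> (flow A B (point (corner L j)) \<circ> h))
           \<le> C * (real L ^ (CARD('m) * CARD('n)) * (A ^ CARD('m)) powr - (1 - \<eta>)) * covol_height \<eta> \<kappa> h))"
proof -
  let ?m = "CARD('m)" and ?n = "CARD('n)"
  let ?d = "?m + ?n"
  have mn: "0 < ?m" "0 < ?n" by auto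
  define b where "b i = beta \<eta> ?m ?n i" for i
  define te where "te i = tent ?m ?n i" for i
  have te: "0 < te i" "te i \<le> 1" if "i \<in> {1..<?d}" for i
    using that tent_pos[OF mn] tent_le_1[OF mn] by (auto simp: te_def)
  have b0: "0 < b i" if "i \<in> {1..<?d}" for i using te(1)[OF that] \<eta> by (simp add: b_def beta_def te_def)
  have bte: "b i * (te i / (1 - \<eta>)) = 1" if "i \<in> {1..<?d}" for i
    using te(1)[OF that] \<eta> by (simp add: b_def beta_def te_def)
  have b1: "1 - \<eta> \<le> b i" if "i \<in> {1..<?d}" for i
    using te[OF that] \<eta> by (simp add: b_def beta_def te_def le_divide_eq)
  define Q where "Q i C \<longleftrightarrow> (\<forall>L A B (v :: ((real ^ 'm) \<times> (real ^ 'n)) list). 0 < L \<longrightarrow> 0 < A \<longrightarrow> 0 < B \<longrightarrow> A * B = real L \<longrightarrow>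
      A ^ ?m = B ^ ?n \<longrightarrow> length v = i \<longrightarrow> vol v > 0 \<longrightarrow>
      (\<Sum>j\<in>digits L. (vol (map (flow A B (point (corner L j))) v) / vol v) powr - b i)
        \<le> C * real L ^ (?m * ?n) * (A ^ ?m) powr - (1 - \<eta>))" for i C
  have "\<exists>C. 0 \<le> C \<and> Q i C" if "i \<in> {1..<?d}" for i
  proof -
    have i: "0 < i" "i < ?m + ?n" using that by auto
    show ?thesis
    proof (rule step_sum[OF \<eta> i])
      fix C assume C: "0 \<le> C" "\<And>L A B (v :: ((real ^ 'm) \<times> (real ^ 'n)) list). 0 < L \<Longrightarrow> 0 < A \<Longrightarrow> 0 < B \<Longrightarrow> A * B = real L \<Longrightarrow>
        A ^ ?m = B ^ ?n \<Longrightarrow> length v = i \<Longrightarrow> vol v > 0 \<Longrightarrow>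
        (\<Sum>j\<in>digits L. (vol (map (flow A B (point (corner L j))) v) / vol v) powr - beta \<eta> ?m ?n i)
          \<le> C * real L ^ (?m * ?n) * (A ^ ?m) powr - (1 - \<eta>)"
      show ?thesis unfolding Q_def b_def using C by (intro exI[of _ C] conjI allI impI) simp_all
    qed
  qed
  then obtain Ci where Ci0: "\<And>i. i \<in> {1..<?d} \<Longrightarrow> 0 \<le> Ci i" and CiQ: "\<And>i. i \<in> {1..<?d} \<Longrightarrow> Q i (Ci i)"
    by metis
  have Ci: "(\<Sum>j\<in>digits L. (vol (map (flow A B (point (corner L j))) v) / vol v) powr - b i)
        \<le> Ci i * real L ^ (?m * ?n) * (A ^ ?m) powr - (1 - \<eta>)"
    if "i \<in> {1..<?d}" "0 < L" "0 < A" "0 < B" "A * B = real L" "A ^ ?m = B ^ ?n" "length v = i" "vol v > 0"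
    for i L A B and v :: "((real ^ 'm) \<times> (real ^ 'n)) list"
    using CiQ[OF that(1)] that(2-) unfolding Q_def by blast
  \<comment> \<open>\<open>Ci i\<close> serves the first case of the dichotomy in rank i, the 1
    serves the second.\<close>
  define C where "C = (\<Sum>i\<in>{1..<?d}. Ci i + 1)"
  have one: "1 \<in> {1..<?d}" unfolding atLeastLessThan_iff using mn by linarith
  have Cpos: "0 < C" unfolding C_def using Ci0 one by (intro sum_pos) (auto intro: add_nonneg_pos)
  have "\<exists>\<kappa> R. 0 \<le> R \<and> (\<forall>h :: (real ^ 'm) \<times> (real ^ 'n) \<Rightarrow> (real ^ 'm) \<times> (real ^ 'n). good h \<longrightarrow>
        (\<forall>j\<in>digits L. covol_height \<eta> \<kappa> (flow A B (point (corner L j)) \<circ> h) \<le> R * covol_height \<eta> \<kappa> h) \<and>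
        (1 \<le> covol_height \<eta> \<kappa> h \<longrightarrow> (\<Sum>j\<in>digits L. covol_height \<eta> \<kappa> (flow A B (point (corner L j)) \<circ> h))
           \<le> C * (real L ^ (?m * ?n) * (A ^ ?m) powr - (1 - \<eta>)) * covol_height \<eta> \<kappa> h))"
    if L: "0 < L" and AB1: "1 \<le> A" "1 \<le> B" and AB: "A * B = real L" and AmBn: "A ^ ?m = B ^ ?n" for L A B
  proof -
    define R0 where "R0 = (2 * (A + B)) ^ ?d"
    have R0: "1 \<le> R0" unfolding R0_def using AB1 by (intro one_le_power) simp
    have Am: "1 \<le> A ^ ?m" using AB1 by simp
    \<comment> \<open>exp(-2\<kappa>) has to pay for 4 R0^4 from the dichotomy, for R0^2 from the
      distortion of the next step and for the square of A^m; the last two are squared because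
      squares of the terms are compared.\<close>
    define \<kappa> where "\<kappa> = ln (4 * R0 ^ 6 * (A ^ ?m)\<^sup>2) / 2"
    have R6: "1 \<le> R0 ^ 6" "1 \<le> (A ^ ?m)\<^sup>2" using R0 Am by (auto intro: one_le_power)
    have prod1: "1 \<le> 4 * R0 ^ 6 * (A ^ ?m)\<^sup>2"
      using mult_mono[of 1 "4 * R0 ^ 6" 1 "(A ^ ?m)\<^sup>2"] R6 by simp
    have \<kappa>0: "0 \<le> \<kappa>" unfolding \<kappa>_def using prod1 by simp
    have \<kappa>: "exp (- 2 * \<kappa>) = 1 / (4 * R0 ^ 6 * (A ^ ?m)\<^sup>2)"
    proof -
      have "- 2 * \<kappa> = - ln (4 * R0 ^ 6 * (A ^ ?m)\<^sup>2)" by (simp add: \<kappa>_def)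
      then have "exp (- 2 * \<kappa>) = inverse (exp (ln (4 * R0 ^ 6 * (A ^ ?m)\<^sup>2)))" by (simp only: exp_minus)
      also have "exp (ln (4 * R0 ^ 6 * (A ^ ?m)\<^sup>2)) = 4 * R0 ^ 6 * (A ^ ?m)\<^sup>2" using prod1 by (intro exp_ln) linarith
      finally show ?thesis by (simp only: inverse_eq_divide)
    qed
    define w where "w i = weight \<kappa> ?d i" for i
    have w: "0 < w i" "0 \<le> w i" for i by (simp_all add: w_def)
    define T where "T i h = (w i * alpha i h) powr b i"
      for i and h :: "(real ^ 'm) \<times> (real ^ 'n) \<Rightarrow> (real ^ 'm) \<times> (real ^ 'n)"
    have covol_height: "covol_height \<eta> \<kappa> h = (\<Sum>i\<in>{1..<?d}. T i h)" for h
      by (simp add: covol_height_def T_def w_def b_def)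
    have T0: "0 \<le> T i h" for i h by (simp add: T_def)
    have Tle: "T i h \<le> covol_height \<eta> \<kappa> h" if "i \<in> {1..<?d}" for i and h :: "(real ^ 'm) \<times> (real ^ 'n) \<Rightarrow> (real ^ 'm) \<times> (real ^ 'n)"
      unfolding covol_height using that T0 by (intro member_le_sum) auto
    have f0: "0 \<le> covol_height \<eta> \<kappa> h" for h :: "(real ^ 'm) \<times> (real ^ 'n) \<Rightarrow> (real ^ 'm) \<times> (real ^ 'n)"
      unfolding covol_height by (intro sum_nonneg T0)
    let ?g = "\<lambda>j. flow A B (point (corner L j)) :: (real ^ 'm) \<times> (real ^ 'n) \<Rightarrow> (real ^ 'm) \<times> (real ^ 'n)"
    define X where "X = real L ^ (?m * ?n) * (A ^ ?m) powr - (1 - \<eta>)"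
    have X0: "0 \<le> X" by (simp add: X_def)
    define R where "R = (\<Sum>i\<in>{1..<?d}. R0 powr b i)"
    have dist: "vol (map (?g j) xs) \<le> R0 * vol xs" "vol xs \<le> R0 * vol (map (?g j) xs)"
      if "j \<in> digits L" "length xs \<le> ?d" for j xs
      unfolding R0_def
      using vol_flow_distort[OF AB1 AB L, of "point (corner L j)" xs] point_corner_le[OF AB1 AB L that(1)] that(2) by blast+
    have gg: "good (?g j)" for j using AB1 AmBn by (intro good_flow) auto
    have a1: "alpha i (?g j \<circ> h) \<le> R0 * alpha i h" if "good h" "j \<in> digits L" "i \<le> ?d" for h i j
      using that R0 dist(2)[OF that(2)] by (intro alpha_distort) auto
    have agh: "0 < alpha i (?g j \<circ> h)" "0 < alpha i h" if "good h" "i \<le> ?d" for h i j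
      using that gg by (auto intro!: alpha_pos good_comp)
    have T1: "T i (?g j \<circ> h) \<le> (R0 * (w i * alpha i h)) powr b i" if "good h" "j \<in> digits L" "i \<in> {1..<?d}" for h i j
    proof -
      have "w i * alpha i (?g j \<circ> h) \<le> R0 * (w i * alpha i h)"
        using mult_left_mono[OF a1[OF that(1,2), of i] w(2)[of i]] that(3) by (simp add: mult_ac)
      then show ?thesis
        unfolding T_def using agh(1)[OF that(1), of i j] that(3) w b0[OF that(3)] by (intro powr_mono2) auto
    qed
    have crude: "covol_height \<eta> \<kappa> (?g j \<circ> h) \<le> R * covol_height \<eta> \<kappa> h" if h: "good h" "j \<in> digits L" for h j
    proof -
      have "T i (?g j \<circ> h) \<le> R0 powr b i * covol_height \<eta> \<kappa> h" if i: "i \<in> {1..<?d}" for i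
      proof -
        have "T i (?g j \<circ> h) \<le> R0 powr b i * T i h" using T1[OF h i] by (simp only: powr_mult T_def)
        also have "\<dots> \<le> R0 powr b i * covol_height \<eta> \<kappa> h" by (intro mult_left_mono Tle i) simp
        finally show ?thesis .
      qed
      then have "covol_height \<eta> \<kappa> (?g j \<circ> h) \<le> (\<Sum>i\<in>{1..<?d}. R0 powr b i * covol_height \<eta> \<kappa> h)"
        unfolding covol_height[of "?g j \<circ> h"] by (rule sum_mono)
      then show ?thesis by (simp add: R_def sum_distrib_right)
    qed
    have main: "(\<Sum>j\<in>digits L. covol_height \<eta> \<kappa> (?g j \<circ> h)) \<le> C * X * covol_height \<eta> \<kappa> h"
      if h: "good h" and f1: "1 \<le> covol_height \<eta> \<kappa> h" for h
    proof -
      let ?f = "covol_height \<eta> \<kappa> h"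
      \<comment> \<open>The power in \<open>T\<close> is inverted: 1 / \<open>b k\<close> equals
        \<open>te k / (1 - \<eta>)\<close>. At the two trivial ranks \<open>te\<close> is 0 and the
        right-hand side is 1.\<close>
      have wa: "w k * alpha k h \<le> ?f powr (te k / (1 - \<eta>))" if "k \<le> ?d" for k
      proof -
        have "k = 0 \<or> k = ?d \<or> k \<in> {1..<?d}" unfolding atLeastLessThan_iff using that by linarith
        then consider "k = 0" | "k = ?d" | "k \<in> {1..<?d}" by blast
        then show ?thesis
        proof cases
          case 1
          then show ?thesis using alpha_0_le[of h] f1 by (simp add: w_def weight_def te_def tent_ends)
        next
          case 2
          then show ?thesis using alpha_DIM_le[OF h] f1 mn by (simp add: w_def weight_def te_def tent_ends)
        next
          case 3
          have "w k * alpha k h = T k h powr (te k / (1 - \<eta>))"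
            unfolding T_def powr_powr bte[OF 3] using w agh(2)[OF h that] by simp
          also have "\<dots> \<le> ?f powr (te k / (1 - \<eta>))"
            using Tle[OF 3] T0 te[OF 3] \<eta> by (intro powr_mono2) auto
          finally show ?thesis .
        qed
      qed
      have Ti: "(\<Sum>j\<in>digits L. T i (?g j \<circ> h)) \<le> (Ci i + 1) * X * ?f" if i: "i \<in> {1..<?d}" for i
      proof -
        have id: "i \<le> DIM((real ^ 'm) \<times> (real ^ 'n))" and id': "i \<le> ?d" using i by auto
        have ai: "0 < alpha i h" by (rule agh(2)[OF h id'])
        show ?thesis
        proof (cases rule: alpha_dichotomy[OF h id R0])
          case (1 z)
          let ?v = "map h z"
          have v: "length ?v = i" "0 < vol ?v" using 1(1) vol_map_pos[OF h] by (auto simp: Zt_def)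
          have "T i (?g j \<circ> h) \<le> T i h * (vol (map (?g j) ?v) / vol ?v) powr - b i" if j: "j \<in> digits L" for j
          proof -
            let ?J = "vol (map (?g j) ?v) / vol ?v"
            have J: "0 < ?J" using vol_map_pos[OF gg v(2), of j] v(2) by (rule divide_pos_pos)
            have "alpha i (?g j \<circ> h) \<le> alpha i h / ?J"
              using dist[OF j] id' by (intro 1(2) linear_flow) auto
            from mult_left_mono[OF this w(2)[of i]]
            have "w i * alpha i (?g j \<circ> h) \<le> (w i * alpha i h) * inverse ?J" by (simp add: divide_inverse mult_ac)
            then have "T i (?g j \<circ> h) \<le> ((w i * alpha i h) * inverse ?J) powr b i"
              unfolding T_def using agh(1)[OF h id', of j] w b0[OF i] by (intro powr_mono2) auto
            also have "\<dots> = T i h * inverse ?J powr b i" by (simp only: powr_mult T_def)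
            also have "inverse ?J powr b i = ?J powr - b i" by (simp only: powr_minus inverse_powr)
            finally show ?thesis .
          qed
          then have "(\<Sum>j\<in>digits L. T i (?g j \<circ> h)) \<le> (\<Sum>j\<in>digits L. T i h * (vol (map (?g j) ?v) / vol ?v) powr - b i)"
            by (rule sum_mono)
          also have "\<dots> = T i h * (\<Sum>j\<in>digits L. (vol (map (?g j) ?v) / vol ?v) powr - b i)"
            by (simp only: sum_distrib_left)
          also have "\<dots> \<le> ?f * (Ci i * X)"
          proof (rule mult_mono[OF Tle[OF i] _ f0])
            show "(\<Sum>j\<in>digits L. (vol (map (?g j) ?v) / vol ?v) powr - b i) \<le> Ci i * X"
              using Ci[OF i L _ _ AB AmBn v] AB1 by (simp add: X_def mult.assoc del: map_map)
          qed (intro sum_nonneg, simp)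
          also have "\<dots> \<le> (Ci i + 1) * X * ?f" using X0 f0[of h] by (simp add: algebra_simps)
          finally show ?thesis .
        next
          case (2 k)
          let ?e = "te i / (1 - \<eta>)"
          have k': "i + k \<le> ?d" using 2(3) by simp
          have "(w i * alpha i h)\<^sup>2 = exp (- 2 * \<kappa> * (real k)\<^sup>2) * (w (i - k) * w (i + k)) * (alpha i h)\<^sup>2"
            unfolding power_mult_distrib w_def weight_convex[OF 2(2) k'] ..
          also have "\<dots> \<le> exp (- 2 * \<kappa>) * (w (i - k) * w (i + k)) * (4 * R0 ^ 4 * (alpha (i - k) h * alpha (i + k) h))"
          proof (intro mult_mono 2(4) order_refl)
            have "1 \<le> (real k)\<^sup>2" using 2(1) by simp
            then have "\<kappa> * 1 \<le> \<kappa> * (real k)\<^sup>2" using \<kappa>0 by (intro mult_left_mono)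
            then show "exp (- 2 * \<kappa> * (real k)\<^sup>2) \<le> exp (- 2 * \<kappa>)" by simp
          qed (use w in auto)
          also have "\<dots> = exp (- 2 * \<kappa>) * (4 * R0 ^ 4) * ((w (i - k) * alpha (i - k) h) * (w (i + k) * alpha (i + k) h))"
            by (simp add: mult_ac)
          also have "\<dots> \<le> exp (- 2 * \<kappa>) * (4 * R0 ^ 4) * (?f powr (te (i - k) / (1 - \<eta>)) * ?f powr (te (i + k) / (1 - \<eta>)))"
            using R0 w agh(2)[OF h, of "i - k"] agh(2)[OF h k'] id'
            by (intro mult_left_mono mult_mono wa k') (auto intro!: mult_nonneg_nonneg less_imp_le)
          also have "?f powr (te (i - k) / (1 - \<eta>)) * ?f powr (te (i + k) / (1 - \<eta>)) = ?f powr ((te (i - k) + te (i + k)) / (1 - \<eta>))"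
            by (simp add: powr_add[symmetric] add_divide_distrib)
          \<comment> \<open>Concavity of \<open>tent\<close> brings the two neighbouring ranks back
            to the exponent of rank i; this direction uses that \<open>?f\<close> is at least
            1.\<close>
          also have "exp (- 2 * \<kappa>) * (4 * R0 ^ 4) * \<dots> \<le> exp (- 2 * \<kappa>) * (4 * R0 ^ 4) * ?f powr (2 * te i / (1 - \<eta>))"
            using tent_concave[OF 2(2), of ?m ?n] \<eta> R0 f1 unfolding te_def
            by (intro mult_left_mono powr_mono divide_right_mono) auto
          also have "\<dots> = (?f powr ?e / (R0 * A ^ ?m))\<^sup>2"
          proof -
            have "?f powr (2 * te i / (1 - \<eta>)) = (?f powr ?e)\<^sup>2" by (simp add: power2_eq_square powr_add[symmetric])
            moreover have "exp (- 2 * \<kappa>) * (4 * R0 ^ 4) = 1 / (R0 * A ^ ?m)\<^sup>2"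
              unfolding \<kappa> using R0 Am by (simp add: power_mult_distrib divide_simps)
            ultimately show ?thesis by (simp add: power_divide)
          qed
          finally have "w i * alpha i h \<le> ?f powr ?e / (R0 * A ^ ?m)"
            by (rule power2_le_imp_le) (use R0 Am in simp)
          then have "R0 * (w i * alpha i h) \<le> R0 * (?f powr ?e / (R0 * A ^ ?m))" using R0 by (intro mult_left_mono) auto
          also have "\<dots> = ?f powr ?e * inverse (A ^ ?m)" using R0 by (simp add: divide_inverse)
          finally have le: "R0 * (w i * alpha i h) \<le> ?f powr ?e * inverse (A ^ ?m)" .
          have "T i (?g j \<circ> h) \<le> ?f * (A ^ ?m) powr - (1 - \<eta>)" if j: "j \<in> digits L" for j
          proof -
            have "T i (?g j \<circ> h) \<le> (R0 * (w i * alpha i h)) powr b i" by (rule T1[OF h j i])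
            also have "\<dots> \<le> (?f powr ?e * inverse (A ^ ?m)) powr b i"
              using le R0 w ai b0[OF i] by (intro powr_mono2) (auto intro!: mult_nonneg_nonneg less_imp_le)
            also have "\<dots> = (?f powr ?e) powr b i * inverse (A ^ ?m) powr b i" by (rule powr_mult)
            also have "(?f powr ?e) powr b i = ?f"
              unfolding powr_powr mult.commute[of ?e] bte[OF i] using f1 by simp
            also have "inverse (A ^ ?m) powr b i = (A ^ ?m) powr - b i" by (simp only: powr_minus inverse_powr)
            \<comment> \<open>Since \<open>tent\<close> is at most 1, \<open>b i\<close> is at least
              1-\<eta>, so this case contracts at least as fast as required.\<close>
            also have "?f * (A ^ ?m) powr - b i \<le> ?f * (A ^ ?m) powr - (1 - \<eta>)"
              using b1[OF i] Am f0[of h] by (intro mult_left_mono powr_mono) auto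
            finally show ?thesis .
          qed
          then have "(\<Sum>j\<in>digits L. T i (?g j \<circ> h)) \<le> (\<Sum>j\<in>(digits L :: ('m \<times> 'n \<Rightarrow> nat) set). ?f * (A ^ ?m) powr - (1 - \<eta>))"
            by (rule sum_mono)
          also have "\<dots> = X * ?f" by (simp add: card_digits X_def)
          also have "\<dots> \<le> (Ci i + 1) * X * ?f"
            using Ci0[OF i] X0 f0[of h] by (simp add: algebra_simps)
          finally show ?thesis .
        qed
      qed
      have "(\<Sum>j\<in>digits L. covol_height \<eta> \<kappa> (?g j \<circ> h)) = (\<Sum>i\<in>{1..<?d}. \<Sum>j\<in>digits L. T i (?g j \<circ> h))"
        unfolding covol_height by (rule sum.swap)
      also have "\<dots> \<le> (\<Sum>i\<in>{1..<?d}. (Ci i + 1) * X * ?f)" by (intro sum_mono Ti)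
      also have "\<dots> = C * X * ?f" by (simp only: C_def sum_distrib_right)
      finally show ?thesis .
    qed
    have "0 \<le> R" unfolding R_def by (intro sum_nonneg) simp
    with crude main show ?thesis unfolding X_def by (intro exI[of _ \<kappa>] exI[of _ R]) blast
  qed
  with Cpos that show thesis by blast
qed

section \<open>Counting cells\<close>

text \<open>Division with remainder by \<open>L\<close>: a cell of level N+1 is a cell of level N
  together with one more digit per coordinate.\<close>

lemma sum_digits_Suc:
  fixes F :: "('x::finite \<Rightarrow> nat) \<Rightarrow> real"
  assumes L: "0 < L"
  shows "(\<Sum>J\<in>digits (L ^ Suc N). F J) = (\<Sum>J\<in>digits (L ^ N). \<Sum>j\<in>digits L. F (\<lambda>x. L * J x + j x))"
proof -
  have lt: "L * a + b < L * L ^ N" if "a < L ^ N" "b < L" for a b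
  proof -
    have "L * a + b < L * (a + 1)" using that by simp
    also have "\<dots> \<le> L * L ^ N" using that by (intro mult_le_mono2) simp
    finally show ?thesis .
  qed
  have dv: "c div L < L ^ N" if "c < L * L ^ N" for c
    using that by (simp add: less_mult_imp_div_less mult.commute)
  have "(\<Sum>J\<in>digits (L ^ N). \<Sum>j\<in>digits L. F (\<lambda>x. L * J x + j x))
     = (\<Sum>(J, j)\<in>digits (L ^ N) \<times> digits L. F (\<lambda>x. L * J x + j x))"
    by (simp add: sum.cartesian_product)
  also have "\<dots> = (\<Sum>J\<in>digits (L ^ Suc N). F J)"
    by (rule sum.reindex_bij_witness[of _ "\<lambda>J. (\<lambda>x. J x div L, \<lambda>x. J x mod L)" "\<lambda>(J, j) x. L * J x + j x"])
       (use L lt dv in \<open>auto simp: digits_def fun_eq_iff\<close>)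
  finally show ?thesis ..
qed

text \<open>The product of \<kappa> over the proper ancestors of a cell; division by
  \<open>L\<close> leads from a cell to its parent.\<close>

fun wt :: "nat \<Rightarrow> (nat \<Rightarrow> ('x \<Rightarrow> nat) \<Rightarrow> real) \<Rightarrow> nat \<Rightarrow> ('x \<Rightarrow> nat) \<Rightarrow> real" where
  "wt L \<kappa> 0 J = 1"
| "wt L \<kappa> (Suc N) J = wt L \<kappa> N (\<lambda>x. J x div L) * \<kappa> N (\<lambda>x. J x div L)"

lemma wt_nonneg:
  assumes "\<And>N J. 0 \<le> \<kappa> N J"
  shows "0 \<le> wt L \<kappa> N J"
  by (induction N arbitrary: J) (auto intro!: mult_nonneg_nonneg assms)

text \<open>By \<open>step\<close>, a cell passes on to its children at most its own amount. Hence
  the weighted total does not increase with the level, like the expectation of a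
  supermartingale.\<close>

lemma sum_wt_le:
  fixes G :: "nat \<Rightarrow> ('x::finite \<Rightarrow> nat) \<Rightarrow> real"
  assumes L: "0 < L" and \<kappa>: "\<And>N J. 0 \<le> \<kappa> N J"
    and step: "\<And>N J. \<kappa> N J * (\<Sum>j\<in>digits L. G (Suc N) (\<lambda>x. L * J x + j x)) \<le> G N J"
  shows "(\<Sum>J\<in>digits (L ^ N). wt L \<kappa> N J * G N J) \<le> G 0 (\<lambda>_. 0)"
proof (induction N)
  case 0
  have "digits 1 = {\<lambda>_ :: 'x. 0 :: nat}" by (auto simp: digits_def)
  then show ?case by simp
next
  case (Suc N)
  have "(\<Sum>J\<in>digits (L ^ Suc N). wt L \<kappa> (Suc N) J * G (Suc N) J)
     = (\<Sum>J\<in>digits (L ^ N). \<Sum>j\<in>digits L. wt L \<kappa> (Suc N) (\<lambda>x. L * J x + j x) * G (Suc N) (\<lambda>x. L * J x + j x))"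
    by (rule sum_digits_Suc[OF L])
  also have "\<dots> = (\<Sum>J\<in>digits (L ^ N). \<Sum>j\<in>digits L. wt L \<kappa> N J * \<kappa> N J * G (Suc N) (\<lambda>x. L * J x + j x))"
  proof (intro sum.cong refl)
    fix J j assume "j \<in> (digits L :: ('x \<Rightarrow> nat) set)"
    then have "(\<lambda>x. (L * J x + j x) div L) = J" using L by (auto simp: digits_def)
    then show "wt L \<kappa> (Suc N) (\<lambda>x. L * J x + j x) * G (Suc N) (\<lambda>x. L * J x + j x)
       = wt L \<kappa> N J * \<kappa> N J * G (Suc N) (\<lambda>x. L * J x + j x)" by simp
  qed
  also have "\<dots> = (\<Sum>J\<in>digits (L ^ N). wt L \<kappa> N J * (\<kappa> N J * (\<Sum>j\<in>digits L. G (Suc N) (\<lambda>x. L * J x + j x))))"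
    by (simp add: sum_distrib_left mult.assoc)
  also have "\<dots> \<le> (\<Sum>J\<in>digits (L ^ N). wt L \<kappa> N J * G N J)"
    by (intro sum_mono mult_left_mono step wt_nonneg \<kappa>)
  finally show ?case using Suc by linarith
qed

definition digit_index :: "nat \<Rightarrow> ('x \<Rightarrow> real) \<Rightarrow> nat \<Rightarrow> 'x \<Rightarrow> nat" where
  "digit_index L y N x = nat \<lfloor>y x * real L ^ N\<rfloor>"

lemma digit_index_props:
  assumes y: "\<And>x. 0 \<le> y x \<and> y x < 1" and L: "0 < L"
  shows "digit_index L y N \<in> digits (L ^ N)"
    and "real (digit_index L y N x) \<le> y x * real L ^ N"
    and "y x * real L ^ N < real (digit_index L y N x) + 1"
    and "(\<lambda>x. digit_index L y (Suc N) x div L) = digit_index L y N"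
proof -
  have p: "0 \<le> y x * real L ^ N" for x N using y by simp
  have r: "real (digit_index L y N x) = of_int \<lfloor>y x * real L ^ N\<rfloor>" for N x
    unfolding digit_index_def using p by simp
  show 1: "real (digit_index L y N x) \<le> y x * real L ^ N" for x unfolding r by simp
  show "y x * real L ^ N < real (digit_index L y N x) + 1" unfolding r by linarith
  have "real (digit_index L y N x) < real (L ^ N)" for x
  proof -
    have "y x * real L ^ N < 1 * real L ^ N" using y L by (intro mult_strict_right_mono) auto
    with 1[of x] have "real (digit_index L y N x) < real L ^ N" by linarith
    then show ?thesis by (simp only: of_nat_power)
  qed
  then show "digit_index L y N \<in> digits (L ^ N)" by (simp add: digits_def del: of_nat_power)
  show "(\<lambda>x. digit_index L y (Suc N) x div L) = digit_index L y N"
  proof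
    fix x
    have "\<lfloor>y x * real L ^ N\<rfloor> = \<lfloor>(y x * real L ^ Suc N) / of_int (int L)\<rfloor>" using L by simp
    also have "\<dots> = \<lfloor>y x * real L ^ Suc N\<rfloor> div int L" by (intro floor_divide_real_eq_div) simp
    finally show "digit_index L y (Suc N) x div L = digit_index L y N x"
      unfolding digit_index_def using p[of x "Suc N"] by (simp add: nat_div_distrib)
  qed
qed

lemma wt_digit_index:
  fixes y :: "'x::finite \<Rightarrow> real"
  assumes y: "\<And>x. 0 \<le> y x \<and> y x < 1" and L: "0 < L"
  shows "wt L \<kappa> N (digit_index L y N) = (\<Prod>l<N. \<kappa> l (digit_index L y l))"
proof (induction N)
  case (Suc N)
  have "(\<lambda>x. digit_index L y (Suc N) x div L) = digit_index L y N"
    by (rule digit_index_props(4)[where y = y and L = L, OF y L])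
  then have "wt L \<kappa> (Suc N) (digit_index L y (Suc N)) = wt L \<kappa> N (digit_index L y N) * \<kappa> N (digit_index L y N)"
    by (simp only: wt.simps)
  then show ?case by (simp only: Suc prod.lessThan_Suc)
qed simp

text \<open>All logarithms to base 2 are linear in k. Per unit of k there is a positive gap
  \<open>g\<close> between the target (m+n) D and the growth rate at \<eta> = 0. Half of it pays for
  \<eta>, and k times the other half beats the logarithm of \<open>C\<close>.\<close>

lemma exponent_choice:
  fixes D :: real
  assumes m: "0 < m" and n: "0 < n" and D: "real m * real n - real m * real n / (real m + real n) < D"
  obtains \<eta> where "0 < \<eta>" "\<eta> < 1"
    "\<And>C. 0 < C \<Longrightarrow> \<exists>k\<ge>1. C * (real (2 ^ ((m + n) * k)) ^ (m * n) * (((2 ^ (n * k)) ^ m) powr - (1 - \<eta>)))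
       < real (2 ^ ((m + n) * k)) powr D"
proof -
  have mn: "0 < real m * real n" "0 < real m + real n" using m n by auto
  have "(real m + real n) * (real m * real n - real m * real n / (real m + real n)) < (real m + real n) * D"
    using D mn(2) by (intro mult_strict_left_mono)
  then have gap: "(real m + real n) * (real m * real n) - real m * real n < (real m + real n) * D"
    using mn by (simp add: right_diff_distrib)
  define g where "g = (real m + real n) * D - ((real m + real n) * (real m * real n) - real m * real n)"
  have g: "0 < g" using gap by (simp add: g_def)
  define \<eta> where "\<eta> = min (1 / 2) (g / (2 * (real m * real n)))"
  have \<eta>: "0 < \<eta>" "\<eta> < 1" using g mn by (auto simp: \<eta>_def)
  have \<eta>g: "\<eta> * (real m * real n) \<le> g / 2"
  proof -
    have "\<eta> \<le> g / (2 * (real m * real n))" by (simp add: \<eta>_def)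
    then have "\<eta> * (real m * real n) \<le> g / (2 * (real m * real n)) * (real m * real n)"
      using mn by (intro mult_right_mono) auto
    also have "\<dots> = g / 2"
    proof -
      have "g / (2 * p) * p = g / 2" if "0 < p" for p :: real using that by simp
      from this[OF mn(1)] show ?thesis .
    qed
    finally show ?thesis .
  qed
  show thesis
  proof (rule that[OF \<eta>])
    fix C :: real assume C: "0 < C"
    obtain k where k: "k \<ge> 1" "C < 2 powr (real k * (g / 2))"
    proof -
      have "1 < 2 powr (g / 2)" using g powr_less_mono[of 0 "g / 2" 2] by simp
      then obtain k0 where k0: "C < (2 powr (g / 2)) ^ k0" using real_arch_pow by blast
      have "(2 powr (g / 2)) ^ k0 \<le> (2 powr (g / 2)) ^ (k0 + 1)"
        using \<open>1 < 2 powr (g / 2)\<close> by (intro power_increasing) auto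
      moreover have "(2 powr (g / 2)) ^ (k0 + 1) = 2 powr (real (k0 + 1) * (g / 2))"
        by (subst powr_realpow[symmetric]) (simp_all add: powr_powr mult.commute)
      ultimately show thesis using that[of "k0 + 1"] k0 by linarith
    qed
    have e1: "real (2 ^ ((m + n) * k)) ^ (m * n) = 2 powr (real k * ((real m + real n) * (real m * real n)))"
    proof -
      have "real (2 ^ ((m + n) * k)) ^ (m * n) = 2 ^ ((m + n) * k * (m * n))" by (simp add: power_mult)
      also have "\<dots> = 2 powr real ((m + n) * k * (m * n))" by (rule powr_realpow[symmetric]) simp
      finally show ?thesis by (simp add: mult_ac)
    qed
    have e2: "((2 ^ (n * k)) ^ m) powr - (1 - \<eta>) = 2 powr (real k * (- (real m * real n) + \<eta> * (real m * real n)))"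
    proof -
      have "(2 ^ (n * k)) ^ m = (2 :: real) powr real (n * k * m)" by (subst powr_realpow) (simp_all add: power_mult)
      then have "((2 ^ (n * k)) ^ m) powr - (1 - \<eta>) = 2 powr (real (n * k * m) * - (1 - \<eta>))" by (simp only: powr_powr)
      also have "real (n * k * m) * - (1 - \<eta>) = real k * (- (real m * real n) + \<eta> * (real m * real n))" by (simp add: algebra_simps)
      finally show ?thesis .
    qed
    have e3: "real (2 ^ ((m + n) * k)) powr D = 2 powr (real k * ((real m + real n) * D))"
    proof -
      have "real (2 ^ ((m + n) * k)) = 2 powr real ((m + n) * k)" by (subst powr_realpow) simp_all
      then show ?thesis by (simp add: powr_powr algebra_simps)
    qed
    have "C * (2 powr (real k * ((real m + real n) * (real m * real n))) * 2 powr (real k * (- (real m * real n) + \<eta> * (real m * real n))))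
      < 2 powr (real k * (g / 2)) * (2 powr (real k * ((real m + real n) * (real m * real n))) * 2 powr (real k * (- (real m * real n) + \<eta> * (real m * real n))))"
      using k(2) by (intro mult_strict_right_mono) auto
    also have "\<dots> = 2 powr (real k * (g / 2 + (real m + real n) * (real m * real n) - real m * real n + \<eta> * (real m * real n)))"
      by (simp add: powr_add[symmetric] algebra_simps)
    also have "\<dots> \<le> 2 powr (real k * ((real m + real n) * D))"
    proof (intro powr_mono mult_left_mono)
      show "g / 2 + (real m + real n) * (real m * real n) - real m * real n + \<eta> * (real m * real n) \<le> (real m + real n) * D"
        using \<eta>g g_def by linarith
    qed auto
    finally show "\<exists>k\<ge>1. C * (real (2 ^ ((m + n) * k)) ^ (m * n) * (((2 ^ (n * k)) ^ m) powr - (1 - \<eta>)))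
       < real (2 ^ ((m + n) * k)) powr D"
      using k(1) unfolding e1[symmetric] e2[symmetric] e3[symmetric] by blast
  qed
qed

section \<open>Trajectories that stay in the cusp\<close>

definition lattice_at :: "real \<Rightarrow> real \<Rightarrow> nat \<Rightarrow> ('m::finite \<Rightarrow> 'n::finite \<Rightarrow> real) \<Rightarrow> nat \<Rightarrow> ('m \<times> 'n \<Rightarrow> nat) \<Rightarrow> (real ^ 'm) \<times> (real ^ 'n) \<Rightarrow> (real ^ 'm) \<times> (real ^ 'n)" where
  "lattice_at A B L s N J = flow (A ^ N) (B ^ N) (\<lambda>i k. s i k + point (\<lambda>x. real (J x) / real L ^ N) i k)"

text \<open>\<open>lattice_at\<close> is the flow at time N based at the lower corner of the cell
  \<open>J\<close>. By \<open>flow_comp\<close>, a further step with the corner of \<open>j\<close>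
  amounts to refining the base point by one digit.\<close>

lemma lattice_at_Suc:
  assumes "A \<noteq> 0" "B \<noteq> 0" "A * B = real L" "0 < L"
  shows "flow A B (point (corner L j)) \<circ> lattice_at A B L s N J = lattice_at A B L s (Suc N) (\<lambda>x. L * J x + j x)"
proof
  fix v
  have pw: "A ^ N * B ^ N = real L ^ N" by (simp add: assms(3) power_mult_distrib[symmetric])
  have "(\<lambda>i k. s i k + point (\<lambda>x. real (J x) / real L ^ N) i k + point (corner L j) i k / (A ^ N * B ^ N))
     = (\<lambda>i k. s i k + point (\<lambda>x. real (L * J x + j x) / real L ^ Suc N) i k)"
    unfolding pw using assms(4) by (intro ext) (simp add: point_def corner_def field_simps)
  then show "(flow A B (point (corner L j)) \<circ> lattice_at A B L s N J) v = lattice_at A B L s (Suc N) (\<lambda>x. L * J x + j x) v"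
    using assms(1,2) by (simp add: lattice_at_def flow_comp)
qed

lemma good_lattice_at:
  fixes s :: "'m::finite \<Rightarrow> 'n::finite \<Rightarrow> real"
  assumes "0 < A" "0 < B" "A ^ CARD('m) = B ^ CARD('n)"
  shows "good (lattice_at A B L s N J)"
  unfolding lattice_at_def
proof (rule good_flow)
  show "(A ^ N) ^ CARD('m) = (B ^ N) ^ CARD('n)"
    using assms(3) by (metis power_mult mult.commute)
qed (use assms in auto)

lemma vol_singleton: "vol [v] = norm (v :: 'a::euclidean_space)"
  using vol_snoc[of "[]" v] by (simp add: infdist_def dist_norm)

text \<open>The rank 1 term alone exceeds \<open>M\<close> once there is a short vector; solving for
  its length gives an \<epsilon> that works for all \<open>h\<close>.\<close>

lemma covol_height_large:
  fixes s :: "'m::finite \<Rightarrow> 'n::finite \<Rightarrow> real"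
  assumes \<eta>: "0 < \<eta>" "\<eta> < 1" and M: "1 \<le> M"
  obtains \<epsilon> where "0 < \<epsilon>"
    "\<And>(h :: (real ^ 'm) \<times> (real ^ 'n) \<Rightarrow> (real ^ 'm) \<times> (real ^ 'n)) z. good h \<Longrightarrow> z \<in> Zlat \<Longrightarrow> z \<noteq> 0 \<Longrightarrow>
       norm (h z) \<le> \<epsilon> \<Longrightarrow> M \<le> covol_height \<eta> \<kappa> h"
proof -
  let ?m = "CARD('m)" and ?n = "CARD('n)"
  let ?b = "beta \<eta> ?m ?n 1" and ?w = "weight \<kappa> (?m + ?n) 1"
  have mn: "0 < ?m" "0 < ?n" by auto
  have one: "1 \<in> {1..<?m + ?n}" unfolding atLeastLessThan_iff using mn by linarith
  then have b: "0 < ?b" using \<eta> tent_pos[OF mn, of 1] by (simp add: beta_def)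
  define \<epsilon> where "\<epsilon> = ?w / M powr (1 / ?b)"
  have \<epsilon>: "0 < \<epsilon>" using M by (simp add: \<epsilon>_def)
  have "M \<le> covol_height \<eta> \<kappa> h" if h: "good h" and z: "z \<in> Zlat" "z \<noteq> 0" and le: "norm (h z) \<le> \<epsilon>"
    for h :: "(real ^ 'm) \<times> (real ^ 'n) \<Rightarrow> (real ^ 'm) \<times> (real ^ 'n)" and z
  proof -
    have zt: "[z] \<in> Zt 1" using z by (simp add: Zt_def vol_singleton)
    have pos: "0 < norm (h z)" using vol_map_pos[OF h, of "[z]"] z by (simp add: vol_singleton)
    have "1 / \<epsilon> \<le> 1 / norm (h z)" using le pos \<epsilon> by (intro divide_left_mono) auto
    also have "\<dots> \<le> alpha 1 h" using alpha_ge[OF h zt] by (simp add: vol_singleton)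
    finally have "?w * (1 / \<epsilon>) \<le> ?w * alpha 1 h" by (intro mult_left_mono) auto
    moreover have "?w * (1 / \<epsilon>) = M powr (1 / ?b)" using M by (simp add: \<epsilon>_def less_imp_neq[OF weight_pos(1), symmetric])
    ultimately have "(M powr (1 / ?b)) powr ?b \<le> (?w * alpha 1 h) powr ?b"
      using b by (intro powr_mono2) auto
    then have "M \<le> (?w * alpha 1 h) powr ?b" using M b by (simp add: powr_powr)
    also have "\<dots> \<le> covol_height \<eta> \<kappa> h"
      unfolding covol_height_def
      by (rule member_le_sum[OF one, of "\<lambda>i. (weight \<kappa> (?m + ?n) i * alpha i h) powr beta \<eta> ?m ?n i"]) auto
    finally show ?thesis .
  qed
  with \<epsilon> that show thesis by blast
qed

text \<open>Among the first p N scales only o(p N) are bad, and this is o(N) for fixed p. So bad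
  scales are negligible also along the multiples of p; the delay c costs at most c+1
  indices.\<close>

lemma bad_density:
  fixes s :: "real ^ 'n ^ 'm"
  assumes s: "singular_on_average s" and \<epsilon>: "0 < \<epsilon>" and p: "1 \<le> p"
  shows "(\<lambda>N. real (card {l. l < N \<and> \<not> (c < l \<and> approximable s \<epsilon> (2 ^ (p * (l - c))))}) / real N) \<longlonglongrightarrow> 0"
proof -
  define bad where "bad N = card {l \<in> {1..N}. \<not> approximable s \<epsilon> (2 ^ l)}" for N :: nat
  have lim: "(\<lambda>N. real (bad N) / real N) \<longlonglongrightarrow> 0"
  proof -
    have "(\<lambda>N. 1 - real (card {l \<in> {1..N}. approximable s \<epsilon> (2 ^ l)}) / real N) \<longlonglongrightarrow> 1 - 1"
      using s \<epsilon> by (intro tendsto_diff tendsto_const) (auto simp: singular_on_average_def)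
    moreover have "eventually (\<lambda>N. 1 - real (card {l \<in> {1..N}. approximable s \<epsilon> (2 ^ l)}) / real N = real (bad N) / real N) sequentially"
      using eventually_gt_at_top[of 0]
    proof eventually_elim
      case (elim N)
      have "card ({l \<in> {1..N}. approximable s \<epsilon> (2 ^ l)} \<union> {l \<in> {1..N}. \<not> approximable s \<epsilon> (2 ^ l)})
         = card {l \<in> {1..N}. approximable s \<epsilon> (2 ^ l)} + bad N"
        unfolding bad_def by (intro card_Un_disjoint) auto
      also have "{l \<in> {1..N}. approximable s \<epsilon> (2 ^ l)} \<union> {l \<in> {1..N}. \<not> approximable s \<epsilon> (2 ^ l)} = {1..N}" by auto
      finally have "real N = real (card {l \<in> {1..N}. approximable s \<epsilon> (2 ^ l)}) + real (bad N)" by simp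
      then show ?case using elim by (simp add: field_simps)
    qed
    ultimately show ?thesis by (simp add: tendsto_cong)
  qed
  have "filterlim (\<lambda>N. p * N) at_top sequentially"
    using p by (intro mult_nat_left_at_top) simp
  then have "(\<lambda>N. real (bad (p * N)) / real (p * N)) \<longlonglongrightarrow> 0"
    by (rule filterlim_compose[OF lim])
  then have "(\<lambda>N. real p * (real (bad (p * N)) / real (p * N)) + real (c + 1) / real N) \<longlonglongrightarrow> real p * 0 + 0"
    by (intro tendsto_add tendsto_mult tendsto_const lim_const_over_n)
  then have up: "(\<lambda>N. real p * (real (bad (p * N)) / real (p * N)) + real (c + 1) / real N) \<longlonglongrightarrow> 0" by simp
  show ?thesis
  proof (rule tendsto_sandwich[OF _ _ tendsto_const up])
    show "eventually (\<lambda>N. real (card {l. l < N \<and> \<not> (c < l \<and> approximable s \<epsilon> (2 ^ (p * (l - c))))}) / real N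
       \<le> real p * (real (bad (p * N)) / real (p * N)) + real (c + 1) / real N) sequentially"
      using eventually_gt_at_top[of 0]
    proof eventually_elim
      case (elim N)
      define S where "S = {l. c < l \<and> l < N \<and> \<not> approximable s \<epsilon> (2 ^ (p * (l - c)))}"
      have finS: "finite S" by (rule finite_subset[of _ "{..<N}"]) (auto simp: S_def)
      have "inj_on (\<lambda>l. p * (l - c)) S" using p by (auto simp: inj_on_def S_def)
      moreover have "(\<lambda>l. p * (l - c)) ` S \<subseteq> {l \<in> {1..p * N}. \<not> approximable s \<epsilon> (2 ^ l)}"
        using p by (auto simp: S_def intro: mult_le_mono2)
      ultimately have "card S \<le> bad (p * N)"
        unfolding bad_def by (intro card_inj_on_le) auto
      moreover have "card {l. l < N \<and> \<not> (c < l \<and> approximable s \<epsilon> (2 ^ (p * (l - c))))} \<le> card ({..c} \<union> S)"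
        using finS by (intro card_mono) (auto simp: S_def)
      moreover have "card ({..c} \<union> S) \<le> (c + 1) + card S"
        using card_Un_le[of "{..c}" S] by simp
      ultimately have "real (card {l. l < N \<and> \<not> (c < l \<and> approximable s \<epsilon> (2 ^ (p * (l - c))))}) \<le> real (bad (p * N)) + real (c + 1)"
        by linarith
      then have "real (card {l. l < N \<and> \<not> (c < l \<and> approximable s \<epsilon> (2 ^ (p * (l - c))))}) / real N
         \<le> (real (bad (p * N)) + real (c + 1)) / real N" by (rule divide_right_mono) simp
      also have "\<dots> = real p * (real (bad (p * N)) / real (p * N)) + real (c + 1) / real N"
        using p elim by (simp add: add_divide_distrib)
      finally show ?case .
    qed
  qed simp
qed

text \<open>The condition is used at T = B^(l-c), where its first bound is \<epsilon> / A^(l-c). The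
  bound norm q < T alone only keeps the second component below 1 at time l-c. Flowing c steps longer
  pushes it below B^(-c), at the price of a factor A^c that \<epsilon> can compensate.\<close>

lemma approximable_short_vector:
  fixes s :: "real ^ 'n::finite ^ 'm::finite"
  assumes A: "A = 2 ^ (CARD('n) * k)" and B: "B = 2 ^ (CARD('m) * k)" and c: "c < l"
    and ap: "approximable s \<epsilon> (2 ^ (CARD('m) * k * (l - c)))"
  obtains z where "z \<in> Zlat" "z \<noteq> 0"
    "norm (flow (A ^ l) (B ^ l) (\<lambda>i j. s $ i $ j) z) \<le> \<epsilon> * A ^ c + 1 / B ^ c"
proof -
  let ?T = "(2 :: real) ^ (CARD('m) * k * (l - c))"
  obtain q :: "int ^ 'n" and p :: "int ^ 'm" where
    1: "norm (s *v real_vec q - real_vec p) < \<epsilon> / ?T powr (real CARD('n) / real CARD('m))"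
    and 2: "0 < norm (real_vec q)" "norm (real_vec q) < ?T"
    using ap unfolding approximable_def by auto
  define z :: "(real ^ 'm) \<times> (real ^ 'n)" where "z = (- real_vec p, real_vec q)"
  have T: "?T powr (real CARD('n) / real CARD('m)) = A ^ (l - c)"
  proof -
    have "?T = 2 powr real (CARD('m) * k * (l - c))" by (rule powr_realpow[symmetric]) simp
    then have "?T powr (real CARD('n) / real CARD('m)) = 2 powr (real (CARD('m) * k * (l - c)) * (real CARD('n) / real CARD('m)))"
      by (simp only: powr_powr)
    also have "real (CARD('m) * k * (l - c)) * (real CARD('n) / real CARD('m)) = real (CARD('n) * k * (l - c))" by simp
    also have "2 powr real (CARD('n) * k * (l - c)) = 2 ^ (CARD('n) * k * (l - c))" by (rule powr_realpow) simp
    finally show ?thesis by (simp add: A power_mult)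
  qed
  have TB: "?T = B ^ (l - c)" by (simp add: B power_mult)
  have ApBp: "0 < A" "0 < B" by (simp_all add: A B)
  have expand_eq: "expand (\<lambda>i j. s $ i $ j) z = s *v real_vec q - real_vec p"
    by (simp add: expand_def mat_app_def z_def matrix_vector_mult_def)
  have Al: "A ^ l = A ^ c * A ^ (l - c)" "B ^ l = B ^ c * B ^ (l - c)" using c by (simp_all flip: power_add)
  have "norm (flow (A ^ l) (B ^ l) (\<lambda>i j. s $ i $ j) z)
     \<le> norm (A ^ l *\<^sub>R (s *v real_vec q - real_vec p)) + norm ((1 / B ^ l) *\<^sub>R real_vec q)"
    unfolding flow_def expand_eq unfolding z_def snd_conv by (rule norm_Pair_le)
  also have "\<dots> = A ^ l * norm (s *v real_vec q - real_vec p) + norm (real_vec q) / B ^ l"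
    using ApBp by simp
  also have "\<dots> \<le> A ^ l * (\<epsilon> / A ^ (l - c)) + B ^ (l - c) / B ^ l"
    using 1 2 ApBp unfolding T unfolding TB by (intro add_mono mult_left_mono divide_right_mono) auto
  also have "A ^ l * (\<epsilon> / A ^ (l - c)) = \<epsilon> * A ^ c" unfolding Al using ApBp by simp
  also have "B ^ (l - c) / B ^ l = 1 / B ^ c" unfolding Al using ApBp by simp
  finally have "norm (flow (A ^ l) (B ^ l) (\<lambda>i j. s $ i $ j) z) \<le> \<epsilon> * A ^ c + 1 / B ^ c" .
  moreover have "z \<in> Zlat"
    by (auto simp: Zlat_def z_def Basis_prod_def Basis_vec_def inner_axis real_vec_def)
  moreover have "z \<noteq> 0" using 2(1) by (auto simp: z_def prod_eq_iff)
  ultimately show thesis using that by blast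
qed

text \<open>Replacing a point by the corner of its cell changes the lattice at time l by a unipotent
  map with entries at most \<open>radius\<close>, hence of norm at most 2.\<close>

lemma norm_lattice_at_le:
  fixes s :: "'m::finite \<Rightarrow> 'n::finite \<Rightarrow> real"
  assumes AB: "0 < A" "0 < B" "A * B = real L" and L: "0 < L" and y: "\<And>x. 0 \<le> y x \<and> y x < 1"
  shows "norm (lattice_at A B L s l (digit_index L y l) z) \<le> 2 * norm (flow (A ^ l) (B ^ l) (\<lambda>i j. s i j + point y i j) z)"
proof -
  let ?J = "digit_index L y l" and ?\<rho> = "radius CARD('m) CARD('n)"
  have mn: "0 < CARD('m)" "0 < CARD('n)" by auto
  define t where "t i j = real L ^ l * (point (\<lambda>x. real (?J x) / real L ^ l) i j - point y i j)" for i :: 'm and j :: 'n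
  have pw: "A ^ l * B ^ l = real L ^ l" by (simp add: AB(3) power_mult_distrib[symmetric])
  have Ll: "0 < real L ^ l" using L by simp
  have "\<bar>t i j\<bar> \<le> ?\<rho>" for i j
  proof -
    have "t i j = ?\<rho> * (real (?J (i, j)) - y (i, j) * real L ^ l)"
      using Ll by (simp add: t_def point_def algebra_simps)
    moreover have "\<bar>real (?J (i, j)) - y (i, j) * real L ^ l\<bar> \<le> 1"
      using digit_index_props(2,3)[where y = y and L = L and N = l and x = "(i, j)", OF y L] by linarith
    ultimately show ?thesis
      using radius_pos[OF mn] mult_left_mono[of "\<bar>real (?J (i, j)) - y (i, j) * real L ^ l\<bar>" 1 ?\<rho>]
      by (simp add: abs_mult)
  qed
  then have "norm (flow 1 1 t (flow (A ^ l) (B ^ l) (\<lambda>i j. s i j + point y i j) z))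
     \<le> 2 * norm (flow (A ^ l) (B ^ l) (\<lambda>i j. s i j + point y i j) z)"
    by (intro norm_unipotent_le[of t ?\<rho>] radius_le[OF mn])
  moreover have "flow 1 1 t (flow (A ^ l) (B ^ l) (\<lambda>i j. s i j + point y i j) z) = lattice_at A B L s l ?J z"
    using AB Ll by (simp add: flow_comp pw lattice_at_def t_def)
  ultimately show ?thesis by simp
qed

text \<open>A cell in the cusp contributes 1/\<Lambda> to the weight, any other cell 1/Cn. The
  weighted total of \<open>G\<close> stays bounded, while a point that is singular on average meets
  the second kind so rarely that its cells eventually have weight at least \<tau>^N. Hence the cells
  of such weight number at most G0 / \<tau>^N.\<close>

lemma exceptional_cells:
  fixes s :: "'m::finite \<Rightarrow> 'n::finite \<Rightarrow> real" and D :: real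
  assumes D: "real CARD('m) * real CARD('n) - real CARD('m) * real CARD('n) / (real CARD('m) + real CARD('n)) < D"
  obtains L \<tau> G0 E where "2 \<le> L" "0 < \<tau>" "1 < \<tau> * real L powr D"
    "\<And>N. E N \<subseteq> digits (L ^ N)" "\<And>N. real (card (E N)) * \<tau> ^ N \<le> G0"
    "\<And>y. (\<And>x. 0 \<le> y x \<and> y x < 1) \<Longrightarrow> singular_on_average (\<chi> i j. s i j + point y i j) \<Longrightarrow>
       eventually (\<lambda>N. digit_index L y N \<in> E N) sequentially"
proof -
  let ?m = "CARD('m)" and ?n = "CARD('n)"
  have mn: "0 < ?m" "0 < ?n" by auto
  obtain \<eta> where \<eta>: "0 < \<eta>" "\<eta> < 1"
    and kex: "\<And>C. 0 < C \<Longrightarrow> \<exists>k\<ge>1. C * (real (2 ^ ((?m + ?n) * k)) ^ (?m * ?n) * (((2 ^ (?n * k)) ^ ?m) powr - (1 - \<eta>)))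
       < real (2 ^ ((?m + ?n) * k)) powr D"
    using exponent_choice[OF mn D] by blast
  obtain C where C: "0 < C"
    and contr: "\<And>L A B. 0 < L \<Longrightarrow> 1 \<le> A \<Longrightarrow> 1 \<le> B \<Longrightarrow> A * B = real L \<Longrightarrow> A ^ ?m = B ^ ?n \<Longrightarrow>
      \<exists>\<kappa> R. 0 \<le> R \<and> (\<forall>h :: (real ^ 'm) \<times> (real ^ 'n) \<Rightarrow> (real ^ 'm) \<times> (real ^ 'n). good h \<longrightarrow>
        (\<forall>j\<in>digits L. covol_height \<eta> \<kappa> (flow A B (point (corner L j)) \<circ> h) \<le> R * covol_height \<eta> \<kappa> h) \<and>
        (1 \<le> covol_height \<eta> \<kappa> h \<longrightarrow> (\<Sum>j\<in>digits L. covol_height \<eta> \<kappa> (flow A B (point (corner L j)) \<circ> h))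
           \<le> C * (real L ^ (?m * ?n) * (A ^ ?m) powr - (1 - \<eta>)) * covol_height \<eta> \<kappa> h))"
    by (rule covol_height_contraction[where ?'m = 'm and ?'n = 'n, OF \<eta>]) blast
  \<comment> \<open>The factor 2 in front of \<open>C\<close> is reserved for the constant added to
    the height in \<open>G\<close>.\<close>
  obtain k where k: "1 \<le> k" "2 * C * (real (2 ^ ((?m + ?n) * k)) ^ (?m * ?n) * (((2 ^ (?n * k)) ^ ?m) powr - (1 - \<eta>)))
       < real (2 ^ ((?m + ?n) * k)) powr D"
    using kex[of "2 * C"] C by auto
  define L :: nat where "L = 2 ^ ((?m + ?n) * k)"
  define A :: real where "A = 2 ^ (?n * k)"
  define B :: real where "B = 2 ^ (?m * k)"
  have L2: "2 \<le> L"
  proof -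
    have "1 \<le> (?m + ?n) * k" using k(1) mn by (simp add: Suc_le_eq)
    then have "(2 :: nat) ^ 1 \<le> 2 ^ ((?m + ?n) * k)" by (intro power_increasing) auto
    then show ?thesis by (simp add: L_def)
  qed
  then have L0: "0 < L" by simp
  have AB1: "1 \<le> A" "1 \<le> B" by (simp_all add: A_def B_def)
  have AB: "A * B = real L" by (simp add: A_def B_def L_def power_add[symmetric] algebra_simps)
  have AmBn: "A ^ ?m = B ^ ?n" by (simp add: A_def B_def power_mult[symmetric] mult_ac)
  have AB0: "0 < A" "0 < B" "A \<noteq> 0" "B \<noteq> 0" using AB1 by auto
  obtain \<kappa> R where R: "0 \<le> R"
    and crude: "\<And>(h :: (real ^ 'm) \<times> (real ^ 'n) \<Rightarrow> (real ^ 'm) \<times> (real ^ 'n)) j. good h \<Longrightarrow> j \<in> digits L \<Longrightarrow>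
       covol_height \<eta> \<kappa> (flow A B (point (corner L j)) \<circ> h) \<le> R * covol_height \<eta> \<kappa> h"
    and main: "\<And>h :: (real ^ 'm) \<times> (real ^ 'n) \<Rightarrow> (real ^ 'm) \<times> (real ^ 'n). good h \<Longrightarrow> 1 \<le> covol_height \<eta> \<kappa> h \<Longrightarrow>
       (\<Sum>j\<in>digits L. covol_height \<eta> \<kappa> (flow A B (point (corner L j)) \<circ> h))
           \<le> C * (real L ^ (?m * ?n) * (A ^ ?m) powr - (1 - \<eta>)) * covol_height \<eta> \<kappa> h"
    using contr[OF L0 AB1 AB AmBn] by blast
  define X where "X = real L ^ (?m * ?n) * (A ^ ?m) powr - (1 - \<eta>)"
  have X: "0 < X" using L0 AB0 by (simp add: X_def)
  define \<Lambda> where "\<Lambda> = 2 * C * X"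
  have \<Lambda>: "0 < \<Lambda>" using C X by (simp add: \<Lambda>_def)
  have \<Lambda>D: "\<Lambda> < real L powr D" using k(2) by (simp add: \<Lambda>_def X_def L_def A_def)
  \<comment> \<open>When the height f of a cell is at least \<open>M\<close>, the constants added in
    its L^(mn) children sum to at most C X f, so the children total at most \<Lambda> f.\<close>
  define M where "M = max 1 (real L ^ (?m * ?n) / (C * X))"
  define Cn where "Cn = max \<Lambda> (real L ^ (?m * ?n) * (R + 1))"
  have Cn: "\<Lambda> \<le> Cn" "0 < Cn" using \<Lambda> by (auto simp: Cn_def)
  define f where "f N J = covol_height \<eta> \<kappa> (lattice_at A B L s N J)" for N J
  have goodl: "good (lattice_at A B L s N J)" for N J by (rule good_lattice_at[OF AB0(1,2) AmBn])
  have f0: "0 \<le> f N J" for N J unfolding f_def covol_height_def by (intro sum_nonneg) simp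
  define \<kappa>' where "\<kappa>' N J = (if M \<le> f N J then 1 / \<Lambda> else 1 / Cn)" for N J
  have \<kappa>'0: "0 \<le> \<kappa>' N J" for N J using \<Lambda> Cn by (simp add: \<kappa>'_def)
  \<comment> \<open>The added 1 makes every cell count at least 1, so that the weighted total bounds
    a number of cells.\<close>
  define G where "G N J = f N J + 1" for N J
  have G1: "1 \<le> G N J" for N J using f0 by (simp add: G_def)
  have step: "\<kappa>' N J * (\<Sum>j\<in>digits L. G (Suc N) (\<lambda>x. L * J x + j x)) \<le> G N J" for N J
  proof -
    have fs: "f (Suc N) (\<lambda>x. L * J x + j x) = covol_height \<eta> \<kappa> (flow A B (point (corner L j)) \<circ> lattice_at A B L s N J)" for j
      unfolding f_def by (simp only: lattice_at_Suc[OF AB0(3,4) AB L0])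
    have Gsum: "(\<Sum>j\<in>digits L. G (Suc N) (\<lambda>x. L * J x + j x))
       = (\<Sum>j\<in>digits L. f (Suc N) (\<lambda>x. L * J x + j x)) + real L ^ (?m * ?n)"
      by (simp add: G_def sum.distrib card_digits)
    show ?thesis
    proof (cases "M \<le> f N J")
      case True
      then have "1 \<le> f N J" "real L ^ (?m * ?n) / (C * X) \<le> f N J" by (auto simp: M_def)
      then have "(\<Sum>j\<in>digits L. f (Suc N) (\<lambda>x. L * J x + j x)) \<le> C * X * f N J" "real L ^ (?m * ?n) \<le> C * X * f N J"
        unfolding fs using main[OF goodl, of N J, folded X_def] C X by (simp_all add: f_def divide_le_eq mult.commute)
      then have "(\<Sum>j\<in>digits L. G (Suc N) (\<lambda>x. L * J x + j x)) \<le> \<Lambda> * f N J" unfolding Gsum by (simp add: \<Lambda>_def)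
      also have "\<dots> \<le> \<Lambda> * G N J" using \<Lambda> by (simp add: G_def)
      finally show ?thesis using True \<Lambda> by (simp add: \<kappa>'_def divide_le_eq mult.commute)
    next
      case False
      have "(\<Sum>j\<in>digits L. f (Suc N) (\<lambda>x. L * J x + j x)) \<le> (\<Sum>j\<in>(digits L :: ('m \<times> 'n \<Rightarrow> nat) set). R * f N J)"
      proof (rule sum_mono)
        fix j assume j: "j \<in> (digits L :: ('m \<times> 'n \<Rightarrow> nat) set)"
        show "f (Suc N) (\<lambda>x. L * J x + j x) \<le> R * f N J"
          using crude[OF goodl j, of N J] unfolding fs by (simp only: f_def)
      qed
      also have "\<dots> = real L ^ (?m * ?n) * (R * f N J)" by (simp add: card_digits)
      finally have "(\<Sum>j\<in>digits L. G (Suc N) (\<lambda>x. L * J x + j x)) \<le> real L ^ (?m * ?n) * (R * f N J + 1)"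
        unfolding Gsum by (simp add: algebra_simps)
      also have "\<dots> \<le> real L ^ (?m * ?n) * ((R + 1) * G N J)"
        using R f0[of N J] by (intro mult_left_mono) (simp_all add: G_def algebra_simps)
      also have "\<dots> \<le> Cn * G N J"
        using G1[of N J] mult_right_mono[of "real L ^ (?m * ?n) * (R + 1)" Cn "G N J"] by (simp add: Cn_def mult.assoc)
      finally show ?thesis using False Cn by (simp add: \<kappa>'_def divide_le_eq mult.commute)
    qed
  qed
  have total: "(\<Sum>J\<in>digits (L ^ N). wt L \<kappa>' N J * G N J) \<le> G 0 (\<lambda>_. 0)" for N
    by (rule sum_wt_le[where \<kappa> = \<kappa>' and G = G, OF L0 \<kappa>'0 step])
  have "inverse (real L powr D) < 1 / \<Lambda>"
    using \<Lambda> \<Lambda>D less_imp_inverse_less[OF \<Lambda>D \<Lambda>] by (simp add: inverse_eq_divide)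
  \<comment> \<open>The lower bound will make the cover summable for the exponent \<open>D\<close>;
    the upper bound leaves a margin for the bad steps.\<close>
  then obtain \<tau> where \<tau>: "inverse (real L powr D) < \<tau>" "\<tau> < 1 / \<Lambda>" using dense by blast
  have LD: "0 < real L powr D" using L0 by simp
  have \<tau>0: "0 < \<tau>" using \<tau>(1) LD by (meson inverse_positive_iff_positive less_trans)
  have \<tau>LD: "1 < \<tau> * real L powr D"
    using mult_strict_right_mono[OF \<tau>(1) LD] LD by simp
  define E where "E N = {J \<in> digits (L ^ N). \<tau> ^ N \<le> wt L \<kappa>' N J}" for N
  have card: "real (card (E N)) * \<tau> ^ N \<le> G 0 (\<lambda>_. 0)" for N
  proof -
    have "real (card (E N)) * \<tau> ^ N = (\<Sum>J\<in>E N. \<tau> ^ N * 1)" by simp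
    also have "\<dots> \<le> (\<Sum>J\<in>E N. wt L \<kappa>' N J * G N J)"
      using \<tau>0 G1 wt_nonneg[OF \<kappa>'0] by (intro sum_mono mult_mono) (auto simp: E_def)
    also have "\<dots> \<le> (\<Sum>J\<in>digits (L ^ N). wt L \<kappa>' N J * G N J)"
      by (intro sum_mono2 mult_nonneg_nonneg wt_nonneg \<kappa>'0 order_trans[OF zero_le_one G1]) (auto simp: E_def)
    finally show ?thesis using total by (rule order_trans)
  qed
  have "1 \<le> M" by (simp add: M_def)
  then obtain \<epsilon>0 where \<epsilon>0: "0 < \<epsilon>0"
    "\<And>(h :: (real ^ 'm) \<times> (real ^ 'n) \<Rightarrow> (real ^ 'm) \<times> (real ^ 'n)) z. good h \<Longrightarrow> z \<in> Zlat \<Longrightarrow> z \<noteq> 0 \<Longrightarrow>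
       norm (h z) \<le> \<epsilon>0 \<Longrightarrow> M \<le> covol_height \<eta> \<kappa> h"
    using covol_height_large[OF \<eta>, where \<kappa> = \<kappa>] by blast
  have B2: "2 \<le> B"
  proof -
    have "1 \<le> ?m * k" using k(1) mn by (simp add: Suc_le_eq)
    then have "(2 :: real) ^ 1 \<le> 2 ^ (?m * k)" by (intro power_increasing) auto
    then show ?thesis by (simp add: B_def)
  qed
  \<comment> \<open>First c is chosen for the second component, then \<epsilon> for the first. Each
    gets a quarter, because the two are added and the passage to the corner costs a factor
    2.\<close>
  obtain c where c: "1 / B ^ c \<le> \<epsilon>0 / 4"
  proof -
    have "\<exists>c. (1 / B) ^ c < \<epsilon>0 / 4" using B2 \<epsilon>0(1) by (intro real_arch_pow_inv) auto
    then obtain c where "(1 / B) ^ c < \<epsilon>0 / 4" by blast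
    then show thesis by (intro that[of c]) (simp add: power_one_over)
  qed
  define \<epsilon> where "\<epsilon> = \<epsilon>0 / (4 * A ^ c)"
  have \<epsilon>: "0 < \<epsilon>" "\<epsilon> * A ^ c = \<epsilon>0 / 4" using \<epsilon>0(1) AB0 by (simp_all add: \<epsilon>_def)
  have ev: "eventually (\<lambda>N. digit_index L y N \<in> E N) sequentially"
    if y: "\<And>x. 0 \<le> y x \<and> y x < 1" and sing: "singular_on_average (\<chi> i j. s i j + point y i j)" for y
  proof -
    let ?s = "(\<chi> i j. s i j + point y i j) :: real ^ 'n ^ 'm"
    have hit: "M \<le> f l (digit_index L y l)" if l: "c < l" "approximable ?s \<epsilon> (2 ^ (?m * k * (l - c)))" for l
    proof -
      obtain z where z: "z \<in> Zlat" "z \<noteq> 0"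
        "norm (flow (A ^ l) (B ^ l) (\<lambda>i j. ?s $ i $ j) z) \<le> \<epsilon> * A ^ c + 1 / B ^ c"
        using approximable_short_vector[OF A_def B_def l] by blast
      have "norm (lattice_at A B L s l (digit_index L y l) z) \<le> 2 * norm (flow (A ^ l) (B ^ l) (\<lambda>i j. s i j + point y i j) z)"
        by (rule norm_lattice_at_le[where y = y, OF AB0(1,2) AB L0 y])
      also have "\<dots> \<le> 2 * (\<epsilon>0 / 4 + \<epsilon>0 / 4)" using z(3) c \<epsilon>(2) by simp
      finally show ?thesis unfolding f_def using \<epsilon>0 by (intro \<epsilon>0(2)[OF goodl z(1,2)]) simp
    qed
    define b where "b N = card {l. l < N \<and> \<not> (c < l \<and> approximable ?s \<epsilon> (2 ^ (?m * k * (l - c))))}" for N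
    have p1: "1 \<le> ?m * k" using k(1) mn by (simp add: Suc_le_eq)
    have blim: "(\<lambda>N. real (b N) / real N) \<longlonglongrightarrow> 0"
      unfolding b_def by (rule bad_density[OF sing \<epsilon>(1) p1])
    \<comment> \<open>\<open>r\<close> is the margin gained at every step and \<open>q\<close> the
      loss at a bad one. The threshold for the density below is divided by \<open>ln q + 1\<close>,
      which is positive even when \<open>q\<close> is 1.\<close>
    define r where "r = 1 / (\<Lambda> * \<tau>)"
    define q where "q = Cn / \<Lambda>"
    have r: "1 < r" using \<tau> \<Lambda> \<tau>0 by (simp add: r_def field_simps)
    have q: "1 \<le> q" using Cn \<Lambda> by (simp add: q_def)
    have lnr: "0 < ln r" using r by simp
    have lnq: "0 \<le> ln q" using q by simp
    have "eventually (\<lambda>N. real (b N) / real N < ln r / (ln q + 1)) sequentially"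
      using lnr lnq by (intro order_tendstoD(2)[OF blim]) simp
    then show ?thesis
      using eventually_gt_at_top[of 0]
    proof eventually_elim
      case (elim N)
      have "real (b N) * ln q \<le> real N * ln r"
      proof -
        have "real (b N) * (ln q + 1) < real N * ln r"
          using elim lnq by (simp add: field_simps)
        moreover have "real (b N) * ln q \<le> real (b N) * (ln q + 1)" by (intro mult_left_mono) auto
        ultimately show ?thesis by linarith
      qed
      then have "ln (q ^ b N) \<le> ln (r ^ N)" using q r by (simp add: ln_realpow)
      then have qr: "q ^ b N \<le> r ^ N" using q r by (subst (asm) ln_le_cancel_iff) auto
      define W where "W = {l. l < N \<and> \<not> (c < l \<and> approximable ?s \<epsilon> (2 ^ (?m * k * (l - c))))}"
      have "(1 / \<Lambda>) ^ N * (1 / q) ^ b N = (\<Prod>l<N. (1 / \<Lambda>) * (if l \<in> W then 1 / q else 1))"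
      proof -
        have "(\<Prod>l<N. if l \<in> W then 1 / q else 1) = (1 / q) ^ card ({..<N} \<inter> W)"
          by (simp add: prod.If_cases)
        moreover have "{..<N} \<inter> W = W" by (auto simp: W_def)
        moreover have "b N = card W" by (simp only: b_def W_def)
        ultimately show ?thesis by (simp only: prod.distrib prod_constant card_lessThan)
      qed
      also have "\<dots> \<le> (\<Prod>l<N. \<kappa>' l (digit_index L y l))"
      proof (intro prod_mono conjI)
        fix l assume l: "l \<in> {..<N}"
        show "0 \<le> 1 / \<Lambda> * (if l \<in> W then 1 / q else 1)" using \<Lambda> q by simp
        have Cq: "1 / \<Lambda> * (1 / q) = 1 / Cn" using \<Lambda> Cn by (simp add: q_def)
        have C\<Lambda>: "1 / Cn \<le> 1 / \<Lambda>" using \<Lambda> Cn by (intro divide_left_mono) auto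
        show "1 / \<Lambda> * (if l \<in> W then 1 / q else 1) \<le> \<kappa>' l (digit_index L y l)"
        proof (cases "l \<in> W")
          case True
          then show ?thesis using Cq C\<Lambda> by (simp add: \<kappa>'_def)
        next
          case False
          then have "M \<le> f l (digit_index L y l)" using l by (intro hit) (auto simp: W_def)
          then show ?thesis using False by (simp add: \<kappa>'_def)
        qed
      qed
      also have "\<dots> = wt L \<kappa>' N (digit_index L y N)" by (rule wt_digit_index[where y = y, OF y L0, symmetric])
      finally have "(1 / \<Lambda>) ^ N * (1 / q) ^ b N \<le> wt L \<kappa>' N (digit_index L y N)" .
      moreover have "\<tau> ^ N \<le> (1 / \<Lambda>) ^ N * (1 / q) ^ b N"
      proof -
        have "\<tau> ^ N * q ^ b N \<le> \<tau> ^ N * r ^ N" using qr \<tau>0 by (intro mult_left_mono) auto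
        also have "\<dots> = (1 / \<Lambda>) ^ N" using \<tau>0 by (simp add: r_def power_mult_distrib[symmetric])
        finally have "\<tau> ^ N \<le> (1 / \<Lambda>) ^ N / q ^ b N"
          using q by (subst pos_le_divide_eq) simp_all
        then show ?thesis by (simp only: power_one_over[of q] times_divide_eq_right mult_1_right)
      qed
      moreover have "digit_index L y N \<in> digits (L ^ N)" by (rule digit_index_props(1)[where y = y, OF y L0])
      ultimately show ?case by (simp add: E_def)
    qed
  qed
  show thesis
    by (rule that[of L \<tau> E "G 0 (\<lambda>_. 0)", OF L2 \<tau>0 \<tau>LD _ card ev]) (auto simp: E_def)
qed

section \<open>Hausdorff dimension\<close>

lemma hausdorff_content_le:
  assumes "A \<subseteq> (\<Union>i. U i)" "\<And>i :: nat. bounded (U i) \<and> diameter (U i) \<le> \<delta>"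
  shows "hausdorff_content d \<delta> A \<le> (\<Sum>i. ennreal (hausdorff_weight d (U i)))"
  unfolding hausdorff_content_def using assms by (intro Inf_lower) blast

lemma hausdorff_content_single:
  assumes "bounded A" "diameter A \<le> \<delta>" "0 \<le> \<delta>"
  shows "hausdorff_content d \<delta> A \<le> ennreal (hausdorff_weight d A)"
proof -
  let ?U = "\<lambda>i :: nat. if i = 0 then A else {}"
  have "hausdorff_content d \<delta> A \<le> (\<Sum>i. ennreal (hausdorff_weight d (?U i)))"
    using assms by (intro hausdorff_content_le) (auto split: if_splits)
  also have "\<dots> = (\<Sum>i\<in>{0}. ennreal (hausdorff_weight d (?U i)))"
    by (rule suminf_finite) (auto simp: hausdorff_weight_def)
  finally show ?thesis by simp
qed

lemma hausdorff_content_mono: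
  "A \<subseteq> B \<Longrightarrow> hausdorff_content d \<delta> A \<le> hausdorff_content d \<delta> B"
  unfolding hausdorff_content_def by (rule Inf_superset_mono) blast

lemma hausdorff_content_empty: "0 \<le> \<delta> \<Longrightarrow> hausdorff_content d \<delta> {} = 0"
  using hausdorff_content_single[of "{}" \<delta> d] by (simp add: hausdorff_weight_def)

text \<open>Almost optimal covers, the i-th one with error e / 2^(i+1), are merged into one sequence
  by an enumeration of pairs.\<close>

lemma hausdorff_content_UN:
  fixes A :: "nat \<Rightarrow> 'a::metric_space set"
  shows "hausdorff_content d \<delta> (\<Union>i. A i) \<le> (\<Sum>i. hausdorff_content d \<delta> (A i))"
proof (rule ennreal_le_epsilon)
  fix e :: real assume fin: "(\<Sum>i. hausdorff_content d \<delta> (A i)) < \<top>" and e: "0 < e"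
  have finA: "hausdorff_content d \<delta> (A i) < \<top>" for i
  proof -
    have "(\<Sum>i\<in>{i}. hausdorff_content d \<delta> (A i)) \<le> (\<Sum>i. hausdorff_content d \<delta> (A i))"
      by (rule sum_le_suminf) auto
    then show ?thesis using fin by simp
  qed
  have "\<exists>U :: nat \<Rightarrow> 'a set. A i \<subseteq> (\<Union>k. U k) \<and> (\<forall>k. bounded (U k) \<and> diameter (U k) \<le> \<delta>) \<and>
     (\<Sum>k. ennreal (hausdorff_weight d (U k))) \<le> hausdorff_content d \<delta> (A i) + ennreal (e * (1 / 2) ^ Suc i)" for i
  proof -
    have "0 < ennreal (e * (1 / 2) ^ Suc i)" using e by simp
    then have "hausdorff_content d \<delta> (A i) < hausdorff_content d \<delta> (A i) + ennreal (e * (1 / 2) ^ Suc i)"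
      using finA[of i] by (simp add: ennreal_add_left_cancel_less[of _ 0, simplified] less_top)
    then have "\<exists>x\<in>{(\<Sum>i. ennreal (hausdorff_weight d (U i))) | U :: nat \<Rightarrow> 'a set.
            A i \<subseteq> (\<Union>i. U i) \<and> (\<forall>i. bounded (U i) \<and> diameter (U i) \<le> \<delta>)}. x < hausdorff_content d \<delta> (A i) + ennreal (e * (1 / 2) ^ Suc i)"
      unfolding hausdorff_content_def[of d \<delta> "A i"] by (simp only: Inf_less_iff)
    then show ?thesis by (auto intro: less_imp_le)
  qed
  then obtain U where U: "\<And>i. A i \<subseteq> (\<Union>k. U i k)" "\<And>i k. bounded (U i k) \<and> diameter (U i k) \<le> \<delta>"
    "\<And>i. (\<Sum>k. ennreal (hausdorff_weight d (U i k))) \<le> hausdorff_content d \<delta> (A i) + ennreal (e * (1 / 2) ^ Suc i)"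
    by metis
  define V where "V n = (case prod_decode n of (i, k) \<Rightarrow> U i k)" for n
  have "hausdorff_content d \<delta> (\<Union>i. A i) \<le> (\<Sum>n. ennreal (hausdorff_weight d (V n)))"
  proof (rule hausdorff_content_le)
    show "(\<Union>i. A i) \<subseteq> (\<Union>n. V n)"
    proof
      fix x assume "x \<in> (\<Union>i. A i)"
      then obtain i k where "x \<in> U i k" using U(1) by blast
      then have "x \<in> V (prod_encode (i, k))" by (simp add: V_def)
      then show "x \<in> (\<Union>n. V n)" by blast
    qed
    show "bounded (V n) \<and> diameter (V n) \<le> \<delta>" for n
      using U(2) by (simp add: V_def split: prod.split)
  qed
  also have "\<dots> = (\<Sum>i. \<Sum>k. ennreal (hausdorff_weight d (U i k)))"
  proof -
    have "(\<Sum>n. ennreal (hausdorff_weight d (V n))) = (\<integral>\<^sup>+ n. ennreal (hausdorff_weight d (V n)) \<partial>count_space UNIV)"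
      by (simp add: nn_integral_count_space_nat)
    also have "\<dots> = (\<integral>\<^sup>+ p. ennreal (hausdorff_weight d (case p of (i, k) \<Rightarrow> U i k)) \<partial>count_space UNIV)"
      unfolding V_def by (rule nn_integral_bij_count_space[OF bij_prod_decode])
    also have "\<dots> = (\<integral>\<^sup>+ i. \<integral>\<^sup>+ k. ennreal (hausdorff_weight d (U i k)) \<partial>count_space UNIV \<partial>count_space UNIV)"
      by (subst nn_integral_fst_count_space[symmetric]) simp
    finally show ?thesis by (simp add: nn_integral_count_space_nat)
  qed
  also have "\<dots> \<le> (\<Sum>i. hausdorff_content d \<delta> (A i) + ennreal (e * (1 / 2) ^ Suc i))"
    by (intro suminf_le U(3)) auto
  also have "\<dots> = (\<Sum>i. hausdorff_content d \<delta> (A i)) + (\<Sum>i. ennreal (e * (1 / 2) ^ Suc i))"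
    by (rule suminf_add[symmetric]) auto
  also have "(\<Sum>i. ennreal (e * (1 / 2) ^ Suc i)) = ennreal e"
  proof -
    have "(\<lambda>i. e * (1 / 2) ^ Suc i) sums (e * 1)" by (intro sums_mult power_half_series)
    then show ?thesis using e by (intro suminf_ennreal_eq) auto
  qed
  finally show "hausdorff_content d \<delta> (\<Union>i. A i) \<le> (\<Sum>i. hausdorff_content d \<delta> (A i)) + ennreal e" .
qed

text \<open>Two sets at a time, padded to a sequence by empty sets, whose content is 0.\<close>

lemma hausdorff_content_finite_UN:
  assumes "finite E" "0 \<le> \<delta>"
  shows "hausdorff_content d \<delta> (\<Union>J\<in>E. A J) \<le> (\<Sum>J\<in>E. hausdorff_content d \<delta> (A J))"
  using assms(1)
proof (induction E rule: finite_induct)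
  case empty
  then show ?case using assms(2) by (simp add: hausdorff_content_empty)
next
  case (insert J E)
  let ?B = "\<Union>J\<in>E. A J"
  let ?U = "\<lambda>i :: nat. if i = 0 then A J else if i = 1 then ?B else {}"
  have "(\<Union>J\<in>insert J E. A J) = (\<Union>i. ?U i)"
  proof -
    have "A J = ?U 0" "?B = ?U 1" by simp_all
    then have "A J \<union> ?B \<subseteq> (\<Union>i. ?U i)" by blast
    moreover have "(\<Union>i. ?U i) \<subseteq> A J \<union> ?B" by (auto split: if_splits)
    ultimately show ?thesis by auto
  qed
  then have "hausdorff_content d \<delta> (\<Union>J\<in>insert J E. A J) \<le> (\<Sum>i. hausdorff_content d \<delta> (?U i))"
    using hausdorff_content_UN[of d \<delta> ?U] by simp
  also have "\<dots> = (\<Sum>i\<in>{0, 1}. hausdorff_content d \<delta> (?U i))"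
    by (rule suminf_finite) (auto simp: hausdorff_content_empty[OF assms(2)])
  also have "\<dots> = hausdorff_content d \<delta> (A J) + hausdorff_content d \<delta> ?B" by simp
  finally show ?case using insert by (simp add: add_left_mono order_trans)
qed

lemma hausdorff_dim_le:
  assumes "0 \<le> d" "\<And>\<delta>. 0 < \<delta> \<Longrightarrow> hausdorff_content d \<delta> A = 0"
  shows "hausdorff_dim A \<le> ereal d"
proof -
  have "hausdorff_measure d A = 0"
    unfolding hausdorff_measure_def using assms(2) by (auto intro!: SUP_eq_const)
  then show ?thesis unfolding hausdorff_dim_def using assms(1) by (intro Inf_lower) auto
qed


lemma norm_matrix_le:
  fixes u :: "real ^ 'n::finite ^ 'm::finite"
  assumes "\<And>i j. \<bar>u $ i $ j\<bar> \<le> r"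
  shows "norm u \<le> real CARD('m) * real CARD('n) * r"
proof -
  have rows: "norm (u $ i) \<le> (\<Sum>j\<in>(UNIV :: 'n set). r)" for i
    using assms by (intro order_trans[OF norm_le_l1_cart] sum_mono) auto
  have "norm u \<le> (\<Sum>i\<in>UNIV. norm (u $ i))"
    unfolding norm_vec_def[of u] by (rule L2_set_le_sum) simp
  also have "\<dots> \<le> (\<Sum>i\<in>(UNIV :: 'm set). \<Sum>j\<in>(UNIV :: 'n set). r)"
    by (intro sum_mono rows)
  finally show ?thesis by simp
qed

text \<open>A point whose cells are eventually exceptional lies in an exceptional cell at some level
  beyond any given \<open>N0\<close>. The exceptional cells of level N have total weight at most
  \<open>G0 * r ^ N\<close>, where \<open>r\<close> is the inverse of
  \<open>\<tau> * real L powr D\<close>; so all levels from \<open>N0\<close> on together form a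
  cover whose weight is the tail of a convergent geometric series.\<close>

lemma root_cell_content:
  fixes s :: "'m::finite \<Rightarrow> 'n::finite \<Rightarrow> real" and D :: real
  assumes D: "real CARD('m) * real CARD('n) - real CARD('m) * real CARD('n) / (real CARD('m) + real CARD('n)) < D"
    and D0: "0 < D" and \<delta>: "0 < \<delta>"
  shows "hausdorff_content D \<delta> {(\<chi> i j. s i j + point y i j) | y. (\<forall>x. 0 \<le> y x \<and> y x < 1) \<and>
     singular_on_average (\<chi> i j. s i j + point y i j)} = 0" (is "hausdorff_content D \<delta> ?S = 0")
proof -
  have mn: "0 < CARD('m)" "0 < CARD('n)" by auto
  obtain L \<tau> G0 and E :: "nat \<Rightarrow> ('m \<times> 'n \<Rightarrow> nat) set" where E: "2 \<le> L" "0 < \<tau>" "1 < \<tau> * real L powr D"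
    "\<And>N. E N \<subseteq> digits (L ^ N)" "\<And>N. real (card (E N)) * \<tau> ^ N \<le> G0"
    "\<And>y. (\<And>x. 0 \<le> y x \<and> y x < 1) \<Longrightarrow> singular_on_average (\<chi> i j. s i j + point y i j) \<Longrightarrow>
       eventually (\<lambda>N. digit_index L y N \<in> E N) sequentially"
    by (rule exceptional_cells[OF D, of s]) blast
  have L0: "0 < L" using E(1) by simp
  define cell where "cell N J = {(\<chi> i j. s i j + point y i j) :: real ^ 'n ^ 'm | y.
     \<forall>x. real (J x) \<le> y x * real L ^ N \<and> y x * real L ^ N < real (J x) + 1}" for N J
  define q where "q = 1 / real L powr D"
  define r where "r = q / \<tau>"
  have q0: "0 < q" using L0 by (simp add: q_def)
  have r: "0 < r" "r < 1" using E(2,3) L0 by (simp_all add: r_def q_def field_simps)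
  \<comment> \<open>A cell has side \<open>radius\<close> / L^N, and \<open>radius_le\<close> makes
    mn times the radius at most 1.\<close>
  have dist: "norm (u - v) \<le> (1 / real L) ^ N" if uv: "u \<in> cell N J" "v \<in> cell N J" for u v N J
  proof -
    obtain y z where y: "u = (\<chi> i j. s i j + point y i j)" "\<And>x. real (J x) \<le> y x * real L ^ N \<and> y x * real L ^ N < real (J x) + 1"
      and z: "v = (\<chi> i j. s i j + point z i j)" "\<And>x. real (J x) \<le> z x * real L ^ N \<and> z x * real L ^ N < real (J x) + 1"
      using uv unfolding cell_def by blast
    have pL: "0 < real L ^ N" using L0 by simp
    have "\<bar>(u - v) $ i $ j\<bar> \<le> radius CARD('m) CARD('n) * (1 / real L) ^ N" for i j
    proof -
      have "\<bar>y (i, j) * real L ^ N - z (i, j) * real L ^ N\<bar> \<le> 1" using y(2)[of "(i, j)"] z(2)[of "(i, j)"] by linarith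
      moreover have "y (i, j) * real L ^ N - z (i, j) * real L ^ N = (y (i, j) - z (i, j)) * real L ^ N" by (simp add: algebra_simps)
      ultimately have "\<bar>y (i, j) - z (i, j)\<bar> * real L ^ N \<le> 1" by (simp add: abs_mult)
      then have "\<bar>y (i, j) - z (i, j)\<bar> \<le> (1 / real L) ^ N" using pL by (simp add: power_one_over field_simps)
      moreover have "(u - v) $ i $ j = radius CARD('m) CARD('n) * (y (i, j) - z (i, j))"
        by (simp add: y(1) z(1) point_def algebra_simps)
      ultimately show ?thesis using radius_pos[OF mn] by (simp add: abs_mult)
    qed
    from norm_matrix_le[OF this] have "norm (u - v) \<le> (real CARD('m) * real CARD('n) * radius CARD('m) CARD('n)) * (1 / real L) ^ N"
      by (simp add: mult.assoc)
    also have "\<dots> \<le> 1 * (1 / real L) ^ N" using radius_le[OF mn] by (intro mult_right_mono) auto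
    finally show ?thesis by simp
  qed
  have bdd: "bounded (cell N J)" for N J
  proof (cases "cell N J = {}")
    case False
    then obtain u where "u \<in> cell N J" by blast
    then show ?thesis
      unfolding bounded_def using dist by (intro exI[of _ u] exI[of _ "(1 / real L) ^ N"]) (auto simp: dist_norm)
  qed simp
  have diam: "diameter (cell N J) \<le> (1 / real L) ^ N" for N J
    using dist by (intro diameter_le) auto
  have weight: "hausdorff_weight D (cell N J) \<le> q ^ N" for N J
  proof (cases "cell N J = {}")
    case True
    then show ?thesis using q0 by (simp add: hausdorff_weight_def)
  next
    case False
    have "diameter (cell N J) powr D \<le> ((1 / real L) ^ N) powr D"
      using diam D0 bdd by (intro powr_mono2) (auto simp: diameter_ge_0)
    also have "\<dots> = q ^ N"
      using L0 by (simp add: q_def powr_realpow[symmetric] powr_powr powr_divide power_one_over mult.commute)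
    finally show ?thesis using False D0 by (simp add: hausdorff_weight_def)
  qed
  define K where "K = G0 / (1 - r)"
  have G0: "0 \<le> G0" using E(5)[of 0] by simp
  have bound: "hausdorff_content D \<delta> ?S \<le> ennreal (K * r ^ N0)" if N0: "(1 / real L) ^ N0 \<le> \<delta>" for N0
  proof -
    define B where "B i = (\<Union>J\<in>E (N0 + i). cell (N0 + i) J)" for i
    have "?S \<subseteq> (\<Union>i. B i)"
    proof
      fix u assume "u \<in> ?S"
      then obtain y where y: "u = (\<chi> i j. s i j + point y i j)" "\<And>x. 0 \<le> y x \<and> y x < 1" "singular_on_average u"
        by blast
      have "eventually (\<lambda>N. digit_index L y N \<in> E N) sequentially" using y by (intro E(6)) auto
      then obtain N1 where "\<And>N. N1 \<le> N \<Longrightarrow> digit_index L y N \<in> E N" by (auto simp: eventually_sequentially)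
      then have "digit_index L y (N0 + N1) \<in> E (N0 + N1)" by simp
      moreover have "u \<in> cell (N0 + N1) (digit_index L y (N0 + N1))"
        unfolding cell_def y(1)
        using digit_index_props(2,3)[where y = y and L = L, OF y(2) L0] by blast
      ultimately show "u \<in> (\<Union>i. B i)" unfolding B_def by blast
    qed
    then have "hausdorff_content D \<delta> ?S \<le> hausdorff_content D \<delta> (\<Union>i. B i)" by (rule hausdorff_content_mono)
    also have "\<dots> \<le> (\<Sum>i. hausdorff_content D \<delta> (B i))" by (rule hausdorff_content_UN)
    also have "\<dots> \<le> (\<Sum>i. ennreal (G0 * r ^ (N0 + i)))"
    proof (rule suminf_le)
      fix i
      let ?N = "N0 + i"
      have fin: "finite (E ?N)" using E(4) finite_digits finite_subset by blast
      have "(1 / real L) ^ ?N \<le> (1 / real L) ^ N0" using L0 by (intro power_decreasing) auto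
      then have d: "diameter (cell ?N J) \<le> \<delta>" for J using diam[of ?N J] N0 by linarith
      have "hausdorff_content D \<delta> (B i) \<le> (\<Sum>J\<in>E ?N. hausdorff_content D \<delta> (cell ?N J))"
        unfolding B_def using \<delta> by (intro hausdorff_content_finite_UN fin) simp
      also have "\<dots> \<le> (\<Sum>J\<in>E ?N. ennreal (q ^ ?N))"
        using d bdd \<delta> weight by (intro sum_mono order_trans[OF hausdorff_content_single] ennreal_leI) auto
      also have "\<dots> = ennreal (real (card (E ?N)) * q ^ ?N)" using q0 by (simp add: ennreal_mult ennreal_of_nat_eq_real_of_nat)
      also have "\<dots> \<le> ennreal (G0 * r ^ ?N)"
      proof (rule ennreal_leI)
        have "real (card (E ?N)) * q ^ ?N = (real (card (E ?N)) * \<tau> ^ ?N) * r ^ ?N"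
          using E(2) by (simp add: r_def power_divide)
        also have "\<dots> \<le> G0 * r ^ ?N" using E(5) r by (intro mult_right_mono) auto
        finally show "real (card (E ?N)) * q ^ ?N \<le> G0 * r ^ ?N" .
      qed
      finally show "hausdorff_content D \<delta> (B i) \<le> ennreal (G0 * r ^ ?N)" .
    qed auto
    also have "\<dots> = ennreal (K * r ^ N0)"
    proof (rule suminf_ennreal_eq)
      have "(\<lambda>i. (G0 * r ^ N0) * r ^ i) sums ((G0 * r ^ N0) * (1 / (1 - r)))"
        using r by (intro sums_mult geometric_sums) simp
      then show "(\<lambda>i. G0 * r ^ (N0 + i)) sums (K * r ^ N0)" by (simp add: K_def power_add mult_ac)
    qed (use G0 r in simp)
    finally show ?thesis .
  qed
  have "(\<lambda>N0. ennreal (K * r ^ N0)) \<longlonglongrightarrow> ennreal (K * 0)"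
    using r by (intro tendsto_ennrealI tendsto_mult tendsto_const LIMSEQ_realpow_zero) auto
  moreover have "eventually (\<lambda>N0. hausdorff_content D \<delta> ?S \<le> ennreal (K * r ^ N0)) sequentially"
  proof -
    have "(\<lambda>N. (1 / real L) ^ N) \<longlonglongrightarrow> 0" using E(1) by (intro LIMSEQ_realpow_zero) auto
    from order_tendstoD(2)[OF this \<delta>] show ?thesis
      by (rule eventually_mono) (rule bound, rule less_imp_le)
  qed
  ultimately have "hausdorff_content D \<delta> ?S \<le> ennreal (K * 0)"
    by (intro tendsto_lowerbound) auto
  then show ?thesis by simp
qed

text \<open>Countably many translates of the root cube cover the space of matrices, and
  \<open>root_cell_content\<close> applies to each, as its base point is arbitrary.\<close>

lemma singular_on_average_dim_le:
  assumes D: "real CARD('m::finite) * real CARD('n::finite) - real CARD('m) * real CARD('n) / (real CARD('m) + real CARD('n)) < D"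
    and S: "S \<subseteq> {s :: real ^ 'n ^ 'm. singular_on_average s}"
  shows "hausdorff_dim S \<le> ereal D"
proof -
  let ?\<rho> = "radius CARD('m) CARD('n)"
  have mn: "0 < CARD('m)" "0 < CARD('n)" by auto
  have \<rho>: "0 < ?\<rho>" by (rule radius_pos[OF mn])
  \<comment> \<open>This gives D > 0. For exponent 0 every nonempty cell would have weight 1,
    however small it is.\<close>
  have "0 \<le> real CARD('m) * real CARD('n) - real CARD('m) * real CARD('n) / (real CARD('m) + real CARD('n))"
  proof -
    have "real CARD('m) * real CARD('n) / (real CARD('m) + real CARD('n)) \<le> real CARD('m) * real CARD('n) / 1"
    proof (rule divide_left_mono)
      have "1 \<le> real CARD('m)" "0 \<le> real CARD('n)" by simp_all
      then have "1 \<le> real CARD('m) + real CARD('n)" by linarith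
      then show "1 \<le> real CARD('m) + real CARD('n)" "0 < (real CARD('m) + real CARD('n)) * 1" by simp_all
    qed simp
    then show ?thesis by simp
  qed
  with D have D0: "0 < D" by linarith
  define T where "T t = {(\<chi> i j. ?\<rho> * real_of_int (t (i, j)) + point y i j) :: real ^ 'n ^ 'm | y. (\<forall>x. 0 \<le> y x \<and> y x < 1) \<and>
     singular_on_average (\<chi> i j. ?\<rho> * real_of_int (t (i, j)) + point y i j)}" for t :: "'m \<times> 'n \<Rightarrow> int"
  show ?thesis
  proof (rule hausdorff_dim_le)
    fix \<delta> :: real assume \<delta>: "0 < \<delta>"
    have "S \<subseteq> (\<Union>k. T (from_nat k))"
    proof
      fix s assume "s \<in> S"
      then have s: "singular_on_average s" using S by blast
      define t where "t x = \<lfloor>s $ fst x $ snd x / ?\<rho>\<rfloor>" for x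
      define y where "y x = s $ fst x $ snd x / ?\<rho> - real_of_int (t x)" for x
      have y: "0 \<le> y x \<and> y x < 1" for x unfolding y_def t_def by linarith
      have "s $ i $ j = ?\<rho> * real_of_int (t (i, j)) + point y i j" for i j
        using \<rho> by (simp add: point_def y_def right_diff_distrib)
      then have eq: "s = (\<chi> i j. ?\<rho> * real_of_int (t (i, j)) + point y i j)"
        by (simp add: Finite_Cartesian_Product.vec_eq_iff)
      have "s \<in> T t" unfolding T_def using y s eq by blast
      moreover have "t = from_nat (to_nat t)" by simp
      ultimately show "s \<in> (\<Union>k. T (from_nat k))" by (metis UN_I UNIV_I)
    qed
    then have "hausdorff_content D \<delta> S \<le> hausdorff_content D \<delta> (\<Union>k. T (from_nat k))" by (rule hausdorff_content_mono)
    also have "\<dots> \<le> (\<Sum>k. hausdorff_content D \<delta> (T (from_nat k)))" by (rule hausdorff_content_UN)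
    also have "\<dots> = 0"
      unfolding T_def using root_cell_content[OF D D0 \<delta>] by simp
    finally show "hausdorff_content D \<delta> S = 0" by simp
  qed (use D0 in simp)
qed

text \<open>For l > T0 also 2^l > T0, so at most T0 of the first N scales can fail.\<close>

lemma singular_imp_singular_on_average:
  assumes "singular s"
  shows "singular_on_average s"
  unfolding singular_on_average_def
proof (intro allI impI)
  fix \<epsilon> :: real assume "0 < \<epsilon>"
  then obtain T0 :: nat where T0: "\<And>T :: real. real T0 < T \<Longrightarrow> approximable s \<epsilon> T"
    using assms unfolding singular_def by blast
  have "(\<lambda>N. 1 - real T0 / real N) \<longlonglongrightarrow> 1 - 0" by (intro tendsto_diff tendsto_const lim_const_over_n)
  then have low: "(\<lambda>N. 1 - real T0 / real N) \<longlonglongrightarrow> 1" by simp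
  show "(\<lambda>N. real (card {l \<in> {1..N}. approximable s \<epsilon> (2 ^ l)}) / real N) \<longlonglongrightarrow> 1"
  proof (rule tendsto_sandwich[OF _ _ low tendsto_const])
    show "eventually (\<lambda>N. 1 - real T0 / real N \<le> real (card {l \<in> {1..N}. approximable s \<epsilon> (2 ^ l)}) / real N) sequentially"
      using eventually_gt_at_top[of 0]
    proof eventually_elim
      case (elim N)
      have "{T0<..N} \<subseteq> {l \<in> {1..N}. approximable s \<epsilon> (2 ^ l)}"
      proof
        fix l assume l: "l \<in> {T0<..N}"
        have "real T0 < real l" using l by simp
        also have "real l < 2 ^ l" by (rule of_nat_less_two_power)
        finally show "l \<in> {l \<in> {1..N}. approximable s \<epsilon> (2 ^ l)}" using l T0 by auto
      qed
      then have "card {T0<..N} \<le> card {l \<in> {1..N}. approximable s \<epsilon> (2 ^ l)}" by (intro card_mono) auto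
      then have "real N - real T0 \<le> real (card {l \<in> {1..N}. approximable s \<epsilon> (2 ^ l)})" by simp
      then have "(real N - real T0) / real N \<le> real (card {l \<in> {1..N}. approximable s \<epsilon> (2 ^ l)}) / real N"
        by (rule divide_right_mono) simp
      then show ?case using elim by (simp add: diff_divide_distrib)
    qed
    show "eventually (\<lambda>N. real (card {l \<in> {1..N}. approximable s \<epsilon> (2 ^ l)}) / real N \<le> 1) sequentially"
      using eventually_gt_at_top[of 0]
    proof eventually_elim
      case (elim N)
      have "card {l \<in> {1..N}. approximable s \<epsilon> (2 ^ l)} \<le> card {1..N}" by (intro card_mono) auto
      then show ?case using elim by (simp add: divide_le_eq)
    qed
  qed
qed

theorem corollary1p2:
  shows "hausdorff_dim {s :: real ^ 'n ^ 'm. singular_on_average s}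
           \<le> ereal (real CARD('m) * real CARD('n)
                - real CARD('m) * real CARD('n) / (real CARD('m) + real CARD('n)))
       \<and> hausdorff_dim {s :: real ^ 'n ^ 'm. singular s}
           \<le> ereal (real CARD('m) * real CARD('n)
                - real CARD('m) * real CARD('n) / (real CARD('m) + real CARD('n)))"
proof -
  let ?b = "real CARD('m) * real CARD('n) - real CARD('m) * real CARD('n) / (real CARD('m) + real CARD('n))"
  \<comment> \<open>The estimate is available for every \<open>D\<close> strictly above the bound,
    and density of the extended reals yields the bound itself.\<close>
  have "hausdorff_dim S \<le> ereal ?b" if S: "S \<subseteq> {s :: real ^ 'n ^ 'm. singular_on_average s}" for S
  proof (rule dense_ge)
    fix x assume x: "ereal ?b < x"
    show "hausdorff_dim S \<le> x"
    proof (cases x)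
      case (real D)
      then show ?thesis using x singular_on_average_dim_le[OF _ S, of D] by simp
    qed (use x in auto)
  qed
  then show ?thesis using singular_imp_singular_on_average by blast
qed

end
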